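(* Let $\chi_1,\chi_2$ be the two primitive Dirichlet characters modulo $5$ distinct from the Legendre symbol $\left(\frac{\cdot}{5}\right)$, let $\left(\frac{\cdot}{3}\right)$ be the Legendre symbol modulo $3$, and let $\psi$ be the non-principal character modulo $4$. Let $f$ be a meromorphic modular function of integral weight on $\Gamma_0(N)$ with a cuspidal divisor. Then: (i) if $N=9M$ or $N=27M$ with $M$ square-free and coprime to $3$, $f$ is an $\eta,\eta_{(\cdot/3)}$-quotient of level $N$; (ii) if $N=16M$ or $N=32M$ with $M$ odd and square-free, $f$ is an $\eta,\eta_{\psi}$-quotient of level $N$; (iii) if $N=25M$ or $N=125M$ with $M$ square-free and coprime to $5$, $f$ is an $\eta,\eta_{(\cdot/5)},\eta_{\chi_1},\eta_{\chi_2}$-quotient of level $N$.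
   Context: $q=e^{2\pi i\tau}$, $\tau\in\mathcal{H}$ (upper half-plane); all complex powers are defined via the principal branch of the logarithm. $\eta(\tau)=q^{1/24}\prod_{n\ge1}(1-q^n)$. For a Dirichlet character $\chi$ of conductor $u$, $\eta_{\chi}(\tau):=\prod_{n\ge1}\prod_{a=1}^{u}(1-e^{2\pi i a/u}q^n)^{\bar\chi(an)}$. For $t\ge1$, $(g|V_t)(\tau)=g(t\tau)$. Given functions $f_1,\dots,f_d:\mathcal{H}\to\mathbf{C}$, a function $f$ is an $f_1,\dots,f_d$-quotient of level $N$ if there are complex numbers $c$ and $(a_{t,i})_{t\mid N,1\le i\le d}$ with $f=c\prod_{t\mid N}(f_1|V_t)^{a_{t,1}}\cdots(f_d|V_t)^{a_{t,d}}$. A meromorphic modular function of integral weight $k$ on $\Gamma_0(N)=\{\left(\begin{smallmatrix}a&b\\c&d\end{smallmatrix}\right)\in\mathrm{SL}_2(\mathbf{Z}):N\mid c\}$ is a meromorphic $f$ on $\mathcal{H}$ with $f(\frac{a\tau+b}{c\tau+d})=(c\tau+d)^kf(\tau)$ for all such matrices, meromorphic at the cusps; it has a cuspidal divisor if it has no zeros or poles in $\mathcal{H}$.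
   Formalization: Complex powers of the functions f_i|V_t use the continuous logarithm on the upper half-plane that is principal at τ=iy for large y (equivalently, principal powers of each product factor), since pointwise principal powers are discontinuous and make the claim false. *)

theory Defs
  imports
    "HOL-Complex_Analysis.Complex_Analysis"
    "HOL-Number_Theory.Number_Theory"
    "HOL-Computational_Algebra.Squarefree"
begin

definition upper_half_plane :: "complex set" where
  "upper_half_plane = {\<tau>. Im \<tau> > 0}"


subsection \<open>Dirichlet characters\<close>

definition dirichlet_character :: "nat \<Rightarrow> (int \<Rightarrow> complex) \<Rightarrow> bool" where
  "dirichlet_character m chi \<longleftrightarrow> m > 0 \<and>
     (\<forall>n. chi (n + int m) = chi n) \<and>
     (\<forall>a b. chi (a * b) = chi a * chi b) \<and>
     (\<forall>n. chi n \<noteq> 0 \<longleftrightarrow> coprime n (int m))"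

definition principal_character :: "nat \<Rightarrow> int \<Rightarrow> complex" where
  "principal_character m n = (if coprime n (int m) then 1 else 0)"

definition conductor :: "nat \<Rightarrow> (int \<Rightarrow> complex) \<Rightarrow> nat" where
  "conductor m chi = (LEAST d. d > 0 \<and> d dvd m \<and>
     (\<forall>a. coprime a (int m) \<longrightarrow> [a = 1] (mod int d) \<longrightarrow> chi a = 1))"

definition primitive_character :: "nat \<Rightarrow> (int \<Rightarrow> complex) \<Rightarrow> bool" where
  "primitive_character m chi \<longleftrightarrow> dirichlet_character m chi \<and> conductor m chi = m"

definition legendre_character :: "nat \<Rightarrow> int \<Rightarrow> complex" where
  "legendre_character p n = of_int (Legendre n (int p))"


subsection \<open>The functions \<open>\<eta>\<close> and \<open>\<eta>\<^sub>\<chi>\<close>\<close>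

definition nome :: "complex \<Rightarrow> complex" where
  "nome \<tau> = exp (2 * of_real pi * \<i> * \<tau>)"

text \<open>
  As usual, $q^{1/24}$ means $e^{2\pi i\tau/24}$. Since \<^const>\<open>prodinf\<close> starts at \<open>0\<close>,
  the indices are shifted by one.
\<close>
definition dedekind_eta :: "complex \<Rightarrow> complex" where
  "dedekind_eta \<tau> =
     exp (2 * of_real pi * \<i> * \<tau> / 24) * (\<Prod>n. 1 - nome \<tau> ^ Suc n)"

text \<open>
  Here \<open>u\<close> is the conductor of \<open>chi\<close>, i.e. \<open>chi\<close> is a primitive character modulo \<open>u\<close>. Each base
  has positive real part, so \<^term>\<open>(powr)\<close> is the principal power away from its branch cut.
\<close>
definition eta_character :: "nat \<Rightarrow> (int \<Rightarrow> complex) \<Rightarrow> complex \<Rightarrow> complex" where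
  "eta_character u chi \<tau> =
     (\<Prod>n. \<Prod>a=1..u.
        (1 - exp (2 * of_real pi * \<i> * of_nat a / of_nat u) * nome \<tau> ^ Suc n)
          powr cnj (chi (int (a * Suc n))))"


subsection \<open>Quotients of level \<open>N\<close>\<close>

definition V_op :: "nat \<Rightarrow> (complex \<Rightarrow> complex) \<Rightarrow> complex \<Rightarrow> complex" where
  "V_op t g \<tau> = g (of_nat t * \<tau>)"

text \<open>
  The pointwise principal power of \<open>g \<tau>\<close> jumps whenever \<open>g \<tau>\<close> crosses the negative real axis, so
  complex powers of functions are formed with the continuous logarithm of \<open>g\<close> on the upper
  half-plane that is the principal one for \<open>\<tau> = iy\<close> with \<open>y\<close> large. (It is unique on the upper
  half-plane.) For \<open>g = \<eta>\<close> or \<open>g = \<eta>\<^sub>\<chi>\<close> this amounts to taking the principal power of every factor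
  of the product, with $(q^{1/24})^\alpha = e^{2\pi i\alpha\tau/24}$.
\<close>
definition log_branch :: "(complex \<Rightarrow> complex) \<Rightarrow> (complex \<Rightarrow> complex) \<Rightarrow> bool" where
  "log_branch g L \<longleftrightarrow> continuous_on upper_half_plane L \<and>
     (\<forall>\<tau>\<in>upper_half_plane. exp (L \<tau>) = g \<tau>) \<and>
     (\<forall>\<^sub>F y in at_top. L (\<i> * of_real y) = Ln (g (\<i> * of_real y)))"

definition is_complex_power ::
  "(complex \<Rightarrow> complex) \<Rightarrow> complex \<Rightarrow> (complex \<Rightarrow> complex) \<Rightarrow> bool" where
  "is_complex_power g \<alpha> h \<longleftrightarrow>
     (\<exists>L. log_branch g L \<and> (\<forall>\<tau>\<in>upper_half_plane. h \<tau> = exp (\<alpha> * L \<tau>)))"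

definition is_quotient_of_level ::
  "(complex \<Rightarrow> complex) list \<Rightarrow> nat \<Rightarrow> (complex \<Rightarrow> complex) \<Rightarrow> bool" where
  "is_quotient_of_level fs N f \<longleftrightarrow>
     (\<exists>(c :: complex) (a :: nat \<Rightarrow> nat \<Rightarrow> complex) (P :: nat \<Rightarrow> nat \<Rightarrow> complex \<Rightarrow> complex).
        (\<forall>t i. t dvd N \<longrightarrow> i < length fs \<longrightarrow>
           is_complex_power (V_op t (fs ! i)) (a t i) (P t i)) \<and>
        (\<forall>\<tau>\<in>upper_half_plane. f \<tau> = c * (\<Prod>t | t dvd N. \<Prod>i<length fs. P t i \<tau>)))"


subsection \<open>Meromorphic modular functions\<close>

text \<open>The quadruple \<open>(a, b, c, d)\<close> stands for the matrix with rows \<open>(a, b)\<close> and \<open>(c, d)\<close>.\<close>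
definition SL2Z :: "(int \<times> int \<times> int \<times> int) set" where
  "SL2Z = {(a, b, c, d). a * d - b * c = 1}"

definition Gamma0 :: "nat \<Rightarrow> (int \<times> int \<times> int \<times> int) set" where
  "Gamma0 N = {(a, b, c, d). (a, b, c, d) \<in> SL2Z \<and> int N dvd c}"

definition moebius_act :: "int \<times> int \<times> int \<times> int \<Rightarrow> complex \<Rightarrow> complex" where
  "moebius_act = (\<lambda>(a, b, c, d) \<tau>. (of_int a * \<tau> + of_int b) / (of_int c * \<tau> + of_int d))"

definition automorphy_factor :: "int \<times> int \<times> int \<times> int \<Rightarrow> complex \<Rightarrow> complex" where
  "automorphy_factor = (\<lambda>(a, b, c, d) \<tau>. of_int c * \<tau> + of_int d)"

text \<open>
  Equivalently: a Laurent expansion in $q^{1/h} = e^{2\pi i\tau/h}$ with only finitely many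
  negative exponents, valid for all \<open>\<tau>\<close> of sufficiently large imaginary part.
\<close>
definition meromorphic_at_ii_inf :: "(complex \<Rightarrow> complex) \<Rightarrow> bool" where
  "meromorphic_at_ii_inf g \<longleftrightarrow>
     (\<exists>(h :: nat) G B. h > 0 \<and> G meromorphic_on {0} \<and>
        (\<forall>\<tau>. Im \<tau> > B \<longrightarrow> g \<tau> = G (exp (2 * of_real pi * \<i> * \<tau> / of_nat h))))"

definition meromorphic_at_cusps :: "int \<Rightarrow> (complex \<Rightarrow> complex) \<Rightarrow> bool" where
  "meromorphic_at_cusps k f \<longleftrightarrow>
     (\<forall>\<gamma>\<in>SL2Z. meromorphic_at_ii_inf
        (\<lambda>\<tau>. automorphy_factor \<gamma> \<tau> powi (-k) * f (moebius_act \<gamma> \<tau>)))"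

text \<open>
  \<open>nicely_meromorphic_on\<close> only normalises the representative of a meromorphic function: no
  removable singularities, and the value \<open>0\<close> at poles. This makes the pointwise transformation law
  meaningful at poles.
\<close>
definition meromorphic_modular_function :: "int \<Rightarrow> nat \<Rightarrow> (complex \<Rightarrow> complex) \<Rightarrow> bool" where
  "meromorphic_modular_function k N f \<longleftrightarrow>
     f nicely_meromorphic_on upper_half_plane \<and>
     (\<forall>\<gamma>\<in>Gamma0 N. \<forall>\<tau>\<in>upper_half_plane.
        f (moebius_act \<gamma> \<tau>) = automorphy_factor \<gamma> \<tau> powi k * f \<tau>) \<and>
     meromorphic_at_cusps k f"

definition cuspidal_divisor :: "(complex \<Rightarrow> complex) \<Rightarrow> bool" where
  "cuspidal_divisor f \<longleftrightarrow> (\<forall>\<tau>\<in>upper_half_plane. f \<tau> \<noteq> 0 \<and> \<not> is_pole f \<tau>)"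

end

theory Submission
  imports Defs "HOL-Real_Asymp.Real_Asymp"
begin

text \<open>
  Let \<open>u\<close> be \<open>3\<close>, \<open>4\<close> or \<open>5\<close>. The products \<open>\<Prod>n,a. (1 - e\<^bsup>2 pi i a/u\<^esup> q\<^sup>n)\<^bsup>w(an)\<^esup>\<close>, for real \<open>w\<close> on \<open>(\<int>/u)\<^sup>*\<close> of sum \<open>0\<close>, are
  products of Siegel functions, so their absolute values are invariant under \<open>\<Gamma>\<^sub>0(u\<^sup>2)\<close> and have orders at the
  cusps; they are also products of complex powers of the \<open>\<eta>\<^sub>\<chi>\<close>. Together with the functions \<open>\<eta>(t \<tau>)\<close> they give as many functions of level \<open>N\<close> as there are cusps of \<open>\<Gamma>\<^sub>0(N)\<close>, since
  \<open>gcd \<delta> (N/\<delta>)\<close> is \<open>u\<close> or has totient \<open>1\<close> for each \<open>\<delta>\<close> dividing \<open>N\<close>. Hence the orders of these functions and of \<open>f\<close> at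
  the cusps satisfy a nontrivial real linear relation. By the maximum principle the corresponding
  multiplicative combination is constant, and it involves \<open>f\<close> because the \<open>q\<close>-expansions of the other
  functions are multiplicatively independent.
\<close>

section \<open>Infinite products\<close>

text \<open>Passing to absolute values removes multiplier systems and admits real exponents, so the
  orders at the cusps are real numbers and plain linear algebra applies. The count is one function
  \<eta>(t \<tau>) for each divisor t of N and totient u - 1 Siegel products for each divisor of
  N/u^2. This is at least the number of cusp classes, and f adds one more, which forces a relation
  between the orders. The relation kills the orders but says nothing about the weight of the
  combination, which may be any real number. The maximum principle is therefore proved for functions
  ln |g| + \<kappa> ln Im \<tau> that need not be harmonic, and \<kappa> = 0 is part of its
  conclusion. Multiplicative independence is read off at the coefficients of q^(t p^k) for a prime p
  that is coprime to N and generates the units modulo u: coprimality isolates t, and the powers of p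
  reach every unit because the unit group is cyclic. Complex exponents arise only at the end, when
  real functions on the units of sum 0 are written as combinations of conjugate characters.\<close>

definition qpoch :: "complex \<Rightarrow> complex \<Rightarrow> complex" where
  "qpoch w q = (\<Prod>n. 1 - w * q ^ n)"

lemma qpoch_abs_convergent:
  fixes q w :: complex
  assumes "norm q < 1" shows "abs_convergent_prod (\<lambda>n. 1 - w * q ^ n)"
proof -
  have "summable (\<lambda>n. norm w * norm q ^ n)"
    using assms by (intro summable_mult summable_geometric) simp
  then show ?thesis
    by (intro summable_imp_abs_convergent_prod) (simp add: norm_mult norm_power)
qed

lemma qpoch_has_prod:
  assumes "norm q < 1" shows "(\<lambda>n. 1 - w * q ^ n) has_prod qpoch w q"
  unfolding qpoch_def
  by (intro convergent_prod_has_prod abs_convergent_prod_imp_convergent_prod qpoch_abs_convergent assms)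

lemma qpoch_tendsto:
  assumes "norm q < 1" shows "(\<lambda>N. \<Prod>n<N. 1 - w * q ^ n) \<longlonglongrightarrow> qpoch w q"
  using has_prod_imp_tendsto'[OF qpoch_has_prod[OF assms]] .

lemma qpoch_eq_0_iff:
  assumes "norm q < 1" shows "qpoch w q = 0 \<longleftrightarrow> (\<exists>n. w * q ^ n = 1)"
  using has_prod_eq_0_iff[OF qpoch_has_prod[OF assms], of w] by (force simp: image_iff)

lemma qpoch_rec:
  assumes "norm q < 1" shows "qpoch w q = (1 - w) * qpoch (w * q) q"
proof -
  have "(\<lambda>n. 1 - w * q ^ Suc n) has_prod qpoch (w * q) q"
    using qpoch_has_prod[OF assms, of "w * q"] by (simp add: mult_ac)
  then have "(\<lambda>n. 1 - w * q ^ n) has_prod (qpoch (w * q) q * (1 - w * q ^ 0))"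
    by (rule has_prod_Suc_imp)
  with qpoch_has_prod[OF assms, of w] show ?thesis
    by (metis has_prod_unique2 mult.commute mult.right_neutral power_0)
qed

lemma qpoch_nonzero:
  assumes "norm q < 1" "norm w < 1" shows "qpoch w q \<noteq> 0"
proof
  assume "qpoch w q = 0"
  then obtain n where "w * q ^ n = 1" using qpoch_eq_0_iff assms by blast
  then have "norm w * norm q ^ n = 1" by (metis norm_mult norm_one norm_power)
  moreover have "norm w * norm q ^ n \<le> norm w * 1"
    using assms by (intro mult_left_mono power_le_one) auto
  ultimately show False using assms by simp
qed

lemma qpoch_holomorphic:
  assumes q: "norm q < 1" shows "(\<lambda>w. qpoch w q) holomorphic_on UNIV"
proof (rule holomorphic_uniform_sequence[where f = "\<lambda>N w. \<Prod>n<N. 1 - w * q ^ n"])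
  fix x :: complex
  have "uniformly_convergent_on (cball x 1) (\<lambda>N w. \<Prod>n<N. 1 - w * q ^ n)"
  proof (rule uniformly_convergent_on_prod')
    show "uniformly_convergent_on (cball x 1) (\<lambda>N w. \<Sum>n<N. norm (1 - w * q ^ n - 1))"
    proof (rule Weierstrass_m_test')
      fix n :: nat and w :: complex assume "w \<in> cball x 1"
      then have "norm (w - x) \<le> 1" by (simp add: dist_norm norm_minus_commute)
      then have "norm w \<le> norm x + 1" using norm_triangle_sub[of w x] by linarith
      then show "norm (norm (1 - w * q ^ n - 1)) \<le> (norm x + 1) * norm q ^ n"
        by (simp add: norm_mult norm_power mult_right_mono)
    qed (use q in \<open>auto intro!: summable_mult summable_geometric\<close>)
  qed (auto intro!: continuous_intros)
  then have "uniform_limit (cball x 1) (\<lambda>N w. \<Prod>n<N. 1 - w * q ^ n)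
      (\<lambda>w. lim (\<lambda>N. \<Prod>n<N. 1 - w * q ^ n)) sequentially"
    by (simp add: uniformly_convergent_uniform_limit_iff)
  moreover have "lim (\<lambda>N. \<Prod>n<N. 1 - w * q ^ n) = qpoch w q" for w
    using qpoch_tendsto[OF q] by (rule limI)
  ultimately show "\<exists>d>0. cball x d \<subseteq> UNIV \<and> uniform_limit (cball x d) (\<lambda>N w. \<Prod>n<N. 1 - w * q ^ n)
      (\<lambda>w. qpoch w q) sequentially"
    by (intro exI[of _ 1]) simp
qed (auto intro!: holomorphic_intros)

lemma qpoch_holomorphic_compose [holomorphic_intros]:
  assumes "norm q < 1" "f holomorphic_on A" shows "(\<lambda>z. qpoch (f z) q) holomorphic_on A"
  using holomorphic_on_compose_gen[OF assms(2) qpoch_holomorphic[OF assms(1)]] by (simp add: o_def)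

text \<open>Separates the factors of even and odd index. The partial products of length 2N already
  split in this way, so passing to that subsequence is enough.\<close>

lemma qpoch_even_odd:
  assumes q: "norm q < 1" shows "qpoch w q = qpoch w (q\<^sup>2) * qpoch (w * q) (q\<^sup>2)"
proof -
  have q2: "norm (q\<^sup>2) < 1" using q by (simp add: norm_power power_less_one_iff)
  have *: "(\<Prod>n<2*N. 1 - w * q ^ n) = (\<Prod>n<N. 1 - w * (q\<^sup>2) ^ n) * (\<Prod>n<N. 1 - w * q * (q\<^sup>2) ^ n)" for N
    by (induction N) (simp_all add: power_mult[symmetric] mult_ac)
  have "(\<lambda>N. \<Prod>n<2*N. 1 - w * q ^ n) \<longlonglongrightarrow> qpoch w q"
    using LIMSEQ_subseq_LIMSEQ[OF qpoch_tendsto[OF q], of "\<lambda>n. 2 * n" w]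
    by (simp add: o_def strict_mono_def)
  moreover have "(\<lambda>N. \<Prod>n<2*N. 1 - w * q ^ n) \<longlonglongrightarrow> qpoch w (q\<^sup>2) * qpoch (w * q) (q\<^sup>2)"
    unfolding * by (intro tendsto_mult qpoch_tendsto q2)
  ultimately show ?thesis by (rule LIMSEQ_unique)
qed

lemma qpoch_mult_neg:
  assumes q: "norm q < 1" shows "qpoch w q * qpoch (-w) q = qpoch (w\<^sup>2) (q\<^sup>2)"
proof -
  have q2: "norm (q\<^sup>2) < 1" using q by (simp add: norm_power power_less_one_iff)
  have "(\<lambda>N. (\<Prod>n<N. 1 - w * q ^ n) * (\<Prod>n<N. 1 - (-w) * q ^ n)) \<longlonglongrightarrow> qpoch w q * qpoch (-w) q"
    by (intro tendsto_mult qpoch_tendsto q)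
  also have "(\<lambda>N. (\<Prod>n<N. 1 - w * q ^ n) * (\<Prod>n<N. 1 - (-w) * q ^ n)) = (\<lambda>N. \<Prod>n<N. 1 - w\<^sup>2 * (q\<^sup>2) ^ n)"
    by (simp add: prod.distrib[symmetric] algebra_simps power2_eq_square power_mult_distrib)
  finally show ?thesis using LIMSEQ_unique qpoch_tendsto[OF q2] by blast
qed

text \<open>Euler's identity: the product of all (1 + q^n) (1 - q^(2n-1)), n \<ge> 1, is 1. The
  factors with p and -p combine to \<open>qpoch q (q\<^sup>2)\<close>, and
  \<open>qpoch (q\<^sup>2) (q\<^sup>2)\<close> is cancelled. The square root p of q appears because
  the half periods \<tau>/2 and (1 + \<tau>)/2 have the nomes p and -p.\<close>

lemma qpoch_euler:
  assumes q: "norm q < 1" and p: "p\<^sup>2 = q" shows "qpoch (-q) q * qpoch p q * qpoch (-p) q = 1"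
proof -
  have q2: "norm (q\<^sup>2) < 1" using q by (simp add: norm_power power_less_one_iff)
  have 1: "qpoch p q * qpoch (-p) q = qpoch q (q\<^sup>2)" using qpoch_mult_neg[OF q, of p] p by simp
  have 2: "qpoch q q = qpoch q (q\<^sup>2) * qpoch (q\<^sup>2) (q\<^sup>2)" using qpoch_even_odd[OF q, of q] by (simp add: power2_eq_square)
  have 3: "qpoch q q * qpoch (-q) q = qpoch (q\<^sup>2) (q\<^sup>2)" by (rule qpoch_mult_neg[OF q])
  have 4: "qpoch (q\<^sup>2) (q\<^sup>2) \<noteq> 0" using q2 qpoch_nonzero by blast
  have "(qpoch (-q) q * qpoch q (q\<^sup>2)) * qpoch (q\<^sup>2) (q\<^sup>2) = 1 * qpoch (q\<^sup>2) (q\<^sup>2)"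
    using 3 unfolding 2 by (simp add: mult_ac)
  then show ?thesis using 4 1 by (simp only: mult_cancel_right mult.assoc) simp
qed

section \<open>The nome as a homomorphism with kernel the integers\<close>

lemma nome_add: "nome (a + b) = nome a * nome b"
  by (simp add: nome_def exp_add[symmetric] algebra_simps)

lemma nome_minus: "nome (- a) = inverse (nome a)"
  by (simp add: nome_def exp_minus)

lemma nome_nonzero [simp]: "nome a \<noteq> 0"
  by (simp add: nome_def)

lemma nome_of_int [simp]: "nome (of_int n) = 1"
  unfolding nome_def exp_eq_1 by auto

lemma nome_one [simp]: "nome 1 = 1" and nome_zero [simp]: "nome 0 = 1"
  using nome_of_int[of 1] nome_of_int[of 0] by simp_all

lemma nome_eq_1_iff: "nome z = 1 \<longleftrightarrow> (\<exists>n::int. z = of_int n)"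
proof
  assume "nome z = 1"
  then obtain n :: int where "Re (2 * of_real pi * \<i> * z) = 0" "Im (2 * of_real pi * \<i> * z) = of_int (2 * n) * pi"
    unfolding nome_def exp_eq_1 by auto
  then have "Im z = 0" "Re z = of_int n" by auto
  then show "\<exists>n::int. z = of_int n" by (auto simp: complex_eq_iff)
qed auto

lemma norm_nome: "norm (nome z) = exp (- 2 * pi * Im z)"
  by (simp add: nome_def norm_exp_eq_Re)

lemma norm_nome_less_1: "Im \<tau> > 0 \<Longrightarrow> norm (nome \<tau>) < 1"
  by (simp add: norm_nome)

lemma nome_of_nat_mult: "nome (of_nat n * z) = nome z ^ n"
  by (simp add: nome_def exp_of_nat_mult[symmetric] mult_ac)

lemma nome_holomorphic [holomorphic_intros]: "f holomorphic_on A \<Longrightarrow> (\<lambda>z. nome (f z)) holomorphic_on A"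
  unfolding nome_def by (intro holomorphic_intros)

section \<open>Klein forms and Siegel functions\<close>

text \<open>For fixed \<tau> this is a constant multiple of the Weierstrass sigma function times
  some exp(c z^2). The term pi z^2 / (2 Im \<tau>) is chosen so that the absolute value is a lattice
  periodic function times exp(pi |z|^2 / (2 Im \<tau>)), a Gaussian that is unchanged when (z,
  \<tau>) is replaced by its image (z/j, \<tau>') under a modular transformation. The function is
  entire in z, which is all that Liouville's theorem asks for.\<close>

definition klein_form :: "complex \<Rightarrow> complex \<Rightarrow> complex" where
  "klein_form \<tau> z = exp (of_real pi * z\<^sup>2 / (2 * of_real (Im \<tau>)) - of_real pi * \<i> * z + of_real pi * \<i> * \<tau> / 6) *
     (qpoch (nome z) (nome \<tau>) * qpoch (nome \<tau> * nome (-z)) (nome \<tau>))"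

text \<open>The absolute value of the Siegel function \<open>g\<^bsub>(x,y)\<^esub>(\<tau>)\<close> with \<open>z = x \<tau> + y\<close>.\<close>
definition siegel_abs :: "complex \<Rightarrow> complex \<Rightarrow> real" where
  "siegel_abs \<tau> z = exp (- pi * (Im z)\<^sup>2 / Im \<tau> + pi * Im z - pi * Im \<tau> / 6) *
     (norm (qpoch (nome z) (nome \<tau>)) * norm (qpoch (nome \<tau> * nome (-z)) (nome \<tau>)))"

text \<open>Rests on Re (z^2) = |z|^2 - 2 (Im z)^2. If Im \<tau> = 0, the quotients by Im \<tau> are
  0 by the convention for division by zero, and the two sides still agree.\<close>

lemma norm_klein_form: "norm (klein_form \<tau> z) = siegel_abs \<tau> z * exp (pi * (norm z)\<^sup>2 / (2 * Im \<tau>))"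
proof (cases "Im \<tau> = 0")
  case False
  have "Re (of_real pi * z\<^sup>2 / (2 * of_real (Im \<tau>)) - of_real pi * \<i> * z + of_real pi * \<i> * \<tau> / 6)
    = pi * ((Re z)\<^sup>2 - (Im z)\<^sup>2) / (2 * Im \<tau>) + pi * Im z - pi * Im \<tau> / 6"
    by (simp add: Re_divide_of_real[of _ "2 * Im \<tau>", simplified] power2_eq_square)
  also have "\<dots> = (- pi * (Im z)\<^sup>2 / Im \<tau> + pi * Im z - pi * Im \<tau> / 6) + pi * (norm z)\<^sup>2 / (2 * Im \<tau>)"
    using False by (simp add: cmod_power2 field_simps)
  finally have *: "Re (of_real pi * z\<^sup>2 / (2 * of_real (Im \<tau>)) - of_real pi * \<i> * z + of_real pi * \<i> * \<tau> / 6) = \<dots>" .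
  show ?thesis
    unfolding klein_form_def siegel_abs_def norm_mult norm_exp_eq_Re * exp_add[of _ "pi * (norm z)\<^sup>2 / (2 * Im \<tau>)"] by simp
qed (simp add: klein_form_def siegel_abs_def norm_mult norm_exp_eq_Re exp_add)

lemma klein_form_holomorphic: "Im \<tau> > 0 \<Longrightarrow> klein_form \<tau> holomorphic_on UNIV"
  unfolding klein_form_def by (intro holomorphic_intros norm_nome_less_1) auto

lemma siegel_abs_add_1: "siegel_abs \<tau> (z + 1) = siegel_abs \<tau> z"
  using nome_add[of z 1] nome_add[of "-z" "-1"] nome_minus[of 1] by (simp add: siegel_abs_def)

text \<open>Translation by \<tau> moves one factor between the two products. With w =
  \<open>nome z\<close>, the relation |1 - 1/w| = |1 - w| exp(2 pi Im z) is offset exactly by the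
  change of the quadratic exponent.\<close>

lemma siegel_abs_add_tau:
  assumes "Im \<tau> > 0" shows "siegel_abs \<tau> (z + \<tau>) = siegel_abs \<tau> z"
proof -
  let ?q = "nome \<tau>" and ?w = "nome z"
  note q = norm_nome_less_1[OF assms]
  have 1: "qpoch ?w ?q = (1 - ?w) * qpoch (nome (z + \<tau>)) ?q"
    using qpoch_rec[OF q, of ?w] by (simp add: nome_add)
  have "?q * nome (- (z + \<tau>)) = nome (-z)" by (simp add: nome_add[symmetric])
  moreover have "nome (-z) * ?q = ?q * nome (-z)" by simp
  ultimately have 2: "qpoch (?q * nome (- (z + \<tau>))) ?q = (1 - inverse ?w) * qpoch (?q * nome (- z)) ?q"
    using qpoch_rec[OF q, of "nome (-z)"]
    by (simp add: nome_minus mult.commute)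
  have "1 - inverse ?w = - (1 - ?w) * inverse ?w" by (simp add: field_simps)
  then have 3: "norm (1 - inverse ?w) = norm (1 - ?w) * exp (2 * pi * Im z)"
    by (simp add: norm_mult norm_inverse norm_nome exp_minus norm_minus_commute)
  have 4: "- pi * (Im (z + \<tau>))\<^sup>2 / Im \<tau> + pi * Im (z + \<tau>) - pi * Im \<tau> / 6 + 2 * pi * Im z =
     - pi * (Im z)\<^sup>2 / Im \<tau> + pi * Im z - pi * Im \<tau> / 6"
    using assms by (simp add: field_simps power2_eq_square)
  show ?thesis unfolding siegel_abs_def 1 2 norm_mult 3 unfolding 4[symmetric] exp_add by (simp add: mult_ac)
qed

lemma siegel_abs_lattice:
  assumes "Im \<tau> > 0" shows "siegel_abs \<tau> (z + of_int m + of_int n * \<tau>) = siegel_abs \<tau> z"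
proof -
  have 1: "siegel_abs \<tau> (z + of_int m) = siegel_abs \<tau> z" for z
  proof (induction m arbitrary: z rule: int_induct[where k = 0])
    case (step1 i) then show ?case using siegel_abs_add_1[of \<tau> "z + of_int i"] by (simp add: add_ac)
  next
    case (step2 i) then show ?case using siegel_abs_add_1[of \<tau> "z + of_int (i - 1)"] by (simp add: algebra_simps)
  qed auto
  have "siegel_abs \<tau> (z + of_int n * \<tau>) = siegel_abs \<tau> z" for z
  proof (induction n arbitrary: z rule: int_induct[where k = 0])
    case (step1 i) then show ?case using siegel_abs_add_tau[OF assms, of "z + of_int i * \<tau>"] by (simp add: algebra_simps)
  next
    case (step2 i) then show ?case using siegel_abs_add_tau[OF assms, of "z + of_int (i - 1) * \<tau>"] by (simp add: algebra_simps)
  qed auto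
  then show ?thesis using 1 by (metis (no_types))
qed

lemma siegel_abs_zero: "Im \<tau> > 0 \<Longrightarrow> siegel_abs \<tau> 0 = 0"
  by (simp add: siegel_abs_def qpoch_eq_0_iff norm_nome_less_1) (metis power_0)

text \<open>A convergent product vanishes only through one of its factors. The first product yields
  the lattice points whose coefficient of \<tau> is at most 0, the second those with positive
  coefficient.\<close>

lemma siegel_abs_eq_0_imp:
  assumes "Im \<tau> > 0" "siegel_abs \<tau> z = 0" shows "\<exists>m n::int. z = of_int m + of_int n * \<tau>"
proof -
  note q = norm_nome_less_1[OF assms(1)]
  from assms(2) consider n where "nome z * nome \<tau> ^ n = 1" | n where "nome \<tau> * nome (-z) * nome \<tau> ^ n = 1"
    by (auto simp: siegel_abs_def qpoch_eq_0_iff[OF q])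
  then show ?thesis
  proof cases
    case 1
    then have "nome (z + of_nat n * \<tau>) = 1" by (simp add: nome_add nome_of_nat_mult)
    then obtain m :: int where "z + of_nat n * \<tau> = of_int m" by (auto simp: nome_eq_1_iff)
    then have "z = of_int m + of_int (- int n) * \<tau>" by (simp add: algebra_simps)
    then show ?thesis by blast
  next
    case 2
    then have "nome (\<tau> + (-z) + of_nat n * \<tau>) = 1" by (simp add: nome_add nome_of_nat_mult del: add_uminus_conv_diff)
    then obtain m :: int where "\<tau> + (-z) + of_nat n * \<tau> = of_int m" by (auto simp: nome_eq_1_iff)
    then have "z = of_int (-m) + of_int (int n + 1) * \<tau>" by (simp add: algebra_simps add_eq_0_iff)
    then show ?thesis by blast
  qed
qed

text \<open>The zero at 0 comes from the single factor \<open>1 - nome z\<close>; what remains takes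
  the value \<eta>(\<tau>)^2 there. Through this derivative the transformation of the Klein form
  carries over to \<eta>.\<close>

lemma klein_form_deriv_0:
  assumes "Im \<tau> > 0"
  shows "(klein_form \<tau> has_field_derivative
    (- 2 * of_real pi * \<i> * (exp (of_real pi * \<i> * \<tau> / 6) * (qpoch (nome \<tau>) (nome \<tau>))\<^sup>2))) (at 0)"
proof -
  note q = norm_nome_less_1[OF assms(1)]
  define k1 where "k1 = (\<lambda>z. exp (of_real pi * z\<^sup>2 / (2 * of_real (Im \<tau>)) - of_real pi * \<i> * z + of_real pi * \<i> * \<tau> / 6) *
     (qpoch (nome z * nome \<tau>) (nome \<tau>) * qpoch (nome \<tau> * nome (-z)) (nome \<tau>)))"
  have "k1 holomorphic_on UNIV"
    unfolding k1_def by (intro holomorphic_intros q) (use assms in auto)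
  then obtain D where D: "(k1 has_field_derivative D) (at 0)"
    by (metis UNIV_I holomorphic_on_def at_within_open open_UNIV field_differentiable_def)
  have eq: "klein_form \<tau> = (\<lambda>z. (1 - nome z) * k1 z)"
  proof
    fix z show "klein_form \<tau> z = (1 - nome z) * k1 z"
      unfolding klein_form_def k1_def qpoch_rec[OF q, of "nome z"] by (simp only: mult_ac)
  qed
  have n: "((\<lambda>z. 1 - nome z) has_field_derivative - 2 * of_real pi * \<i>) (at 0)"
    unfolding nome_def by (rule derivative_eq_intros | simp)+
  have "(klein_form \<tau> has_field_derivative - 2 * of_real pi * \<i> * k1 0) (at 0)"
    unfolding eq using DERIV_mult[OF n D] by simp
  then show ?thesis by (simp add: k1_def power2_eq_square)
qed

text \<open>Periodicity is known only for absolute values, so the difference quotients at l and at 0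
  are compared in absolute value: |k'(l)| = |k'(0)| exp(pi |l|^2 / (2 Im \<tau>)).\<close>

lemma klein_form_deriv_lattice:
  assumes "Im \<tau> > 0" "klein_form \<tau> l = 0" shows "deriv (klein_form \<tau>) l \<noteq> 0"
proof -
  have "siegel_abs \<tau> l = 0" using assms norm_klein_form[of \<tau> l] by simp
  then obtain m n :: int where l: "l = of_int m + of_int n * \<tau>" using siegel_abs_eq_0_imp assms by blast
  define D0 where "D0 = - 2 * of_real pi * \<i> * (exp (of_real pi * \<i> * \<tau> / 6) * (qpoch (nome \<tau>) (nome \<tau>))\<^sup>2)"
  have D0: "D0 \<noteq> 0" using norm_nome_less_1[OF assms(1)] qpoch_nonzero by (simp add: D0_def)
  have k0: "klein_form \<tau> 0 = 0" using norm_klein_form[of \<tau> 0] siegel_abs_zero[OF assms(1)] by simp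
  have nk: "norm (klein_form \<tau> (l + h)) = norm (klein_form \<tau> h) * exp (pi * ((norm (l + h))\<^sup>2 - (norm h)\<^sup>2) / (2 * Im \<tau>))" for h
  proof -
    have "siegel_abs \<tau> (l + h) = siegel_abs \<tau> h" using siegel_abs_lattice[OF assms(1), of h m n] l by (simp add: add_ac)
    then show ?thesis unfolding norm_klein_form
      by (simp add: mult.assoc exp_add[symmetric] diff_divide_distrib right_diff_distrib)
  qed
  have "(\<lambda>h. (klein_form \<tau> (0 + h) - klein_form \<tau> 0) / h) \<midarrow>0\<rightarrow> D0"
    using klein_form_deriv_0[OF assms(1)] unfolding DERIV_def D0_def .
  then have 1: "(\<lambda>h. norm (klein_form \<tau> h / h)) \<midarrow>0\<rightarrow> norm D0" using k0 by (auto intro: tendsto_norm)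
  have 2: "(\<lambda>h. exp (pi * ((norm (l + h))\<^sup>2 - (norm h)\<^sup>2) / (2 * Im \<tau>))) \<midarrow>0\<rightarrow>
     exp (pi * ((norm (l + 0))\<^sup>2 - (norm (0::complex))\<^sup>2) / (2 * Im \<tau>))"
    using assms by (intro tendsto_intros) auto
  have "klein_form \<tau> field_differentiable at l"
    using klein_form_holomorphic[OF assms(1)] by (simp add: holomorphic_on_def)
  then have "(klein_form \<tau> has_field_derivative deriv (klein_form \<tau>) l) (at l)" by (simp add: DERIV_deriv_iff_field_differentiable)
  then have "(\<lambda>h. (klein_form \<tau> (l + h) - klein_form \<tau> l) / h) \<midarrow>0\<rightarrow> deriv (klein_form \<tau>) l" unfolding DERIV_def .
  then have "(\<lambda>h. norm (klein_form \<tau> (l + h) / h)) \<midarrow>0\<rightarrow> norm (deriv (klein_form \<tau>) l)" using assms(2) by (auto intro: tendsto_norm)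
  moreover have "(\<lambda>h. norm (klein_form \<tau> (l + h) / h)) = (\<lambda>h. norm (klein_form \<tau> h / h) * exp (pi * ((norm (l + h))\<^sup>2 - (norm h)\<^sup>2) / (2 * Im \<tau>)))"
    by (simp add: norm_divide nk)
  ultimately have "norm (deriv (klein_form \<tau>) l) = norm D0 * exp (pi * ((norm (l + 0))\<^sup>2 - (norm (0::complex))\<^sup>2) / (2 * Im \<tau>))"
    using tendsto_mult[OF 1 2] by (metis (no_types, lifting) LIM_unique)
  moreover have "norm D0 * exp (pi * ((norm (l + 0))\<^sup>2 - (norm (0::complex))\<^sup>2) / (2 * Im \<tau>)) \<noteq> 0"
    using D0 by (simp only: mult_eq_0_iff norm_eq_zero exp_not_eq_zero) simp
  ultimately show ?thesis by (metis norm_zero)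
qed

text \<open>At a common zero a both functions are divided by z - a, which makes the denominator
  nonzero at a; the new values there are the derivatives, as in l'Hospital's rule.\<close>

lemma holomorphic_quotient_simple_zeros:
  assumes f: "f holomorphic_on UNIV" and g: "g holomorphic_on UNIV"
    and z: "\<And>z. g z = 0 \<Longrightarrow> f z = 0 \<and> deriv g z \<noteq> 0"
  shows "(\<lambda>z. if g z = 0 then deriv f z / deriv g z else f z / g z) holomorphic_on UNIV" (is "?R holomorphic_on _")
proof -
  have "?R field_differentiable at a" for a
  proof (cases "g a = 0")
    case False
    have "continuous_on UNIV g" using g by (rule holomorphic_on_imp_continuous_on)
    then have op: "open {z. g z \<noteq> 0}" by (simp add: open_Collect_neq)
    have "(\<lambda>z. f z / g z) holomorphic_on {z. g z \<noteq> 0}"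
      using f g by (intro holomorphic_intros) (auto elim: holomorphic_on_subset)
    then have "?R holomorphic_on {z. g z \<noteq> 0}" by (rule holomorphic_transform) auto
    then show ?thesis using op False by (simp add: holomorphic_on_open field_differentiable_def)
  next
    case True
    have fa: "f a = 0" and ga: "g a = 0" and dg: "deriv g a \<noteq> 0" using z True by auto
    define F where "F = (\<lambda>z. if z = a then deriv f a else f z / (z - a))"
    define G where "G = (\<lambda>z. if z = a then deriv g a else g z / (z - a))"
    have "F holomorphic_on UNIV" unfolding F_def
      using pole_theorem[of f UNIV a "\<lambda>z. f z / (z - a)"] f fa by (simp cong: if_cong)
    moreover have G: "G holomorphic_on UNIV" unfolding G_def
      using pole_theorem[of g UNIV a "\<lambda>z. g z / (z - a)"] g ga by (simp cong: if_cong)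
    moreover have op: "open {z. G z \<noteq> 0}"
      using holomorphic_on_imp_continuous_on[OF G] by (simp add: open_Collect_neq)
    ultimately have "(\<lambda>z. F z / G z) holomorphic_on {z. G z \<noteq> 0}"
      by (intro holomorphic_intros) (auto elim: holomorphic_on_subset)
    then have "?R holomorphic_on {z. G z \<noteq> 0}"
      by (rule holomorphic_transform) (auto simp: F_def G_def ga split: if_splits)
    then show ?thesis using op dg by (simp add: holomorphic_on_open field_differentiable_def G_def)
  qed
  then show ?thesis by (simp add: holomorphic_on_def)
qed

section \<open>Transformation under the modular group\<close>

text \<open>Modulo the lattice the three nonzero half periods are permuted by SL2(Z), so their
  product can be compared at \<tau> and \<tau>'. The exponents -1/6 + 1/12 + 1/12 cancel, Euler's
  identity removes the products, and the 2 is the factor 1 - (-1) at z = 1/2.\<close>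

lemma half_period_product:
  assumes "Im \<tau> > 0" shows "siegel_abs \<tau> (1/2) * siegel_abs \<tau> (\<tau>/2) * siegel_abs \<tau> ((1 + \<tau>)/2) = 2"
proof -
  define q p where "q = nome \<tau>" and "p = nome (\<tau>/2)"
  have q: "norm q < 1" unfolding q_def by (rule norm_nome_less_1[OF assms])
  have p: "p\<^sup>2 = q" using nome_of_nat_mult[of 2 "\<tau>/2"] by (simp add: p_def q_def)
  have p0: "p \<noteq> 0" by (simp add: p_def)
  have m1: "nome (1/2) = -1" by (simp add: nome_def)
  have m2: "nome (-(1/2)) = -1" unfolding nome_minus m1 by simp
  have e1: "qpoch (-1) q = 2 * qpoch (-q) q" using qpoch_rec[OF q, of "-1"] by simp
  have 1: "siegel_abs \<tau> (1/2) = 2 * exp (- pi * Im \<tau> / 6) * (norm (qpoch (-q) q))\<^sup>2"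
    unfolding siegel_abs_def m1 m2 q_def[symmetric] e1 by (simp add: norm_mult power2_eq_square)
  have n2: "nome \<tau> * nome (-(\<tau>/2)) = p"
    by (simp add: nome_add[symmetric] p_def)
  have 2: "siegel_abs \<tau> (\<tau>/2) = exp (pi * Im \<tau> / 12) * (norm (qpoch p q))\<^sup>2"
  proof -
    have "- pi * (Im (\<tau>/2))\<^sup>2 / Im \<tau> + pi * Im (\<tau>/2) - pi * Im \<tau> / 6 = pi * Im \<tau> / 12"
      using assms by (simp add: field_simps power2_eq_square)
    then show ?thesis unfolding siegel_abs_def n2 by (simp add: q_def p_def power2_eq_square)
  qed
  have n3: "nome ((1 + \<tau>)/2) = - p" using nome_add[of "1/2" "\<tau>/2"] m1 by (simp add: p_def add_divide_distrib)
  have "nome \<tau> * nome (-((1 + \<tau>)/2)) = - p"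
  proof -
    have "nome \<tau> * nome (-((1 + \<tau>)/2)) = nome (-(1/2) + \<tau>/2)"
      unfolding nome_add[symmetric] by (simp add: field_simps)
    also have "\<dots> = - p" unfolding nome_add m2 by (simp add: p_def)
    finally show ?thesis .
  qed
  note n4 = this
  have 3: "siegel_abs \<tau> ((1 + \<tau>)/2) = exp (pi * Im \<tau> / 12) * (norm (qpoch (-p) q))\<^sup>2"
  proof -
    have "- pi * (Im ((1+\<tau>)/2))\<^sup>2 / Im \<tau> + pi * Im ((1+\<tau>)/2) - pi * Im \<tau> / 6 = pi * Im \<tau> / 12"
      using assms by (simp add: field_simps power2_eq_square)
    then show ?thesis unfolding siegel_abs_def n3 n4 by (simp add: q_def power2_eq_square)
  qed
  have "siegel_abs \<tau> (1/2) * siegel_abs \<tau> (\<tau>/2) * siegel_abs \<tau> ((1 + \<tau>)/2) =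
    2 * (exp (- pi * Im \<tau> / 6) * exp (pi * Im \<tau> / 12) * exp (pi * Im \<tau> / 12)) * (norm (qpoch (-q) q * qpoch p q * qpoch (-p) q))\<^sup>2"
    unfolding 1 2 3 norm_mult by (simp add: power_mult_distrib)
  also have "exp (- pi * Im \<tau> / 6) * exp (pi * Im \<tau> / 12) * exp (pi * Im \<tau> / 12) = 1"
    unfolding exp_add[symmetric] by simp
  finally show ?thesis unfolding qpoch_euler[OF q p] by simp
qed

lemma denominator_nonzero:
  fixes a b c d :: int
  assumes "a * d - b * c = 1" "Im \<tau> > 0" shows "of_int c * \<tau> + of_int d \<noteq> 0"
proof
  assume 0: "of_int c * \<tau> + of_int d = 0"
  then have "Im (of_int c * \<tau> + of_int d) = 0" by simp
  then have "c = 0" using assms(2) by simp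
  moreover from this 0 have "d = 0" by simp
  ultimately show False using assms(1) by simp
qed

lemma Im_moebius:
  fixes a b c d :: int
  assumes "a * d - b * c = 1" "Im \<tau> > 0"
  shows "Im ((of_int a * \<tau> + of_int b) / (of_int c * \<tau> + of_int d)) = Im \<tau> / (norm (of_int c * \<tau> + of_int d))\<^sup>2"
proof -
  have "real_of_int (a * d - b * c) = 1" using assms(1) by simp
  then have det: "real_of_int a * real_of_int d = 1 + real_of_int b * real_of_int c" by simp
  have "Im ((of_int a * \<tau> + of_int b) / (of_int c * \<tau> + of_int d)) =
    (of_int a * Im \<tau> * (of_int c * Re \<tau> + of_int d) - (of_int a * Re \<tau> + of_int b) * (of_int c * Im \<tau>)) / (norm (of_int c * \<tau> + of_int d))\<^sup>2"
    by (simp add: Im_divide cmod_power2)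
  also have "of_int a * Im \<tau> * (of_int c * Re \<tau> + of_int d) - (of_int a * Re \<tau> + of_int b) * (of_int c * Im \<tau>) = (of_int a * of_int d - of_int b * of_int c) * Im \<tau>"
    by (simp add: algebra_simps)
  finally show ?thesis by (simp add: det)
qed

text \<open>
  For fixed \<open>\<tau>\<close> the quotient of the two sides of \<open>siegel_abs_moebius\<close> is the absolute value of an entire function
  that is periodic with respect to the lattice, hence constant; comparing the half periods shows that
  the constant is \<open>1\<close>, and comparing the derivatives at \<open>0\<close> yields the transformation law of \<open>\<eta>\<close>.
\<close>
theorem
  fixes a b c d :: int and \<tau> :: complex
  assumes det: "a * d - b * c = 1" and \<tau>: "Im \<tau> > 0"
  defines "j \<equiv> of_int c * \<tau> + of_int d"
  defines "\<tau>' \<equiv> (of_int a * \<tau> + of_int b) / j"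
  shows siegel_abs_moebius: "siegel_abs \<tau>' (z / j) = siegel_abs \<tau> z"
    and eta_moebius: "exp (- pi * Im \<tau>' / 6) * (norm (qpoch (nome \<tau>') (nome \<tau>')))\<^sup>2 =
       norm j * (exp (- pi * Im \<tau> / 6) * (norm (qpoch (nome \<tau>) (nome \<tau>)))\<^sup>2)"
proof -
  have j0: "j \<noteq> 0" unfolding j_def using denominator_nonzero[OF det \<tau>] .
  have Im': "Im \<tau>' = Im \<tau> / (norm j)\<^sup>2" unfolding \<tau>'_def j_def using Im_moebius[OF det \<tau>] .
  then have \<tau>': "Im \<tau>' > 0" using \<tau> j0 by simp
  have tj: "\<tau>' * j = of_int a * \<tau> + of_int b" using j0 by (simp add: \<tau>'_def)
  have detc: "of_int a * of_int d - of_int b * of_int c = (1::complex)"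
    using arg_cong[OF det, of "of_int :: int \<Rightarrow> complex"] by simp
  \<comment> \<open>Coordinates of 1/j and \<tau>/j in the basis 1, \<tau>': division by j carries
    the lattice of \<tau> into the lattice of \<tau>'.\<close>
  have "(of_int a - of_int c * \<tau>') * j = of_int a * j - of_int c * (\<tau>' * j)" by (simp add: algebra_simps)
  also have "\<dots> = of_int a * of_int d - of_int b * of_int c" unfolding tj by (simp add: j_def algebra_simps)
  finally have oj: "1 / j = of_int a - of_int c * \<tau>'" using j0 detc by (simp add: field_simps)
  have "(of_int d * \<tau>' - of_int b) * j = of_int d * (\<tau>' * j) - of_int b * j" by (simp add: algebra_simps)
  also have "\<dots> = (of_int a * of_int d - of_int b * of_int c) * \<tau>" unfolding tj by (simp add: j_def algebra_simps)
  finally have tauj: "\<tau> / j = of_int d * \<tau>' - of_int b" using j0 detc by (simp add: field_simps)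
  have lat: "(of_int m + of_int n * \<tau>) / j = of_int (m * a - n * b) + of_int (n * d - m * c) * \<tau>'" for m n :: int
  proof -
    have "(of_int m + of_int n * \<tau>) / j = of_int m * (1 / j) + of_int n * (\<tau> / j)"
      by (simp add: add_divide_distrib)
    then show ?thesis unfolding oj tauj by (simp add: algebra_simps)
  qed
  have sglat: "siegel_abs \<tau>' ((z + (of_int m + of_int n * \<tau>)) / j) = siegel_abs \<tau>' (z / j)" for z and m n :: int
    unfolding add_divide_distrib[of z] lat by (simp only: add.assoc[symmetric] siegel_abs_lattice[OF \<tau>'])
  define f1 where "f1 = (\<lambda>z. klein_form \<tau>' (z / j))"
  \<comment> \<open>Im \<tau>' = Im \<tau> / |j|^2 turns the Gaussian of z/j relative to \<tau>'
    into that of z relative to \<tau>, so it cancels in the quotient R below.\<close>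
  have n1: "norm (f1 z) = siegel_abs \<tau>' (z / j) * exp (pi * (norm z)\<^sup>2 / (2 * Im \<tau>))" for z
    unfolding f1_def norm_klein_form using j0 by (simp add: Im' norm_divide power_divide)
  have h2: "klein_form \<tau> holomorphic_on UNIV" by (rule klein_form_holomorphic[OF \<tau>])
  have h1: "f1 holomorphic_on UNIV" unfolding f1_def
    using holomorphic_on_compose_gen[of "\<lambda>z. z / j" UNIV "klein_form \<tau>'" UNIV] klein_form_holomorphic[OF \<tau>'] j0
    by (simp add: o_def holomorphic_intros)
  have zeros: "f1 z = 0 \<and> deriv (klein_form \<tau>) z \<noteq> 0" if "klein_form \<tau> z = 0" for z
  proof
    have "siegel_abs \<tau> z = 0" using that norm_klein_form[of \<tau> z] by simp
    then obtain m n :: int where z: "z = of_int m + of_int n * \<tau>" using siegel_abs_eq_0_imp[OF \<tau>] by blast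
    have "siegel_abs \<tau>' (z / j) = 0" using sglat[of 0 m n] siegel_abs_zero[OF \<tau>'] by (simp add: z)
    then show "f1 z = 0" using n1[of z] by simp
    show "deriv (klein_form \<tau>) z \<noteq> 0" by (rule klein_form_deriv_lattice[OF \<tau> that])
  qed
  define R where "R = (\<lambda>z. if klein_form \<tau> z = 0 then deriv f1 z / deriv (klein_form \<tau>) z else f1 z / klein_form \<tau> z)"
  have hR: "R holomorphic_on UNIV" unfolding R_def by (rule holomorphic_quotient_simple_zeros[OF h1 h2 zeros])
  then have cR: "continuous_on UNIV R" by (rule holomorphic_on_imp_continuous_on)
  have fR: "f1 z = R z * klein_form \<tau> z" for z using zeros[of z] by (simp add: R_def)
  have nR: "norm (R z) = siegel_abs \<tau>' (z / j) / siegel_abs \<tau> z" if "klein_form \<tau> z \<noteq> 0" for z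
    using that norm_klein_form[of \<tau> z] by (simp add: R_def norm_divide n1)
  \<comment> \<open>The closed period parallelogram: off the zeros of the Klein form |R| is
    periodic, so a bound on this compact set holds at all those points.\<close>
  define P where "P = (\<lambda>(s::real,t::real). of_real s + of_real t * \<tau>) ` ({0..1} \<times> {0..1})"
  have "compact P" unfolding P_def
    by (intro compact_continuous_image compact_Times) (auto simp: case_prod_unfold intro!: continuous_intros)
  then have "bounded (R ` P)"
    by (intro compact_imp_bounded compact_continuous_image) (auto intro: continuous_on_subset[OF cR])
  then obtain K where K: "norm (R z) \<le> K" if "z \<in> P" for z by (auto simp: bounded_iff)
  have bd: "norm (R z) \<le> K" if nz: "klein_form \<tau> z \<noteq> 0" for z
  proof -
    define t where "t = Im z / Im \<tau>"
    define s where "s = Re z - t * Re \<tau>"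
    have z: "z = of_real s + of_real t * \<tau>" using \<tau> by (simp add: complex_eq_iff s_def t_def)
    define z0 where "z0 = of_real (frac s) + of_real (frac t) * \<tau>"
    have zz: "z = z0 + (of_int \<lfloor>s\<rfloor> + of_int \<lfloor>t\<rfloor> * \<tau>)"
      unfolding z0_def frac_def by (subst z) (simp add: algebra_simps)
    have sz: "siegel_abs \<tau> z = siegel_abs \<tau> z0" unfolding zz using siegel_abs_lattice[OF \<tau>, of z0] by (simp add: add.assoc)
    have "z0 \<in> P" unfolding P_def z0_def
      by (rule image_eqI[of _ _ "(frac s, frac t)"]) (auto simp: frac_ge_0 less_imp_le frac_lt_1)
    moreover have "klein_form \<tau> z0 \<noteq> 0" using nz norm_klein_form[of \<tau> z] norm_klein_form[of \<tau> z0] sz by auto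
    then have "norm (R z0) = norm (R z)" using nR nz sz sglat[of z0] zz by metis
    ultimately show ?thesis using K by metis
  qed
  \<comment> \<open>At a zero of the Klein form the bound passes to the limit, because the
    nonvanishing derivative makes the zero isolated.\<close>
  have "norm (R z) \<le> K" for z
  proof (cases "klein_form \<tau> z = 0")
    case True
    have "klein_form \<tau> field_differentiable at z" using h2 by (simp add: holomorphic_on_def)
    then have "(klein_form \<tau> has_field_derivative deriv (klein_form \<tau>) z) (at z)" by (simp add: DERIV_deriv_iff_field_differentiable)
    then have "((\<lambda>y. (klein_form \<tau> y - klein_form \<tau> z) / (y - z)) \<longlongrightarrow> deriv (klein_form \<tau>) z) (at z)"
      by (simp add: has_field_derivative_iff)
    then have "eventually (\<lambda>y. (klein_form \<tau> y - klein_form \<tau> z) / (y - z) \<noteq> 0) (at z)"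
      by (rule tendsto_imp_eventually_ne) (use zeros True in blast)
    then have ev: "eventually (\<lambda>y. norm (R y) \<le> K) (at z)"
      by eventually_elim (use bd True in auto)
    have "(R \<longlongrightarrow> R z) (at z)" using cR by (simp add: continuous_on_def)
    then have "((\<lambda>y. norm (R y)) \<longlongrightarrow> norm (R z)) (at z)" by (rule tendsto_norm)
    then show ?thesis using ev by (rule tendsto_upperbound) auto
  qed (use bd in auto)
  then have "R constant_on UNIV" using Liouville_theorem[OF hR] by (auto simp: bounded_iff)
  then obtain C where C: "R z = C" for z by (auto simp: constant_on_def)
  have f1C: "f1 z = C * klein_form \<tau> z" for z using fR C by simp
  have sgC: "siegel_abs \<tau>' (z / j) = norm C * siegel_abs \<tau> z" for z
    using arg_cong[OF f1C, of norm z] by (simp add: n1 norm_mult norm_klein_form)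
  \<comment> \<open>The value depends only on the parities of m and n. Since the determinant is odd,
    division by j permutes the three nonzero parity classes.\<close>
  define h where "h = (\<lambda>m n::int. siegel_abs \<tau>' ((of_int m + of_int n * \<tau>') / 2))"
  have hs: "h (m + 2 * k) (n + 2 * l) = h m n" for m n k l
  proof -
    have "(of_int (m + 2 * k) + of_int (n + 2 * l) * \<tau>') / 2 = (of_int m + of_int n * \<tau>') / 2 + of_int k + of_int l * \<tau>'"
      by (simp add: field_simps)
    then show ?thesis unfolding h_def by (simp only: siegel_abs_lattice[OF \<tau>'])
  qed
  have hp: "h m n = h (if even m then 0 else 1) (if even n then 0 else 1)" for m n
  proof -
    have *: "i = (if even i then 0 else 1) + 2 * (i div 2)" for i :: int
      by (cases "even i") (auto elim!: evenE oddE)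
    show ?thesis using hs[of _ "m div 2" _ "n div 2"] *[of m] *[of n] by metis
  qed
  have e1: "siegel_abs \<tau>' (1/2/j) = h a (-c)" and e2: "siegel_abs \<tau>' (\<tau>/2/j) = h (-b) d"
    and e3: "siegel_abs \<tau>' ((1+\<tau>)/2/j) = h (a - b) (d - c)"
    using lat[of 1 0] lat[of 0 1] lat[of 1 1] by (simp_all add: h_def divide_divide_eq_left mult.commute[of 2] divide_divide_eq_left[symmetric])
  have "odd (a * d - b * c)" using det by simp
  then have "h a (-c) * h (-b) d * h (a - b) (d - c) = h 1 0 * h 0 1 * h 1 1"
    by (subst hp[of a], subst hp[of "-b"], subst hp[of "a - b"]) (auto split: if_splits)
  also have "\<dots> = 2" using half_period_product[OF \<tau>'] by (simp add: h_def)
  finally have "(norm C * siegel_abs \<tau> (1/2)) * (norm C * siegel_abs \<tau> (\<tau>/2)) * (norm C * siegel_abs \<tau> ((1+\<tau>)/2)) = 2"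
    unfolding e1[symmetric] e2[symmetric] e3[symmetric] sgC .
  then have "norm C ^ 3 * (siegel_abs \<tau> (1/2) * siegel_abs \<tau> (\<tau>/2) * siegel_abs \<tau> ((1 + \<tau>)/2)) = 2"
    by (simp add: power3_eq_cube mult_ac)
  then have "norm C ^ 3 = 1" unfolding half_period_product[OF \<tau>] by simp
  then have nC: "norm C = 1" using power_inject_base[of "norm C" 2 1] by (simp add: numeral_3_eq_3)
  show "siegel_abs \<tau>' (z / j) = siegel_abs \<tau> z" using sgC nC by simp
  \<comment> \<open>The identity \<open>f1C\<close> is differentiated at 0: one derivative is a
    multiple of \<eta>(\<tau>')^2 / j, the other of C \<eta>(\<tau>)^2, and |C| = 1 is known by
    now.\<close>
  have "(f1 has_field_derivative (- 2 * of_real pi * \<i> * (exp (of_real pi * \<i> * \<tau>' / 6) * (qpoch (nome \<tau>') (nome \<tau>'))\<^sup>2)) * (1 / j)) (at 0)"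
    unfolding f1_def
    by (rule DERIV_chain'[of "\<lambda>z. z / j"]) (use klein_form_deriv_0[OF \<tau>'] j0 in \<open>auto intro!: derivative_eq_intros\<close>)
  moreover have "(f1 has_field_derivative C * (- 2 * of_real pi * \<i> * (exp (of_real pi * \<i> * \<tau> / 6) * (qpoch (nome \<tau>) (nome \<tau>))\<^sup>2))) (at 0)"
    unfolding f1C by (rule DERIV_cmult klein_form_deriv_0[OF \<tau>])+
  ultimately have "(- 2 * of_real pi * \<i> * (exp (of_real pi * \<i> * \<tau>' / 6) * (qpoch (nome \<tau>') (nome \<tau>'))\<^sup>2)) * (1 / j) =
    C * (- 2 * of_real pi * \<i> * (exp (of_real pi * \<i> * \<tau> / 6) * (qpoch (nome \<tau>) (nome \<tau>))\<^sup>2))"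
    by (rule DERIV_unique)
  from arg_cong[OF this, of norm] have
    "2 * pi * (exp (- pi * Im \<tau>' / 6) * (norm (qpoch (nome \<tau>') (nome \<tau>')))\<^sup>2 / norm j) =
     2 * pi * (exp (- pi * Im \<tau> / 6) * (norm (qpoch (nome \<tau>) (nome \<tau>)))\<^sup>2)"
    by (simp add: norm_mult norm_divide norm_exp_eq_Re nC norm_power)
  then have
    "exp (- pi * Im \<tau>' / 6) * (norm (qpoch (nome \<tau>') (nome \<tau>')))\<^sup>2 / norm j =
     exp (- pi * Im \<tau> / 6) * (norm (qpoch (nome \<tau>) (nome \<tau>)))\<^sup>2"
    by (subst (asm) mult_cancel_left) simp
  then show "exp (- pi * Im \<tau>' / 6) * (norm (qpoch (nome \<tau>') (nome \<tau>')))\<^sup>2 =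
       norm j * (exp (- pi * Im \<tau> / 6) * (norm (qpoch (nome \<tau>) (nome \<tau>)))\<^sup>2)"
    using j0 by (simp add: field_simps)
qed

section \<open>The modular group\<close>

definition mmul :: "int \<times> int \<times> int \<times> int \<Rightarrow> int \<times> int \<times> int \<times> int \<Rightarrow> int \<times> int \<times> int \<times> int" where
  "mmul = (\<lambda>(a, b, c, d) (a', b', c', d'). (a * a' + b * c', a * b' + b * d', c * a' + d * c', c * b' + d * d'))"

lemma SL2Z_iff: "(a, b, c, d) \<in> SL2Z \<longleftrightarrow> a * d - b * c = 1"
  by (simp add: SL2Z_def)

lemma Gamma0_iff: "(a, b, c, d) \<in> Gamma0 N \<longleftrightarrow> a * d - b * c = 1 \<and> int N dvd c"
  by (simp add: Gamma0_def SL2Z_def)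

lemma Gamma0_imp_SL2Z: "g \<in> Gamma0 N \<Longrightarrow> g \<in> SL2Z"
  by (auto simp: Gamma0_def)

lemma mmul_SL2Z: "g \<in> SL2Z \<Longrightarrow> h \<in> SL2Z \<Longrightarrow> mmul g h \<in> SL2Z"
proof (cases g; cases h)
  fix a b c d a' b' c' d' :: int
  assume *: "g = (a, b, c, d)" "h = (a', b', c', d')" "g \<in> SL2Z" "h \<in> SL2Z"
  have "(a * a' + b * c') * (c * b' + d * d') - (a * b' + b * d') * (c * a' + d * c') = (a * d - b * c) * (a' * d' - b' * c')"
    by (simp add: algebra_simps)
  then show "mmul g h \<in> SL2Z" using * by (simp add: mmul_def SL2Z_iff)
qed

lemma automorphy_factor_nonzero:
  assumes "g \<in> SL2Z" "Im \<tau> > 0" shows "automorphy_factor g \<tau> \<noteq> 0"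
  using assms denominator_nonzero by (cases g) (auto simp: SL2Z_iff automorphy_factor_def)

lemma Im_moebius_act:
  assumes "g \<in> SL2Z" "Im \<tau> > 0"
  shows "Im (moebius_act g \<tau>) = Im \<tau> / (norm (automorphy_factor g \<tau>))\<^sup>2"
  using assms Im_moebius by (cases g) (auto simp: SL2Z_iff automorphy_factor_def moebius_act_def)

lemma Im_moebius_act_pos:
  assumes "g \<in> SL2Z" "Im \<tau> > 0" shows "Im (moebius_act g \<tau>) > 0"
  using assms by (simp add: Im_moebius_act automorphy_factor_nonzero)

lemma moebius_mmul:
  assumes "g \<in> SL2Z" "h \<in> SL2Z" "Im \<tau> > 0"
  shows "moebius_act g (moebius_act h \<tau>) = moebius_act (mmul g h) \<tau>"
proof -
  obtain a b c d where g: "g = (a, b, c, d)" by (cases g)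
  obtain a' b' c' d' where h: "h = (a', b', c', d')" by (cases h)
  define j where "j = of_int c' * \<tau> + of_int d'"
  have j0: "j \<noteq> 0" using automorphy_factor_nonzero[OF assms(2,3)] by (simp add: h automorphy_factor_def j_def)
  define w where "w = (of_int a' * \<tau> + of_int b') / j"
  have wj: "w * j = of_int a' * \<tau> + of_int b'" using j0 by (simp add: w_def)
  have "moebius_act g (moebius_act h \<tau>) = (of_int a * w + of_int b) / (of_int c * w + of_int d)"
    by (simp add: moebius_act_def g h w_def j_def)
  also have "\<dots> = ((of_int a * w + of_int b) * j) / ((of_int c * w + of_int d) * j)" using j0 by simp
  also have "(of_int a * w + of_int b) * j = of_int a * (w * j) + of_int b * j" by (simp add: algebra_simps)
  also have "(of_int c * w + of_int d) * j = of_int c * (w * j) + of_int d * j" by (simp add: algebra_simps)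
  finally show ?thesis unfolding wj unfolding j_def by (simp add: moebius_act_def g h mmul_def algebra_simps)
qed

lemma moebius_translation: "moebius_act (1, n, 0, 1) \<tau> = \<tau> + of_int n"
  by (simp add: moebius_act_def)

lemma translation_SL2Z [simp]: "(1, n, 0, 1) \<in> SL2Z"
  by (simp add: SL2Z_iff)

text \<open>The lower left entry of g' g^(-1) is c' d - d' c, so the divisibility says exactly that
  this matrix lies in the congruence subgroup.\<close>

lemma Gamma0_coset:
  assumes "(a, b, c, d) \<in> SL2Z" "(a', b', c', d') \<in> SL2Z" "int N dvd c * d' - d * c'"
  shows "\<exists>g0\<in>Gamma0 N. \<forall>\<tau>. Im \<tau> > 0 \<longrightarrow> moebius_act (a', b', c', d') \<tau> = moebius_act g0 (moebius_act (a, b, c, d) \<tau>)"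
proof -
  let ?g = "(a, b, c, d)" and ?g' = "(a', b', c', d')" and ?i = "(d, -b, -c, a)"
  have i: "?i \<in> SL2Z" using assms(1) by (simp add: SL2Z_iff mult.commute)
  have "mmul (mmul ?g' ?i) ?g = ?g'"
  proof -
    have "a * d - b * c = 1" using assms(1) by (simp add: SL2Z_iff)
    then have e: "a * d = 1 + b * c" by simp
    have "(x * d + y * - c) * a + (x * - b + y * a) * c = x" "(x * d + y * - c) * b + (x * - b + y * a) * d = y" for x y
    proof -
      have "(x * d + y * - c) * a + (x * - b + y * a) * c = x * (a * d) - x * (b * c)" by (simp add: algebra_simps)
      then show "(x * d + y * - c) * a + (x * - b + y * a) * c = x" unfolding e by (simp add: algebra_simps)
      have "(x * d + y * - c) * b + (x * - b + y * a) * d = y * (a * d) - y * (b * c)" by (simp add: algebra_simps)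
      then show "(x * d + y * - c) * b + (x * - b + y * a) * d = y" unfolding e by (simp add: algebra_simps)
    qed
    then show ?thesis by (simp add: mmul_def)
  qed
  moreover have "mmul ?g' ?i \<in> Gamma0 N"
  proof -
    have "mmul ?g' ?i \<in> SL2Z" using mmul_SL2Z assms(2) i by blast
    moreover have "c' * d + d' * - c = - (c * d' - d * c')" by (simp add: algebra_simps)
    then have "int N dvd c' * d + d' * - c" using assms(3) by (metis dvd_minus_iff)
    ultimately show ?thesis by (simp add: Gamma0_def mmul_def)
  qed
  ultimately show ?thesis using moebius_mmul Gamma0_imp_SL2Z assms(1) by metis
qed

text \<open>The label of \<open>(a, b, c, d)\<close> determines the orbit of the cusp \<open>a/c\<close> under \<open>\<Gamma>\<^sub>0(N)\<close>.\<close>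
definition cusp_label :: "nat \<Rightarrow> int \<times> int \<times> int \<times> int \<Rightarrow> int \<times> int" where
  "cusp_label N = (\<lambda>(a, b, c, d). (gcd c (int N), (a * (c div gcd c (int N))) mod gcd (gcd c (int N)) (int N div gcd c (int N))))"

text \<open>Replacing g by g T^n changes d to c n + d, so what has to be solved is c c' n = c d' - d
  c' modulo N. With c = \<delta> e and c' = \<delta> e', the gcd of c c' and N is \<delta> h, and c
  d' - d c' = \<delta> (e d' - d e'). Since h divides c and c', the numbers a and a' are inverse to
  d and d' modulo h, and equality of the second labels gives h | e d' - d e'.\<close>

lemma cusp_label_eqD:
  assumes N: "N > 0" and g: "g \<in> SL2Z" and g': "g' \<in> SL2Z" and eq: "cusp_label N g = cusp_label N g'"
  shows "\<exists>g0\<in>Gamma0 N. \<exists>n. \<forall>\<tau>. Im \<tau> > 0 \<longrightarrow> moebius_act g' \<tau> = moebius_act g0 (moebius_act g (\<tau> + of_int n))"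
proof -
  obtain a b c d where ge: "g = (a, b, c, d)" by (cases g)
  obtain a' b' c' d' where ge': "g' = (a', b', c', d')" by (cases g')
  have det: "a * d - b * c = 1" and det': "a' * d' - b' * c' = 1" using g g' by (simp_all add: ge ge' SL2Z_iff)
  define \<delta> where "\<delta> = gcd c (int N)"
  have \<delta>': "\<delta> = gcd c' (int N)" using eq by (simp add: ge ge' cusp_label_def \<delta>_def)
  have \<delta>0: "\<delta> > 0" using N by (simp add: \<delta>_def)
  define M where "M = int N div \<delta>"
  define e where "e = c div \<delta>" define e' where "e' = c' div \<delta>"
  have Ne: "int N = \<delta> * M" and ce: "c = \<delta> * e" and ce': "c' = \<delta> * e'"
    unfolding M_def e_def e'_def using \<delta>_def \<delta>' by (metis dvd_mult_div_cancel gcd_dvd1 gcd_dvd2)+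
  define h where "h = gcd \<delta> M"
  have lab: "[a * e = a' * e'] (mod h)"
    using eq \<delta>' by (simp add: ge ge' cusp_label_def cong_def h_def M_def e_def e'_def flip: \<delta>_def)
  have "gcd (\<delta> * e) (\<delta> * M) = \<delta>" using \<delta>_def Ne ce by simp
  then have cop: "coprime e M" using \<delta>0 by (simp add: gcd_mult_distrib_int[symmetric] coprime_iff_gcd_eq_1)
  have "gcd (\<delta> * e') (\<delta> * M) = \<delta>" using \<delta>' Ne ce' by simp
  then have cop': "coprime e' M" using \<delta>0 by (simp add: gcd_mult_distrib_int[symmetric] coprime_iff_gcd_eq_1)
  have "gcd (\<delta> * (e * e')) M = gcd \<delta> M"
  proof -
    have "coprime (e * e') M" using cop cop' by simp
    then show ?thesis by (simp add: gcd_mult_left_right_cancel coprime_commute)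
  qed
  then have "gcd (c * c') (int N) = \<delta> * h"
    unfolding Ne ce ce' h_def using \<delta>0 by (simp add: gcd_mult_distrib_int[symmetric] mult.assoc mult.left_commute[of e])
  moreover have "h dvd e * d' - d * e'"
  proof -
    have hc: "h dvd c" "h dvd c'" unfolding ce ce' h_def by auto
    have ad: "[a * d = 1] (mod h)" "[a' * d' = 1] (mod h)"
    proof -
      have "a * d - 1 = b * c" "a' * d' - 1 = b' * c'" using det det' by auto
      then show "[a * d = 1] (mod h)" "[a' * d' = 1] (mod h)"
        using hc by (auto simp: cong_iff_dvd_diff)
    qed
    have "[e * d' * (a * d) = e * d' * 1] (mod h)" by (intro cong_mult ad cong_refl)
    moreover have "[(a * e) * (d * d') = (a' * e') * (d * d')] (mod h)" by (intro cong_mult lab cong_refl)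
    moreover have "[d * e' * (a' * d') = d * e' * 1] (mod h)" by (intro cong_mult ad cong_refl)
    ultimately have "[e * d' = d * e'] (mod h)" by (simp add: mult_ac) (meson cong_sym cong_trans)
    then show ?thesis by (simp add: cong_iff_dvd_diff)
  qed
  moreover have "c * d' - d * c' = \<delta> * (e * d' - d * e')" unfolding ce ce' by (simp add: algebra_simps)
  ultimately have "gcd (c * c') (int N) dvd c * d' - d * c'" by simp
  then obtain n where n: "[c * c' * n = c * d' - d * c'] (mod int N)"
    using cong_solve_dvd_int[of "c * c'" "int N" "c * d' - d * c'"] by auto
  define gT where "gT = (a, a * n + b, c, c * n + d)"
  have gT: "gT = mmul g (1, n, 0, 1)" by (simp add: gT_def ge mmul_def)
  have gTS: "gT \<in> SL2Z" unfolding gT using mmul_SL2Z g by simp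
  have "int N dvd c * d' - (c * n + d) * c'"
  proof -
    have "c * d' - (c * n + d) * c' = - (c * c' * n - (c * d' - d * c'))" by (simp add: algebra_simps)
    then show ?thesis using n by (metis cong_iff_dvd_diff dvd_minus_iff)
  qed
  then obtain g0 where g0: "g0 \<in> Gamma0 N" and m: "\<And>\<tau>. Im \<tau> > 0 \<Longrightarrow> moebius_act g' \<tau> = moebius_act g0 (moebius_act gT \<tau>)"
    using Gamma0_coset[of a "a * n + b" c "c * n + d" a' b' c' d' N] gTS g' by (auto simp: gT_def ge')
  have "moebius_act gT \<tau> = moebius_act g (\<tau> + of_int n)" if "Im \<tau> > 0" for \<tau>
    using moebius_mmul[OF g translation_SL2Z that, of n] by (simp add: gT moebius_translation)
  then show ?thesis using g0 m by metis
qed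

text \<open>For c = \<delta> e the second label a e is a unit modulo h = gcd \<delta> (N/\<delta>):
  a is coprime to c, which h divides, and e is coprime to N/\<delta>. An upper bound is what the
  linear algebra asks for.\<close>

lemma card_cusp_labels:
  assumes "N > 0"
  shows "finite (cusp_label N ` SL2Z) \<and>
    card (cusp_label N ` SL2Z) \<le> (\<Sum>\<delta> | \<delta> dvd N. totient (gcd \<delta> (N div \<delta>)))"
proof -
  define L where "L = (\<lambda>(\<delta>, x). (int \<delta>, int x mod int (gcd \<delta> (N div \<delta>)))) ` (SIGMA \<delta>:{\<delta>. \<delta> dvd N}. totatives (gcd \<delta> (N div \<delta>)))"
  have fd: "finite {\<delta>. \<delta> dvd N}" using assms by simp
  have fs: "finite (SIGMA \<delta>:{\<delta>. \<delta> dvd N}. totatives (gcd \<delta> (N div \<delta>)))" using fd by (intro finite_SigmaI) auto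
  have "cusp_label N ` SL2Z \<subseteq> L"
  proof
    fix y assume "y \<in> cusp_label N ` SL2Z"
    then obtain a b c d where abcd: "a * d - b * c = 1" and y: "y = cusp_label N (a, b, c, d)"
      by (auto simp: SL2Z_def)
    define \<delta> where "\<delta> = nat (gcd c (int N))"
    have \<delta>: "int \<delta> = gcd c (int N)" by (simp add: \<delta>_def)
    have dN: "\<delta> dvd N" using \<delta> by (metis gcd_dvd2 int_dvd_int_iff)
    then have \<delta>0: "\<delta> > 0" using assms by (auto intro: Nat.gr0I)
    define M where "M = N div \<delta>"
    have M: "int N div int \<delta> = int M" by (simp add: M_def zdiv_int)
    have NM: "N = \<delta> * M" using dN by (simp add: M_def)
    define e where "e = c div int \<delta>"
    have ce: "c = int \<delta> * e" using \<delta> by (simp add: e_def)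
    define h where "h = gcd \<delta> M"
    have h0: "h > 0" using \<delta>0 by (simp add: h_def)
    have "gcd (int \<delta> * e) (int \<delta> * int M) = int \<delta>" using \<delta> NM ce by simp
    then have "coprime e (int M)" using \<delta>0 by (simp add: gcd_mult_distrib_int[symmetric] coprime_iff_gcd_eq_1)
    then have "coprime e (int h)" by (rule coprime_divisors[OF dvd_refl, rotated]) (simp add: h_def)
    moreover have "coprime a c" using abcd by (intro coprimeI) (metis dvd_diff dvd_mult dvd_mult2)
    then have "coprime a (int h)" by (rule coprime_divisors[OF dvd_refl, rotated]) (simp add: h_def ce)
    ultimately have cop: "coprime (a * e) (int h)" by simp
    \<comment> \<open>The representative of a e in {1..h} rather than {0..<h}, to match
      \<open>totatives\<close>; for h = 1 it is 1.\<close>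
    define x where "x = nat ((a * e - 1) mod int h) + 1"
    have x: "int x = (a * e - 1) mod int h + 1" using h0 by (simp add: x_def)
    have xm: "int x mod int h = (a * e) mod int h" unfolding x by (simp add: mod_simps)
    have "coprime (int x) (int h)" using cop xm by (metis coprime_mod_left_iff h0 of_nat_0_less_iff less_irrefl of_nat_0)
    moreover have "x > 0" "x \<le> h" 
    proof -
      have "(a * e - 1) mod int h < int h" using h0 by simp
      then show "x \<le> h" using x by linarith
    qed (simp add: x_def)
    ultimately have "x \<in> totatives h" by (simp add: totatives_def)
    moreover have "y = (int \<delta>, int x mod int h)"
      unfolding y cusp_label_def using \<delta> M xm by (simp add: h_def e_def gcd_int_int_eq flip: \<delta>)
    ultimately show "y \<in> L" unfolding L_def using dN
      by (intro image_eqI[of _ _ "(\<delta>, x)"]) (auto simp: h_def M_def)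
  qed
  moreover have "finite L" unfolding L_def using fs by simp
  moreover have "card L \<le> (\<Sum>\<delta> | \<delta> dvd N. totient (gcd \<delta> (N div \<delta>)))"
    unfolding L_def using card_image_le[OF fs] fd by (simp add: card_SigmaI totient_def)
  ultimately show ?thesis by (meson card_mono finite_subset le_trans)
qed

text \<open>The square of gcd \<delta> (N/\<delta>) divides N, so a summand exceeds 1 only if this
  gcd is u, and such \<delta> inject into the divisors of N/u^2 by \<delta> -> \<delta>/u. The
  right-hand side is the number of eta functions and Siegel products that will be available.\<close>

lemma totient_gcd_sum_le:
  assumes N: "N > 0" and uN: "u\<^sup>2 dvd N" and sq: "\<And>g. g\<^sup>2 dvd N \<Longrightarrow> g = u \<or> totient g = 1"
  shows "(\<Sum>\<delta> | \<delta> dvd N. totient (gcd \<delta> (N div \<delta>))) \<le>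
     card {t. t dvd N} + (totient u - 1) * card {t. t dvd N div u\<^sup>2}"
proof -
  have u0: "u > 0" using uN N by (auto intro: Nat.gr0I)
  have fd: "finite {\<delta>. \<delta> dvd N}" using N by simp
  have le: "totient (gcd \<delta> (N div \<delta>)) \<le> 1 + (if gcd \<delta> (N div \<delta>) = u then totient u - 1 else 0)" if "\<delta> dvd N" for \<delta>
  proof -
    have "(gcd \<delta> (N div \<delta>))\<^sup>2 dvd \<delta> * (N div \<delta>)" unfolding power2_eq_square by (intro mult_dvd_mono) auto
    then have "(gcd \<delta> (N div \<delta>))\<^sup>2 dvd N" using that by simp
    then show ?thesis using sq by fastforce
  qed
  have "(\<Sum>\<delta> | \<delta> dvd N. totient (gcd \<delta> (N div \<delta>))) \<le>
    (\<Sum>\<delta> | \<delta> dvd N. 1 + (if gcd \<delta> (N div \<delta>) = u then totient u - 1 else 0))"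
    by (intro sum_mono le) auto
  also have "\<dots> = card {t. t dvd N} + (totient u - 1) * card {\<delta>. \<delta> dvd N \<and> gcd \<delta> (N div \<delta>) = u}"
    using fd unfolding sum.distrib by (simp add: sum.If_cases Int_def)
  also have "card {\<delta>. \<delta> dvd N \<and> gcd \<delta> (N div \<delta>) = u} \<le> card {t. t dvd N div u\<^sup>2}"
  proof (rule card_inj_on_le)
    show "inj_on (\<lambda>\<delta>. \<delta> div u) {\<delta>. \<delta> dvd N \<and> gcd \<delta> (N div \<delta>) = u}"
      by (rule inj_onI) (metis (mono_tags, lifting) dvd_div_eq_cancel gcd_dvd1 mem_Collect_eq)
    show "(\<lambda>\<delta>. \<delta> div u) ` {\<delta>. \<delta> dvd N \<and> gcd \<delta> (N div \<delta>) = u} \<subseteq> {t. t dvd N div u\<^sup>2}"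
    proof clarify
      fix \<delta> assume d: "\<delta> dvd N" and u: "u = gcd \<delta> (N div \<delta>)"
      obtain s where s: "\<delta> = u * s" using u by (metis dvdE gcd_dvd1)
      obtain r where r: "N div \<delta> = u * r" using u by (metis dvdE gcd_dvd2)
      have "N = \<delta> * (N div \<delta>)" using d by simp
      then have "N = u\<^sup>2 * (s * r)" by (simp add: r) (simp add: s power2_eq_square mult_ac)
      then have "N div u\<^sup>2 = s * r" using u0 by simp
      then have "\<delta> div u dvd N div u\<^sup>2" using s u0 by simp
      then show "\<delta> div gcd \<delta> (N div \<delta>) dvd N div (gcd \<delta> (N div \<delta>))\<^sup>2" using u by simp
    qed
    have "N div u\<^sup>2 > 0" using uN N u0 by (simp add: dvd_imp_le div_greater_zero_iff)
    then show "finite {t. t dvd N div u\<^sup>2}" by simp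
  qed
  finally show ?thesis by simp
qed

text \<open>A coarse form of reduction theory, with 1/2 in place of sqrt 3 / 2. The minimum of |c
  \<tau> + d| over coprime pairs exists because only pairs with value at most 1 compete; they are
  finitely many and include (0, 1).\<close>

lemma fundamental_domain:
  assumes \<tau>: "Im \<tau> > 0"
  shows "\<exists>g\<in>SL2Z. \<exists>\<tau>0. \<tau> = moebius_act g \<tau>0 \<and> Im \<tau>0 \<ge> 1/2 \<and> \<bar>Re \<tau>0\<bar> \<le> 1/2"
proof -
  define S where "S = {(c::int, d::int). coprime c d \<and> norm (of_int c * \<tau> + of_int d) \<le> 1}"
  define K where "K = \<lceil>1 / Im \<tau>\<rceil>"
  define K' where "K' = \<lceil>1 + (1 / Im \<tau>) * \<bar>Re \<tau>\<bar>\<rceil>"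
  have "S \<subseteq> {-K..K} \<times> {-K'..K'}"
  proof clarify
    fix c d :: int assume "(c, d) \<in> S"
    then have n: "norm (of_int c * \<tau> + of_int d) \<le> 1" by (simp add: S_def)
    have "\<bar>Im (of_int c * \<tau> + of_int d)\<bar> \<le> 1" using abs_Im_le_cmod n by (rule order_trans)
    then have c: "\<bar>of_int c\<bar> \<le> 1 / Im \<tau>" using \<tau> by (simp add: abs_mult field_simps)
    have "\<bar>Re (of_int c * \<tau> + of_int d)\<bar> \<le> 1" using abs_Re_le_cmod n by (rule order_trans)
    then have "\<bar>of_int d\<bar> \<le> 1 + \<bar>of_int c * Re \<tau>\<bar>" by simp
    also have "\<dots> \<le> 1 + (1 / Im \<tau>) * \<bar>Re \<tau>\<bar>"
      unfolding abs_mult by (intro add_left_mono mult_right_mono c) simp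
    finally have d: "\<bar>of_int d\<bar> \<le> 1 + (1 / Im \<tau>) * \<bar>Re \<tau>\<bar>" .
    have "of_int c \<le> 1 / Im \<tau>" "of_int (- c) \<le> 1 / Im \<tau>" using c by auto
    then have "c \<le> K" "- c \<le> K" unfolding K_def by linarith+
    moreover have "of_int d \<le> 1 + (1 / Im \<tau>) * \<bar>Re \<tau>\<bar>" "of_int (- d) \<le> 1 + (1 / Im \<tau>) * \<bar>Re \<tau>\<bar>" using d by auto
    then have "d \<le> K'" "- d \<le> K'" unfolding K'_def by linarith+
    ultimately show "c \<in> {-K..K} \<and> d \<in> {-K'..K'}" by auto
  qed
  then have "finite S" by (rule finite_subset) auto
  moreover have "(0, 1) \<in> S" by (simp add: S_def)
  ultimately obtain c d where cd: "(c, d) \<in> S" and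
    min: "\<And>c' d'. (c', d') \<in> S \<Longrightarrow> norm (of_int c * \<tau> + of_int d) \<le> norm (of_int c' * \<tau> + of_int d')"
    using arg_min_if_finite[of S "\<lambda>(c, d). norm (of_int c * \<tau> + of_int d)"]
    by (metis (no_types, lifting) case_prod_conv empty_iff not_less surj_pair)
  have min': "norm (of_int c * \<tau> + of_int d) \<le> norm (of_int c' * \<tau> + of_int d')" if "coprime c' d'" for c' d'
    using that min[of c' d'] cd by (cases "norm (of_int c' * \<tau> + of_int d') \<le> 1") (auto simp: S_def)
  obtain p r where "p * c + r * d = 1" using cd bezout_int[of c d] by (auto simp: S_def)
  then have g: "(r, -p, c, d) \<in> SL2Z" by (simp add: SL2Z_iff)
  define n where "n = - round (Re (moebius_act (r, -p, c, d) \<tau>))"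
  define \<tau>0 where "\<tau>0 = moebius_act (r, -p, c, d) \<tau> + of_int n"
  have re: "\<bar>Re \<tau>0\<bar> \<le> 1/2"
    using of_int_round_abs_le[of "Re (moebius_act (r, -p, c, d) \<tau>)"] by (simp add: \<tau>0_def n_def abs_minus_commute)
  have g1: "(r + n * c, -p + n * d, c, d) \<in> SL2Z" using g by (simp add: SL2Z_iff algebra_simps)
  have \<tau>0: "\<tau>0 = moebius_act (r + n * c, -p + n * d, c, d) \<tau>"
    unfolding \<tau>0_def using automorphy_factor_nonzero[OF g \<tau>]
    by (simp add: moebius_act_def automorphy_factor_def field_simps)
  \<comment> \<open>The numerator of \<tau>0 is c' \<tau> + d' for another coprime pair, so
    minimality of the denominator gives |\<tau>0| \<ge> 1.\<close>
  have "coprime (r + n * c) (-p + n * d)"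
    using g1 by (intro coprimeI) (metis (no_types, lifting) SL2Z_iff dvd_diff dvd_mult dvd_mult2)
  from min'[OF this] have "norm \<tau>0 \<ge> 1"
    unfolding \<tau>0 using automorphy_factor_nonzero[OF g \<tau>]
    by (simp add: moebius_act_def automorphy_factor_def norm_divide divide_simps)
  then have "(norm \<tau>0)\<^sup>2 \<ge> 1" by (simp add: one_le_power)
  then have "(Re \<tau>0)\<^sup>2 + (Im \<tau>0)\<^sup>2 \<ge> 1" by (simp add: cmod_power2)
  moreover have "(Re \<tau>0)\<^sup>2 \<le> (1/2)\<^sup>2" using re by (metis abs_ge_zero power2_abs power_mono)
  ultimately have "(1/2)\<^sup>2 \<le> (Im \<tau>0)\<^sup>2" by (simp add: power2_eq_square)
  moreover have "Im \<tau>0 > 0" unfolding \<tau>0 using Im_moebius_act_pos[OF g1 \<tau>] .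
  ultimately have im: "Im \<tau>0 \<ge> 1/2" by (meson less_imp_le power2_le_imp_le)
  let ?i = "(d, - (-p + n * d), - c, r + n * c)"
  have i: "?i \<in> SL2Z" using g1 by (simp add: SL2Z_iff algebra_simps)
  have "moebius_act ?i \<tau>0 = moebius_act (mmul ?i (r + n * c, -p + n * d, c, d)) \<tau>"
    unfolding \<tau>0 by (rule moebius_mmul[OF i g1 \<tau>])
  also have "mmul ?i (r + n * c, -p + n * d, c, d) = (1, 0, 0, 1)"
    using g by (simp add: mmul_def SL2Z_iff algebra_simps)
  finally have "moebius_act ?i \<tau>0 = \<tau>" by (simp add: moebius_act_def)
  then show ?thesis using i im re by metis
qed

text \<open>An integral matrix of determinant n is a matrix of SL2(Z) times an upper triangular one;
  A is the gcd of the first column (n a, c), and A D = n. For a function F that transforms under all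
  of SL2(Z), this reduces the growth of F(n g \<tau>) at a cusp to the growth of F at i
  infinity.\<close>

lemma hermite_normal_form:
  assumes "n > 0" and "g \<in> SL2Z"
  shows "\<exists>h\<in>SL2Z. \<exists>A B D::int. A > 0 \<and> D > 0 \<and>
    (\<forall>\<tau>. Im \<tau> > 0 \<longrightarrow> of_nat n * moebius_act g \<tau> = moebius_act h ((of_int A * \<tau> + of_int B) / of_int D))"
proof -
  obtain a b c d where g: "g = (a, b, c, d)" by (cases g)
  have det: "a * d - b * c = 1" using assms(2) by (simp add: g SL2Z_iff)
  define A where "A = gcd (int n * a) c"
  have "A \<noteq> 0" using det assms(1) by (auto simp: A_def)
  then have A: "A > 0" using A_def by (metis gcd_ge_0_int order_le_less)
  define p where "p = int n * a div A"
  define r where "r = c div A"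
  have pA: "p * A = int n * a" and rA: "r * A = c" by (auto simp: p_def r_def A_def)
  obtain x y where "x * (int n * a) + y * c = A" using bezout_int A_def by blast
  then have "x * (p * A) + y * (r * A) = A" unfolding pA rA .
  then have "(x * p + y * r) * A = 1 * A" by (simp add: algebra_simps)
  then have xy: "x * p + y * r = 1" using A by simp
  define D where "D = p * d - r * (int n * b)"
  define B where "B = x * (int n * b) + y * d"
  have "D * A = (p * A) * d - (r * A) * (int n * b)" by (simp add: D_def algebra_simps)
  also have "\<dots> = int n * (a * d - b * c)" unfolding pA rA by (simp add: algebra_simps)
  finally have "D * A = int n" using det by simp
  then have D: "D > 0" using A assms(1) by (metis of_nat_0_less_iff zero_less_mult_pos2)
  have h: "(p, -y, r, x) \<in> SL2Z" using xy by (simp add: SL2Z_iff algebra_simps)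
  have e1: "p * B - y * D = int n * b"
  proof -
    have "p * B - y * D = (x * p + y * r) * (int n * b)" by (simp add: B_def D_def algebra_simps)
    then show ?thesis by (simp add: xy)
  qed
  have e2: "r * B + x * D = d"
  proof -
    have "r * B + x * D = (x * p + y * r) * d" by (simp add: B_def D_def algebra_simps)
    then show ?thesis by (simp add: xy)
  qed
  have "of_nat n * moebius_act g \<tau> = moebius_act (p, -y, r, x) ((of_int A * \<tau> + of_int B) / of_int D)" for \<tau>
  proof -
    have D0: "(of_int D :: complex) \<noteq> 0" using D by simp
    let ?z = "(of_int A * \<tau> + of_int B) / of_int D"
    have "moebius_act (p, -y, r, x) ?z = ((of_int p * ?z - of_int y) * of_int D) / ((of_int r * ?z + of_int x) * of_int D)"
      using D0 by (simp add: moebius_act_def)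
    also have "(of_int p * ?z - of_int y) * of_int D = of_int (p * A) * \<tau> + of_int (p * B - y * D)"
      using D0 by (simp add: field_simps)
    also have "(of_int r * ?z + of_int x) * of_int D = of_int (r * A) * \<tau> + of_int (r * B + x * D)"
      using D0 by (simp add: field_simps)
    finally show ?thesis unfolding pA rA e1 e2 by (simp add: moebius_act_def g field_simps)
  qed
  then show ?thesis using h A D by blast
qed

section \<open>Invariant functions with prescribed growth at the cusps\<close>

abbreviation log_abs :: "(complex \<Rightarrow> complex) \<Rightarrow> real \<Rightarrow> complex \<Rightarrow> real" where
  "log_abs L \<kappa> \<tau> \<equiv> Re (L \<tau>) + \<kappa> * ln (Im \<tau>)"

text \<open>
  For \<open>f = exp L\<close> of weight \<open>2 \<kappa>\<close> the invariant function is \<open>ln (\<bar>f\<bar> (Im \<tau>)\<^sup>\<kappa>)\<close>, and \<open>r g\<close> is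
  \<open>2 pi\<close> times the order of \<open>f\<close> at the cusp \<open>g \<infinity>\<close>. Only absolute values enter, so \<open>\<kappa>\<close> and the orders may be
  arbitrary real numbers.
\<close>
definition admissible :: "nat \<Rightarrow> (complex \<Rightarrow> complex) \<Rightarrow> real \<Rightarrow> (int \<times> int \<times> int \<times> int \<Rightarrow> real) \<Rightarrow> bool" where
  "admissible N L \<kappa> r \<longleftrightarrow> L holomorphic_on {\<tau>. Im \<tau> > 0} \<and>
    (\<forall>g\<in>Gamma0 N. \<forall>\<tau>. Im \<tau> > 0 \<longrightarrow>
       log_abs L \<kappa> (moebius_act g \<tau>) = log_abs L \<kappa> \<tau>) \<and>
    (\<forall>g\<in>SL2Z. \<exists>B C. \<forall>\<tau>. Im \<tau> > 0 \<longrightarrow> Im \<tau> \<ge> B \<longrightarrow>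
       \<bar>log_abs L \<kappa> (moebius_act g \<tau>) - \<kappa> * ln (Im \<tau>) + r g * Im \<tau>\<bar> \<le> C)"

section \<open>Real linear combinations of admissible logarithms\<close>

lemma admissible_zero: "admissible N (\<lambda>_. 0) 0 (\<lambda>_. 0)"
  unfolding admissible_def by auto

lemma admissible_add:
  assumes "admissible N L \<kappa> r" "admissible N L' \<kappa>' r'"
  shows "admissible N (\<lambda>\<tau>. L \<tau> + L' \<tau>) (\<kappa> + \<kappa>') (\<lambda>g. r g + r' g)"
  unfolding admissible_def
proof (intro conjI ballI allI impI)
  show "(\<lambda>\<tau>. L \<tau> + L' \<tau>) holomorphic_on {\<tau>. 0 < Im \<tau>}"
    using assms unfolding admissible_def by (intro holomorphic_intros) auto
next
  fix g \<tau> assume *: "g \<in> Gamma0 N" "0 < Im \<tau>"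
  have "log_abs L \<kappa> (moebius_act g \<tau>) = log_abs L \<kappa> \<tau>"
    "log_abs L' \<kappa>' (moebius_act g \<tau>) = log_abs L' \<kappa>' \<tau>"
    using assms * unfolding admissible_def by blast+
  then show "Re (L (moebius_act g \<tau>) + L' (moebius_act g \<tau>)) + (\<kappa> + \<kappa>') * ln (Im (moebius_act g \<tau>)) =
    Re (L \<tau> + L' \<tau>) + (\<kappa> + \<kappa>') * ln (Im \<tau>)" by (simp add: algebra_simps)
next
  fix g assume g: "g \<in> SL2Z"
  obtain B C where 1: "\<And>\<tau>. Im \<tau> > 0 \<Longrightarrow> Im \<tau> \<ge> B \<Longrightarrow> \<bar>log_abs L \<kappa> (moebius_act g \<tau>) - \<kappa> * ln (Im \<tau>) + r g * Im \<tau>\<bar> \<le> C"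
    using assms(1) g unfolding admissible_def by blast
  obtain B' C' where 2: "\<And>\<tau>. Im \<tau> > 0 \<Longrightarrow> Im \<tau> \<ge> B' \<Longrightarrow> \<bar>log_abs L' \<kappa>' (moebius_act g \<tau>) - \<kappa>' * ln (Im \<tau>) + r' g * Im \<tau>\<bar> \<le> C'"
    using assms(2) g unfolding admissible_def by blast
  show "\<exists>B C. \<forall>\<tau>. Im \<tau> > 0 \<longrightarrow> Im \<tau> \<ge> B \<longrightarrow>
       \<bar>Re (L (moebius_act g \<tau>) + L' (moebius_act g \<tau>)) + (\<kappa> + \<kappa>') * ln (Im (moebius_act g \<tau>)) - (\<kappa> + \<kappa>') * ln (Im \<tau>) + (r g + r' g) * Im \<tau>\<bar> \<le> C"
  proof (rule exI[of _ "max B B'"], rule exI[of _ "C + C'"], intro allI impI)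
    fix \<tau> assume \<tau>: "0 < Im \<tau>" "max B B' \<le> Im \<tau>"
    let ?x = "log_abs L \<kappa> (moebius_act g \<tau>) - \<kappa> * ln (Im \<tau>) + r g * Im \<tau>"
    let ?y = "log_abs L' \<kappa>' (moebius_act g \<tau>) - \<kappa>' * ln (Im \<tau>) + r' g * Im \<tau>"
    have "\<bar>?x\<bar> \<le> C" "\<bar>?y\<bar> \<le> C'" using 1[of \<tau>] 2[of \<tau>] \<tau> by auto
    then have "\<bar>?x + ?y\<bar> \<le> C + C'" by linarith
    then show "\<bar>Re (L (moebius_act g \<tau>) + L' (moebius_act g \<tau>)) + (\<kappa> + \<kappa>') * ln (Im (moebius_act g \<tau>)) - (\<kappa> + \<kappa>') * ln (Im \<tau>) + (r g + r' g) * Im \<tau>\<bar> \<le> C + C'"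
      by (simp add: algebra_simps)
  qed
qed

lemma admissible_cmult:
  assumes "admissible N L \<kappa> r"
  shows "admissible N (\<lambda>\<tau>. of_real x * L \<tau>) (x * \<kappa>) (\<lambda>g. x * r g)"
  unfolding admissible_def
proof (intro conjI ballI allI impI)
  show "(\<lambda>\<tau>. of_real x * L \<tau>) holomorphic_on {\<tau>. 0 < Im \<tau>}"
    using assms unfolding admissible_def by (intro holomorphic_intros) auto
next
  fix g \<tau> assume *: "g \<in> Gamma0 N" "0 < Im \<tau>"
  have "log_abs L \<kappa> (moebius_act g \<tau>) = log_abs L \<kappa> \<tau>"
    using assms * unfolding admissible_def by blast+
  then have "x * (log_abs L \<kappa> (moebius_act g \<tau>)) = x * (log_abs L \<kappa> \<tau>)" by simp
  then show "Re (of_real x * L (moebius_act g \<tau>)) + (x * \<kappa>) * ln (Im (moebius_act g \<tau>)) =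
    Re (of_real x * L \<tau>) + (x * \<kappa>) * ln (Im \<tau>)" by (simp add: algebra_simps)
next
  fix g assume g: "g \<in> SL2Z"
  obtain B C where 1: "\<And>\<tau>. Im \<tau> > 0 \<Longrightarrow> Im \<tau> \<ge> B \<Longrightarrow> \<bar>log_abs L \<kappa> (moebius_act g \<tau>) - \<kappa> * ln (Im \<tau>) + r g * Im \<tau>\<bar> \<le> C"
    using assms(1) g unfolding admissible_def by blast
  show "\<exists>B C. \<forall>\<tau>. Im \<tau> > 0 \<longrightarrow> Im \<tau> \<ge> B \<longrightarrow>
       \<bar>Re (of_real x * L (moebius_act g \<tau>)) + (x * \<kappa>) * ln (Im (moebius_act g \<tau>)) - (x * \<kappa>) * ln (Im \<tau>) + (x * r g) * Im \<tau>\<bar> \<le> C"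
  proof (rule exI[of _ B], rule exI[of _ "\<bar>x\<bar> * C"], intro allI impI)
    fix \<tau> assume \<tau>: "0 < Im \<tau>" "B \<le> Im \<tau>"
    let ?x = "log_abs L \<kappa> (moebius_act g \<tau>) - \<kappa> * ln (Im \<tau>) + r g * Im \<tau>"
    have "\<bar>?x\<bar> \<le> C" using 1[of \<tau>] \<tau> by auto
    then have "\<bar>x * ?x\<bar> \<le> \<bar>x\<bar> * C" by (simp add: abs_mult mult_left_mono)
    then show "\<bar>Re (of_real x * L (moebius_act g \<tau>)) + (x * \<kappa>) * ln (Im (moebius_act g \<tau>)) - (x * \<kappa>) * ln (Im \<tau>) + (x * r g) * Im \<tau>\<bar> \<le> \<bar>x\<bar> * C"
      by (simp add: algebra_simps)
  qed
qed

lemma admissible_sum: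
  assumes "finite J" "\<And>i. i \<in> J \<Longrightarrow> admissible N (L i) (\<kappa> i) (r i)"
  shows "admissible N (\<lambda>\<tau>. \<Sum>i\<in>J. of_real (x i) * L i \<tau>) (\<Sum>i\<in>J. x i * \<kappa> i) (\<lambda>g. \<Sum>i\<in>J. x i * r i g)"
  using assms by (induction J rule: finite_induct) (auto intro!: admissible_zero admissible_add admissible_cmult)

text \<open>Matrices with equal labels differ by the congruence subgroup on the left, which
  preserves the invariant function, and by a translation on the right, which preserves Im \<tau>.
  Subtracting the two growth estimates on the imaginary axis bounds (r g' - r g) y for all large
  y.\<close>

lemma admissible_order_unique:
  assumes "admissible N L \<kappa> r" "N > 0" "g \<in> SL2Z" "g' \<in> SL2Z" "cusp_label N g = cusp_label N g'"
  shows "r g = r g'"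
proof -
  obtain g0 n where g0: "g0 \<in> Gamma0 N" and
    eq: "\<And>\<tau>. Im \<tau> > 0 \<Longrightarrow> moebius_act g' \<tau> = moebius_act g0 (moebius_act g (\<tau> + of_int n))"
    using cusp_label_eqD[OF assms(2-5)] by blast
  obtain B C where 1: "\<And>\<tau>. Im \<tau> > 0 \<Longrightarrow> Im \<tau> \<ge> B \<Longrightarrow> \<bar>log_abs L \<kappa> (moebius_act g \<tau>) - \<kappa> * ln (Im \<tau>) + r g * Im \<tau>\<bar> \<le> C"
    using assms unfolding admissible_def by blast
  obtain B' C' where 2: "\<And>\<tau>. Im \<tau> > 0 \<Longrightarrow> Im \<tau> \<ge> B' \<Longrightarrow> \<bar>log_abs L \<kappa> (moebius_act g' \<tau>) - \<kappa> * ln (Im \<tau>) + r g' * Im \<tau>\<bar> \<le> C'"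
    using assms unfolding admissible_def by blast
  have bd: "\<bar>r g' - r g\<bar> * y \<le> C + C'" if y: "y > 0" "y \<ge> B" "y \<ge> B'" for y
  proof -
    define \<tau> where "\<tau> = Complex 0 y"
    have "Im (moebius_act g (\<tau> + of_int n)) > 0" using Im_moebius_act_pos[OF assms(3)] y by (simp add: \<tau>_def)
    then have "log_abs L \<kappa> (moebius_act g' \<tau>) =
      log_abs L \<kappa> (moebius_act g (\<tau> + of_int n))"
      using eq[of \<tau>] y assms(1) g0 unfolding admissible_def by (simp add: \<tau>_def)
    then have "\<bar>(r g' - r g) * y\<bar> \<le> C + C'"
      using 1[of "\<tau> + of_int n"] 2[of \<tau>] y by (simp add: \<tau>_def algebra_simps abs_le_iff)
    then show ?thesis using y by (simp add: abs_mult)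
  qed
  show ?thesis
  proof (rule ccontr)
    assume "r g \<noteq> r g'"
    then have p: "\<bar>r g' - r g\<bar> > 0" by simp
    define y where "y = max (max 1 (max B B')) ((C + C' + 1) / \<bar>r g' - r g\<bar>)"
    have "C + C' + 1 \<le> \<bar>r g' - r g\<bar> * y"
    proof -
      have "(C + C' + 1) / \<bar>r g' - r g\<bar> \<le> y" by (simp add: y_def)
      then show ?thesis using p by (simp add: pos_divide_le_eq mult.commute)
    qed
    moreover have "\<bar>r g' - r g\<bar> * y \<le> C + C'" by (rule bd) (auto simp: y_def)
    ultimately show False by simp
  qed
qed

text \<open>Dividing by D, which has absolute value at least 1 and tends to infinity, makes the
  maximum modulus principle applicable on a half disc; then e tends to 0. It is meant for cusps at
  which only the absolute value of the function is known to be periodic, so that no expansion in a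
  local parameter is at hand.\<close>

lemma phragmen_lindelof_halfplane:
  fixes h :: "complex \<Rightarrow> complex"
  assumes hol: "h holomorphic_on {z. Im z > 0}" and Y: "Y > 0"
    and C: "\<And>z. Im z \<ge> Y \<Longrightarrow> norm (h z) \<le> C" and m: "\<And>z. Im z = Y \<Longrightarrow> norm (h z) \<le> m" and m0: "m > 0"
    and z: "Im z \<ge> Y"
  shows "norm (h z) \<le> m"
proof -
  have key: "norm (h z) \<le> m * norm (1 - \<i> * of_real e * (z - \<i> * of_real Y))" if e: "e > 0" for e
  proof -
    define D where "D = (\<lambda>z. 1 - \<i> * of_real e * (z - \<i> * of_real Y))"
    have D1: "norm (D z) \<ge> 1" if "Im z \<ge> Y" for z
    proof -
      have "1 \<le> Re (D z)" using e that by (simp add: D_def)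
      also have "\<dots> \<le> norm (D z)" by (rule complex_Re_le_cmod)
      finally show ?thesis .
    qed
    have D2: "norm (D z) \<ge> e * norm (z - \<i> * of_real Y)" if "Im z \<ge> Y" for z
    proof (rule power2_le_imp_le)
      have "(norm (D z))\<^sup>2 = (1 + e * (Im z - Y))\<^sup>2 + (e * Re z)\<^sup>2"
        by (simp add: cmod_power2 D_def)
      moreover have "(e * norm (z - \<i> * of_real Y))\<^sup>2 = (e * Re z)\<^sup>2 + (e * (Im z - Y))\<^sup>2"
        by (simp add: cmod_power2 power_mult_distrib distrib_left)
      moreover have "(e * (Im z - Y))\<^sup>2 \<le> (1 + e * (Im z - Y))\<^sup>2" using e that by (intro power_mono) auto
      ultimately show "(e * norm (z - \<i> * of_real Y))\<^sup>2 \<le> (norm (D z))\<^sup>2" by simp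
    qed simp
    \<comment> \<open>The radius is large enough to include z and to give e * R \<ge> |C| / m, so
      that the crude bound C suffices on the arc.\<close>
    define R where "R = norm (z - \<i> * of_real Y) + \<bar>C\<bar> / (e * m) + 1"
    define S where "S = {w. Im w \<ge> Y} \<inter> cball (\<i> * of_real Y) R"
    have cS: "closed S" unfolding S_def by (intro closed_Int closed_cball) (simp add: closed_halfspace_Im_ge)
    have SH: "S \<subseteq> {w. Im w > 0}" using Y by (auto simp: S_def)
    have D0: "D w \<noteq> 0" if "w \<in> S" for w using D1[of w] that by (auto simp: S_def)
    have hS: "(\<lambda>w. h w / D w) holomorphic_on S"
      using hol SH D0 by (intro holomorphic_on_divide) (auto simp: D_def intro!: holomorphic_intros elim: holomorphic_on_subset)
    have "norm (h z / D z) \<le> m"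
    proof (rule maximum_modulus_frontier[where S = S and f = "\<lambda>w. h w / D w"])
      show "(\<lambda>w. h w / D w) holomorphic_on interior S" using hS interior_subset by (rule holomorphic_on_subset)
      show "continuous_on (closure S) (\<lambda>w. h w / D w)"
        using holomorphic_on_imp_continuous_on[OF hS] cS by (simp add: closure_closed)
      show "bounded S" unfolding S_def by (rule bounded_subset[OF bounded_cball]) auto
      show "z \<in> S" using z m0 e by (simp add: S_def R_def dist_norm norm_minus_commute)
      fix w assume w: "w \<in> frontier S"
      then have wS: "w \<in> S" using cS frontier_subset_closed by blast
      show "norm (h w / D w) \<le> m"
      proof (cases "Im w = Y")
        case True
        have "norm (h w) \<le> m * 1" using m[OF True] by simp
        also have "\<dots> \<le> m * norm (D w)" using D1[of w] True m0 by (intro mult_left_mono) auto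
        finally show ?thesis using D0[OF wS] by (simp add: norm_divide divide_le_eq)
      next
        case False
        have "norm (w - \<i> * of_real Y) = R"
        proof (rule ccontr)
          assume "norm (w - \<i> * of_real Y) \<noteq> R"
          then have "w \<in> {w. Im w > Y} \<inter> ball (\<i> * of_real Y) R"
            using wS False by (auto simp: S_def dist_norm norm_minus_commute)
          moreover have "open ({w. Im w > Y} \<inter> ball (\<i> * of_real Y) R)"
            by (intro open_Int open_ball) (simp add: open_halfspace_Im_gt)
          moreover have "{w. Im w > Y} \<inter> ball (\<i> * of_real Y) R \<subseteq> S" by (auto simp: S_def)
          ultimately have "w \<in> interior S" by (metis interiorI)
          then show False using w by (simp add: frontier_def)
        qed
        then have "norm (D w) \<ge> e * R" using D2[of w] wS by (simp add: S_def)
        moreover have "e * R \<ge> \<bar>C\<bar> / m"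
        proof -
          have "\<bar>C\<bar> / m = e * (\<bar>C\<bar> / (e * m))" using e by simp
          also have "\<dots> \<le> e * R" using e by (intro mult_left_mono) (auto simp: R_def)
          finally show ?thesis .
        qed
        ultimately have "\<bar>C\<bar> / m \<le> norm (D w)" by linarith
        then have "\<bar>C\<bar> \<le> m * norm (D w)" using m0 by (simp add: divide_le_eq mult.commute)
        moreover have "norm (h w) \<le> \<bar>C\<bar>" using C[of w] wS by (simp add: S_def)
        ultimately show ?thesis using D0[OF wS] by (simp add: norm_divide divide_le_eq)
      qed
    qed
    moreover have "D z \<noteq> 0" using D1[OF z] by auto
    ultimately show ?thesis by (simp add: norm_divide divide_le_eq D_def)
  qed
  have "((\<lambda>e. m * norm (1 - \<i> * of_real e * (z - \<i> * of_real Y))) \<longlongrightarrow> m * norm (1 - \<i> * of_real 0 * (z - \<i> * of_real Y))) (at_right 0)"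
    by (intro tendsto_intros)
  moreover have "eventually (\<lambda>e. norm (h z) \<le> m * norm (1 - \<i> * of_real e * (z - \<i> * of_real Y))) (at_right 0)"
    using key by (simp add: eventually_at_right_less eventually_at_filter)
  ultimately have "norm (h z) \<le> m * norm (1 - \<i> * of_real 0 * (z - \<i> * of_real Y))"
    by (rule tendsto_lowerbound) auto
  then show ?thesis by simp
qed

text \<open>A maximum of Re V is a maximum of |exp V|, so exp V is constant; then V' exp V = 0 and
  V' vanishes.\<close>

lemma Re_max_imp_constant:
  assumes hol: "V holomorphic_on {\<tau>. Im \<tau> > 0}" and t: "Im t > 0"
    and max: "\<And>\<tau>. Im \<tau> > 0 \<Longrightarrow> Re (V \<tau>) \<le> Re (V t)" and \<tau>: "Im \<tau> > 0"
  shows "V \<tau> = V t"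
proof -
  let ?H = "{\<tau>. Im \<tau> > 0}"
  have op: "open ?H" by (simp add: open_halfspace_Im_gt)
  have con: "connected ?H" by (intro convex_connected) (simp add: convex_halfspace_Im_gt)
  have "(\<lambda>\<tau>. exp (V \<tau>)) holomorphic_on ?H" using hol by (intro holomorphic_intros)
  then have "(\<lambda>\<tau>. exp (V \<tau>)) constant_on ?H"
    by (rule maximum_modulus_principle[OF _ op con op order_refl, of _ t]) (use t max in \<open>auto simp: norm_exp_eq_Re\<close>)
  then obtain c where c: "exp (V w) = c" if "Im w > 0" for w by (auto simp: constant_on_def)
  have c0: "c \<noteq> 0" using c[OF t] by (metis exp_not_eq_zero)
  have "(V has_field_derivative 0) (at w within ?H)" if w: "w \<in> ?H" for w
  proof -
    obtain D where D: "(V has_field_derivative D) (at w)"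
      using hol op w by (auto simp: holomorphic_on_open)
    have "((\<lambda>\<tau>. exp (V \<tau>)) has_field_derivative exp (V w) * D) (at w)"
      using D by (auto intro!: derivative_eq_intros)
    moreover have "((\<lambda>\<tau>. exp (V \<tau>)) has_field_derivative 0) (at w)"
      by (rule has_field_derivative_transform_within_open[OF _ op w, of "\<lambda>_. c"]) (use c in auto)
    ultimately have "exp (V w) * D = 0" by (rule DERIV_unique)
    then have "D = 0" by simp
    then show ?thesis using D has_field_derivative_at_within by blast
  qed
  then have "\<exists>c. \<forall>x\<in>?H. V x = c"
    by (intro has_field_derivative_zero_constant) (auto simp: convex_halfspace_Im_gt)
  then show ?thesis using \<tau> t by auto
qed

text \<open>For \<kappa> \<le> 0 the function U = Re L + \<kappa> ln Im \<tau> is subharmonic, and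
  it attains its maximum: for \<kappa> < 0 it tends to minus infinity at the cusps, and for \<kappa>
  = 0 it is bounded there and the Phragmen-Lindelof bound moves the supremum into a compact set. A
  subharmonic function with a maximum is constant, which excludes \<kappa> < 0.\<close>

theorem admissible_order_zero_nonpos:
  assumes adm: "admissible N L \<kappa> (\<lambda>_. 0)" and N: "N > 0" and \<kappa>: "\<kappa> \<le> 0"
  shows "\<kappa> = 0 \<and> (\<exists>c. \<forall>\<tau>. Im \<tau> > 0 \<longrightarrow> L \<tau> = c)"
proof -
  define U where "U = (\<lambda>\<tau>. log_abs L \<kappa> \<tau>)"
  have hL: "L holomorphic_on {\<tau>. Im \<tau> > 0}" using adm by (simp add: admissible_def)
  have inv: "U (moebius_act g \<tau>) = U \<tau>" if "g \<in> Gamma0 N" "Im \<tau> > 0" for g \<tau>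
    using adm that unfolding admissible_def U_def by blast
  have growth: "\<exists>B C. \<forall>\<tau>. Im \<tau> > 0 \<longrightarrow> Im \<tau> \<ge> B \<longrightarrow> \<bar>U (moebius_act g \<tau>) - \<kappa> * ln (Im \<tau>)\<bar> \<le> C" if "g \<in> SL2Z" for g
    using adm that unfolding admissible_def U_def by simp
  have contU: "continuous_on {\<tau>. Im \<tau> > 0} U"
    unfolding U_def by (intro continuous_intros holomorphic_on_imp_continuous_on hL) auto
  \<comment> \<open>The lower row modulo N determines the coset of the congruence subgroup, so
    finitely many matrices give bounds that are uniform over SL2(Z).\<close>
  define key where "key = (\<lambda>(a::int, b::int, c, d). (c mod int N, d mod int N))"
  have "key ` SL2Z \<subseteq> {0..<int N} \<times> {0..<int N}" using N by (auto simp: key_def)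
  then have fk: "finite (key ` SL2Z)" by (rule finite_subset) auto
  define R where "R = (\<lambda>k. SOME g. g \<in> SL2Z \<and> key g = k) ` (key ` SL2Z)"
  have fR: "finite R" using fk by (simp add: R_def)
  have repr: "\<exists>h\<in>R. h \<in> SL2Z \<and> key h = key g" if "g \<in> SL2Z" for g
  proof -
    have "(SOME h. h \<in> SL2Z \<and> key h = key g) \<in> SL2Z \<and> key (SOME h. h \<in> SL2Z \<and> key h = key g) = key g"
      by (rule someI[of _ g]) (use that in simp)
    then show ?thesis using that unfolding R_def by blast
  qed
  have RS: "R \<subseteq> SL2Z"
  proof
    fix h assume "h \<in> R"
    then obtain g where "g \<in> SL2Z" "h = (SOME h. h \<in> SL2Z \<and> key h = key g)" by (auto simp: R_def)
    then show "h \<in> SL2Z" using someI[of "\<lambda>h. h \<in> SL2Z \<and> key h = key g" g] by auto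
  qed
  have coset: "U (moebius_act g \<tau>) = U (moebius_act h \<tau>)" if "g \<in> SL2Z" "h \<in> SL2Z" "key g = key h" "Im \<tau> > 0" for g h \<tau>
  proof -
    note gh = that
    obtain a b c d where g: "g = (a, b, c, d)" by (cases g)
    obtain a' b' c' d' where h: "h = (a', b', c', d')" by (cases h)
    have "[c = c'] (mod int N)" "[d = d'] (mod int N)" using gh(3) by (auto simp: g h key_def cong_def)
    then have "[c * d' = c' * d] (mod int N)" by (meson cong_mult cong_sym)
    then have "int N dvd c * d' - d * c'" by (simp add: cong_iff_dvd_diff mult.commute)
    then obtain g0 where "g0 \<in> Gamma0 N" "moebius_act h \<tau> = moebius_act g0 (moebius_act g \<tau>)"
      using Gamma0_coset[of a b c d a' b' c' d' N] gh(1,2,4) unfolding g h by blast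
    then show ?thesis using inv Im_moebius_act_pos gh by metis
  qed
  obtain B C where BC: "\<And>g \<tau>. g \<in> R \<Longrightarrow> Im \<tau> > 0 \<Longrightarrow> Im \<tau> \<ge> B g \<Longrightarrow> \<bar>U (moebius_act g \<tau>) - \<kappa> * ln (Im \<tau>)\<bar> \<le> C g"
    using growth RS by (metis subsetD)
  define B0 where "B0 = 1 + (\<Sum>g\<in>R. \<bar>B g\<bar>)"
  define C0 where "C0 = (\<Sum>g\<in>R. \<bar>C g\<bar>)"
  have B01: "B0 \<ge> 1" by (simp add: B0_def sum_nonneg)
  have bound: "\<bar>U (moebius_act g \<tau>) - \<kappa> * ln (Im \<tau>)\<bar> \<le> C0" if g: "g \<in> SL2Z" and \<tau>: "Im \<tau> \<ge> B0" for g \<tau>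
  proof -
    obtain h where h: "h \<in> R" "h \<in> SL2Z" "key h = key g" using repr[OF g] by blast
    have \<tau>0: "Im \<tau> > 0" using \<tau> B01 by simp
    have "\<bar>B h\<bar> \<le> (\<Sum>g\<in>R. \<bar>B g\<bar>)" "\<bar>C h\<bar> \<le> (\<Sum>g\<in>R. \<bar>C g\<bar>)" using h fR by (auto intro!: member_le_sum)
    then have "Im \<tau> \<ge> B h" "C h \<le> C0" using \<tau> by (auto simp: B0_def C0_def)
    then have "\<bar>U (moebius_act h \<tau>) - \<kappa> * ln (Im \<tau>)\<bar> \<le> C0" using BC[of h \<tau>] h \<tau>0 by linarith
    then show ?thesis using coset[OF g h(2) h(3)[symmetric] \<tau>0] by simp
  qed
  \<comment> \<open>For \<kappa> < 0 this is the height from which C0 + \<kappa> ln Im \<tau> stays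
    below U(i), so points beyond it cannot exceed the maximum over the compact part.\<close>
  define Y where "Y = (if \<kappa> = 0 then B0 else max B0 (exp ((U \<i> - C0) / \<kappa>)))"
  have Y: "Y \<ge> B0" "Y \<ge> 1" using B01 by (auto simp: Y_def)
  define box where "box = cbox (Complex (-1/2) (1/2)) (Complex (1/2) Y)"
  have box: "z \<in> box \<longleftrightarrow> \<bar>Re z\<bar> \<le> 1/2 \<and> 1/2 \<le> Im z \<and> Im z \<le> Y" for z
    by (auto simp: box_def in_cbox_complex_iff abs_le_iff)
  define K where "K = (\<Union>g\<in>R. moebius_act g ` box)"
  have compK: "compact K" unfolding K_def
  proof (intro compact_UN fR compact_continuous_image)
    fix g assume "g \<in> R"
    then have g: "g \<in> SL2Z" using RS by auto
    obtain a b c d where ge: "g = (a, b, c, d)" by (cases g)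
    have "of_int c * \<tau> + of_int d \<noteq> 0" if "\<tau> \<in> box" for \<tau>
      using automorphy_factor_nonzero[OF g, of \<tau>] that by (simp add: ge automorphy_factor_def box)
    then show "continuous_on box (moebius_act g)"
      by (auto simp: ge moebius_act_def intro!: continuous_intros)
  qed (simp add: box_def compact_cbox)
  have KH: "K \<subseteq> {\<tau>. Im \<tau> > 0}"
    using Im_moebius_act_pos RS by (auto simp: K_def box)
  have id: "(1, 0, 0, 1) \<in> SL2Z" by (simp add: SL2Z_iff)
  obtain h1 where h1: "h1 \<in> R" "h1 \<in> SL2Z" "key h1 = key (1, 0, 0, 1)" using repr[OF id] by blast
  have ibox: "\<i> \<in> box" using Y by (simp add: box)
  have Kne: "K \<noteq> {}" using h1(1) ibox unfolding K_def by blast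
  obtain t where t: "t \<in> K" and tmax: "\<And>y. y \<in> K \<Longrightarrow> U y \<le> U t"
    using continuous_attains_sup[OF compK Kne continuous_on_subset[OF contU KH]] by blast
  have t0: "Im t > 0" using t KH by auto
  have boxmax: "U (moebius_act g \<tau>) \<le> U t" if g: "g \<in> SL2Z" and \<tau>: "\<tau> \<in> box" for g \<tau>
  proof -
    obtain h where h: "h \<in> R" "h \<in> SL2Z" "key h = key g" using repr[OF g] by blast
    have "Im \<tau> > 0" using \<tau> by (simp add: box)
    then have "U (moebius_act g \<tau>) = U (moebius_act h \<tau>)" using coset g h by metis
    then show ?thesis using tmax h(1) \<tau> unfolding K_def by auto
  qed
  have Ui: "U \<i> \<le> U t" using boxmax[OF id ibox] by (simp add: moebius_act_def)
  have tmax': "U \<tau> \<le> U t" if \<tau>: "Im \<tau> > 0" for \<tau>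
  proof -
    obtain g \<tau>0 where g: "g \<in> SL2Z" and \<tau>0: "\<tau> = moebius_act g \<tau>0" "Im \<tau>0 \<ge> 1/2" "\<bar>Re \<tau>0\<bar> \<le> 1/2"
      using fundamental_domain[OF \<tau>] by blast
    consider "Im \<tau>0 \<le> Y" | "Im \<tau>0 > Y" "\<kappa> = 0" | "Im \<tau>0 > Y" "\<kappa> < 0" using \<kappa> by linarith
    then show ?thesis
    proof cases
      case 1 then show ?thesis using boxmax[OF g, of \<tau>0] \<tau>0 by (simp add: box)
    next
      case 2
      define h where "h = (\<lambda>z. exp (L (moebius_act g z)))"
      obtain a b c d where ge: "g = (a, b, c, d)" by (cases g)
      have "moebius_act g holomorphic_on {z. Im z > 0}"
        using automorphy_factor_nonzero[OF g] unfolding ge moebius_act_def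
        by (auto simp: automorphy_factor_def intro!: holomorphic_intros)
      then have "(L \<circ> moebius_act g) holomorphic_on {z. Im z > 0}"
        by (rule holomorphic_on_compose_gen[OF _ hL]) (use Im_moebius_act_pos[OF g] in auto)
      then have hh: "h holomorphic_on {z. Im z > 0}" unfolding h_def by (intro holomorphic_intros) (simp add: o_def)
      have nh: "norm (h z) = exp (U (moebius_act g z))" for z by (simp add: h_def U_def 2 norm_exp_eq_Re)
      have "norm (h \<tau>0) \<le> exp (U t)"
      proof (rule phragmen_lindelof_halfplane[OF hh, of Y "exp C0"])
        show "norm (h z) \<le> exp C0" if "Im z \<ge> Y" for z
          using bound[OF g, of z] that Y by (simp add: nh 2 abs_le_iff)
        show "norm (h z) \<le> exp (U t)" if z: "Im z = Y" for z
        proof -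
          \<comment> \<open>A point of the line Im z = Y is translated into the box; the translation
            is absorbed into the matrix.\<close>
          define n where "n = round (Re z)"
          have "moebius_act (mmul g (1, n, 0, 1)) (z - of_int n) = moebius_act g z"
            using moebius_mmul[OF g translation_SL2Z, of "z - of_int n" n] z Y by (simp add: moebius_translation)
          moreover have "z - of_int n \<in> box" using z Y of_int_round_abs_le[of "Re z"]
            by (simp add: box n_def abs_minus_commute)
          ultimately have "U (moebius_act g z) \<le> U t"
            using boxmax[OF mmul_SL2Z[OF g translation_SL2Z[of n]], of "z - of_int n"] by simp
          then show ?thesis by (simp add: nh)
        qed
      qed (use Y 2 in auto)
      then show ?thesis by (simp add: nh \<tau>0)
    next
      case 3
      have "exp ((U \<i> - C0) / \<kappa>) \<le> Im \<tau>0" using 3 by (simp add: Y_def)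
      moreover have "Im \<tau>0 > 0" using 3 Y by linarith
      ultimately have "(U \<i> - C0) / \<kappa> \<le> ln (Im \<tau>0)" by (simp add: ln_ge_iff)
      then have "\<kappa> * ln (Im \<tau>0) \<le> U \<i> - C0" using 3 by (simp add: neg_divide_le_eq mult.commute)
      moreover have "\<bar>U (moebius_act g \<tau>0) - \<kappa> * ln (Im \<tau>0)\<bar> \<le> C0" using bound[OF g] 3 Y by simp
      ultimately show ?thesis using Ui \<tau>0 by (simp add: abs_le_iff)
    qed
  qed
  define y where "y = Im t"
  \<comment> \<open>ln Im \<tau> is replaced by its tangent at y = Im t, which is the real part of a
    holomorphic function. Concavity of ln and \<kappa> \<le> 0 give Re V \<le> U with equality at t,
    so Re V has its maximum at t as well.\<close>
  define V where "V = (\<lambda>\<tau>. L \<tau> + of_real \<kappa> * (of_real (ln y - 1) - \<i> * \<tau> / of_real y))"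
  have hV: "V holomorphic_on {\<tau>. Im \<tau> > 0}" unfolding V_def
    by (intro holomorphic_intros hL) (use t0 in \<open>auto simp: y_def\<close>)
  have ReV: "Re (V \<tau>) = Re (L \<tau>) + \<kappa> * (ln y - 1 + Im \<tau> / y)" for \<tau> by (simp add: V_def)
  have VU: "Re (V \<tau>) \<le> U \<tau>" if "Im \<tau> > 0" for \<tau>
  proof -
    have "ln (Im \<tau> / y) \<le> Im \<tau> / y - 1" using that t0 by (intro ln_le_minus_one) (simp add: y_def)
    then have "ln (Im \<tau>) \<le> ln y - 1 + Im \<tau> / y" using that t0 by (simp add: ln_div y_def)
    then show ?thesis using \<kappa> by (simp add: ReV U_def mult_left_mono_neg)
  qed
  have Vt: "Re (V t) = U t" using t0 by (simp add: ReV U_def y_def)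
  have Vc: "V \<tau> = V t" if "Im \<tau> > 0" for \<tau>
    by (rule Re_max_imp_constant[OF hV t0 _ that]) (use VU tmax' Vt in fastforce)
  have \<kappa>0: "\<kappa> = 0"
  proof (rule ccontr)
    assume "\<kappa> \<noteq> 0"
    then have neg: "\<kappa> < 0" using \<kappa> by simp
    \<comment> \<open>At 2 t the tangent inequality is strict: \<kappa> < 0 would force ln 2 \<ge>
      1.\<close>
    have I2: "Im (2 * t) > 0" using t0 by simp
    have "U (2 * t) \<le> Re (V (2 * t))" using tmax'[OF I2] Vc[OF I2] Vt by simp
    then have "\<kappa> * ln (2 * y) \<le> \<kappa> * (ln y + 1)" using t0 by (simp add: ReV U_def y_def add.commute)
    then have "ln y + 1 \<le> ln (2 * y)" using neg by simp
    then have "ln 2 \<ge> (1::real)" using t0 by (simp add: ln_mult y_def)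
    then show False using ln_2_less_1 by simp
  qed
  then show ?thesis using Vc by (auto simp: V_def)
qed

text \<open>If \<kappa> > 0, the preceding result applies to -L, whose orders are still 0 and whose
  weight is negative.\<close>

corollary admissible_order_zero:
  assumes adm: "admissible N L \<kappa> (\<lambda>_. 0)" and N: "N > 0"
  shows "\<exists>c. \<forall>\<tau>. Im \<tau> > 0 \<longrightarrow> L \<tau> = c"
proof (cases "\<kappa> \<le> 0")
  case False
  then show ?thesis
    using admissible_order_zero_nonpos[of N "\<lambda>\<tau>. of_real (-1) * L \<tau>" "-1 * \<kappa>"] admissible_cmult[OF adm, of "-1"] N by simp
qed (use admissible_order_zero_nonpos[OF adm N] in blast)

section \<open>Logarithms of products in the nome\<close>

text \<open>The double series over n, m \<ge> 1 is rearranged by the product M = n m. Absolute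
  convergence comes from (n+1)(m+1) \<ge> n + m, which bounds the terms by a product of two
  geometric series.\<close>

lemma lambert_series:
  fixes b :: "nat \<Rightarrow> nat \<Rightarrow> complex"
  assumes b: "\<And>n m. n > 0 \<Longrightarrow> m > 0 \<Longrightarrow> norm (b n m) \<le> C" and q: "norm q < 1"
    and h: "\<And>n. (\<lambda>m. b (Suc n) (Suc m) * (q ^ Suc n) ^ Suc m) sums h n"
  shows "\<exists>S. h sums S \<and> (\<lambda>M. (\<Sum>n | n dvd Suc M. b n (Suc M div n)) * q ^ Suc M) sums S"
proof -
  define f where "f = (\<lambda>(n, m). b (Suc n) (Suc m) * (q ^ Suc n) ^ Suc m)"
  have sq: "(\<lambda>n. norm q ^ n) summable_on UNIV"
    using q by (intro norm_summable_imp_summable_on) (simp add: norm_power summable_geometric)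
  define r where "r = (\<lambda>(n::nat, m::nat). C * (norm q ^ n * norm q ^ m))"
  have C0: "C \<ge> 0" using order_trans[OF norm_ge_zero b[of 1 1]] by simp
  have "r summable_on UNIV \<times> UNIV"
  proof (rule summable_on_SigmaI)
    show "((\<lambda>m. r (n, m)) has_sum (C * (norm q ^ n * (\<Sum>\<^sub>\<infinity>m. norm q ^ m)))) UNIV" for n
      unfolding r_def using sq by (auto intro!: has_sum_cmult_right has_sum_infsum)
    show "(\<lambda>n. C * (norm q ^ n * (\<Sum>\<^sub>\<infinity>m. norm q ^ m))) summable_on UNIV"
      using sq by (intro summable_on_cmult_right summable_on_cmult_left)
    show "r (n, m) \<ge> 0" for n m using C0 by (simp add: r_def)
  qed
  then have "(\<lambda>x. norm (r x)) summable_on UNIV \<times> UNIV"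
    using C0 by (simp add: r_def case_prod_unfold abs_mult del: UNIV_Times_UNIV)
  then have "(\<lambda>x. norm (f x)) summable_on UNIV \<times> UNIV"
  proof (rule Infinite_Sum.abs_summable_on_comparison_test)
    fix x :: "nat \<times> nat" 
    obtain n m where x: "x = (n, m)" by (cases x)
    have "norm ((q ^ Suc n) ^ Suc m) = norm q ^ (n + m + (Suc n * Suc m - (n + m)))"
      by (simp add: norm_power power_mult[symmetric] add.assoc del: power_Suc)
    also have "\<dots> \<le> norm q ^ (n + m)" using q by (intro power_decreasing) auto
    finally have "norm ((q ^ Suc n) ^ Suc m) \<le> norm q ^ n * norm q ^ m" by (simp add: power_add)
    then have "norm (b (Suc n) (Suc m)) * norm ((q ^ Suc n) ^ Suc m) \<le> C * (norm q ^ n * norm q ^ m)"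
      using b C0 by (intro mult_mono) auto
    then show "norm (f x) \<le> norm (r x)" using C0 by (simp add: x f_def r_def norm_mult abs_mult)
  qed
  then have fs: "f summable_on UNIV \<times> UNIV" by (rule Infinite_Sum.abs_summable_summable)
  then obtain S where S: "(f has_sum S) (UNIV \<times> UNIV)" by (auto simp: summable_on_def)
  have "((\<lambda>m. f (n, m)) has_sum h n) UNIV" for n
  proof -
    have "(\<lambda>m. f (n, m)) summable_on UNIV" using summable_on_SigmaD1[of "\<lambda>n m. f (n, m)" UNIV "\<lambda>_. UNIV" n] fs by simp
    then obtain s where s: "((\<lambda>m. f (n, m)) has_sum s) UNIV" by (auto simp: summable_on_def)
    then have "(\<lambda>m. f (n, m)) sums s" by (rule has_sum_imp_sums)
    then have "s = h n" using h[of n] sums_unique2 by (simp add: f_def)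
    then show ?thesis using s by simp
  qed
  then have "(h has_sum S) UNIV" using has_sum_SigmaD[OF S] by simp
  then have 1: "h sums S" by (rule has_sum_imp_sums)
  \<comment> \<open>Summation starts at 0, so the first component M stands for the exponent M + 1,
    whereas the second component is the divisor itself.\<close>
  define g where "g = (\<lambda>(n, m). (Suc n * Suc m - 1, Suc n))"
  define f' where "f' = (\<lambda>(M, n). b n (Suc M div n) * q ^ Suc M)"
  have g: "bij_betw g (UNIV \<times> UNIV) (SIGMA M:UNIV. {n. n dvd Suc M})"
  proof (rule bij_betwI[of _ _ _ "\<lambda>(M, n). (n - 1, Suc M div n - 1)"])
    show "g \<in> UNIV \<times> UNIV \<rightarrow> (SIGMA M:UNIV. {n. n dvd Suc M})"
    proof
      fix x :: "nat \<times> nat"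
      obtain n m where x: "x = (n, m)" by (cases x)
      have "Suc (Suc n * Suc m - 1) = Suc n * Suc m" by simp
      then show "g x \<in> (SIGMA M:UNIV. {n. n dvd Suc M})" by (simp only: x g_def case_prod_conv mem_Sigma_iff UNIV_I mem_Collect_eq dvd_triv_left simp_thms)
    qed
    show "(case g x of (M, n) \<Rightarrow> (n - 1, Suc M div n - 1)) = x" for x
    proof -
      obtain n m where x: "x = (n, m)" by (cases x)
      have "Suc (Suc n * Suc m - 1) div Suc n = Suc m" by (metis Suc_diff_1 nat_0_less_mult_iff nonzero_mult_div_cancel_left old.nat.distinct(2) zero_less_Suc)
      then show ?thesis by (simp only: x g_def case_prod_conv) simp
    qed
    show "g (case y of (M, n) \<Rightarrow> (n - 1, Suc M div n - 1)) = y" if "y \<in> (SIGMA M:UNIV. {n. n dvd Suc M})" for y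
    proof -
      obtain M n where y: "y = (M, n)" by (cases y)
      with that obtain k where k: "Suc M = n * k" by auto
      then have nk: "n > 0" "k > 0" by (auto intro: Nat.gr0I)
      have "Suc M div n = k" using k nk by simp
      moreover have "Suc (n - 1) = n" "Suc (k - 1) = k" using nk by auto
      moreover have "n * k - 1 = M" using k by simp
      ultimately show ?thesis by (simp only: y g_def case_prod_conv)
    qed
  qed simp
  have "f x = f' (g x)" for x
  proof -
    obtain n m where x: "x = (n, m)" by (cases x)
    have e: "Suc (Suc n * Suc m - 1) = Suc n * Suc m" by simp
    show ?thesis unfolding x g_def f'_def f_def case_prod_conv e by (simp del: mult_Suc mult_Suc_right power_Suc add: power_mult)
  qed
  then have "f = (\<lambda>x. f' (g x))" by auto
  then have S': "(f' has_sum S) (SIGMA M:UNIV. {n. n dvd Suc M})"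
    using S has_sum_reindex_bij_betw[OF g, of f' S] by simp
  have "((\<lambda>M. \<Sum>n | n dvd Suc M. f' (M, n)) has_sum S) UNIV"
    by (rule has_sum_SigmaD[OF S']) (simp add: has_sum_finite)
  then have "(\<lambda>M. \<Sum>n | n dvd Suc M. f' (M, n)) sums S" by (rule has_sum_imp_sums)
  then show ?thesis using 1 by (auto simp: f'_def sum_distrib_right)
qed

section \<open>Logarithms of products with roots of unity\<close>

abbreviation unity_root :: "nat \<Rightarrow> nat \<Rightarrow> complex" where
  "unity_root u a \<equiv> exp (2 * of_real pi * \<i> * of_nat a / of_nat u)"

lemma norm_unity_root [simp]: "norm (unity_root u a) = 1"
  by (simp add: norm_exp_eq_Re)

lemma norm_unity_root_power_less_1:
  assumes "norm (q :: complex) < 1" shows "norm (unity_root u a * q ^ Suc n) < 1"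
proof -
  have "norm q ^ Suc n < 1" using power_less_one_iff[of "norm q" "Suc n"] assms by simp
  then show ?thesis by (simp only: norm_mult norm_power norm_unity_root mult_1)
qed

lemma unity_root_nome: "unity_root u a = nome (of_nat a / of_nat u)"
  by (simp add: nome_def)

text \<open>Logarithm of the product of all (1 - e^(2 pi i a/u) q^n)^(c n a), with the principal
  logarithm in each factor. It covers at once \<eta> without its power of q (u = 1, c = 1), the
  functions attached to characters, and products with real weights.\<close>

definition log_product :: "nat \<Rightarrow> (nat \<Rightarrow> nat \<Rightarrow> complex) \<Rightarrow> complex \<Rightarrow> complex" where
  "log_product u c q = (\<Sum>n. \<Sum>a=1..u. c (Suc n) a * Ln (1 - unity_root u a * q ^ Suc n))"

abbreviation weighted_product :: "nat \<Rightarrow> (int \<Rightarrow> real) \<Rightarrow> complex \<Rightarrow> complex" where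
  "weighted_product u w \<equiv> log_product u (\<lambda>n a. complex_of_real (w (int (a * n))))"

text \<open>The coefficient of q^M, obtained from Ln (1 - x) = - sum x^m / m with x =
  \<open>unity_root u a * q ^ n\<close> and n m = M.\<close>

definition log_product_coeff :: "nat \<Rightarrow> (nat \<Rightarrow> nat \<Rightarrow> complex) \<Rightarrow> nat \<Rightarrow> complex" where
  "log_product_coeff u c M = (\<Sum>n | n dvd M. - (\<Sum>a=1..u. c n a * unity_root u a ^ (M div n)) / of_nat (M div n))"

definition bounded_coeff :: "(nat \<Rightarrow> nat \<Rightarrow> complex) \<Rightarrow> bool" where
  "bounded_coeff c \<longleftrightarrow> (\<exists>C. \<forall>n a. norm (c n a) \<le> C)"

lemma Ln_one_minus_sums:
  assumes "norm (x::complex) < 1" shows "(\<lambda>m. - (x ^ Suc m) / of_nat (Suc m)) sums Ln (1 - x)"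
proof -
  have "(\<lambda>m. - (x ^ m) / of_nat m) sums Ln (1 - x)" using Ln_series'[of "- x"] assms by simp
  then show ?thesis using sums_Suc_iff[of "\<lambda>m. - (x ^ m) / of_nat m"] by simp
qed

text \<open>The Lambert rearrangement links the defining series, whose convergence is thereby
  established, with a power series in q. The latter yields holomorphy on the disc and the
  coefficients for the independence argument.\<close>

lemma log_product_sums:
  assumes c: "bounded_coeff c" and q: "norm q < 1"
  shows "(\<lambda>n. \<Sum>a=1..u. c (Suc n) a * Ln (1 - unity_root u a * q ^ Suc n)) sums log_product u c q" (is ?A)
    and "(\<lambda>M. log_product_coeff u c (Suc M) * q ^ Suc M) sums log_product u c q" (is ?B)
proof -
  obtain C where C: "\<And>n a. norm (c n a) \<le> C" using c by (auto simp: bounded_coeff_def)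
  have C0: "C \<ge> 0" using C[of 0 0] norm_ge_zero[of "c 0 0"] by linarith
  define b where "b = (\<lambda>n m. - (\<Sum>a=1..u. c n a * unity_root u a ^ m) / of_nat m)"
  have "\<exists>S. (\<lambda>n. \<Sum>a=1..u. c (Suc n) a * Ln (1 - unity_root u a * q ^ Suc n)) sums S \<and>
     (\<lambda>M. (\<Sum>n | n dvd Suc M. b n (Suc M div n)) * q ^ Suc M) sums S"
  proof (rule lambert_series[OF _ q])
    fix n m :: nat assume "m > 0"
    have "norm (\<Sum>a=1..u. c n a * unity_root u a ^ m) \<le> (\<Sum>a=1..u. C)"
      by (rule sum_norm_le) (simp add: norm_mult norm_power C)
    then have "norm (b n m) \<le> (of_nat u * C) / of_nat m"
      by (simp add: b_def norm_divide divide_right_mono)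
    also have "\<dots> \<le> of_nat u * C / 1" using \<open>m > 0\<close> C0 by (intro divide_left_mono) auto
    finally show "norm (b n m) \<le> of_nat u * C" by simp
  next
    fix n
    have "norm (unity_root u a * q ^ Suc n) < 1" for a
      by (rule norm_unity_root_power_less_1[OF q])
    then have "(\<lambda>m. - ((unity_root u a * q ^ Suc n) ^ Suc m) / of_nat (Suc m)) sums Ln (1 - unity_root u a * q ^ Suc n)" for a
      by (rule Ln_one_minus_sums)
    then have "(\<lambda>m. \<Sum>a=1..u. c (Suc n) a * (- ((unity_root u a * q ^ Suc n) ^ Suc m) / of_nat (Suc m))) sums (\<Sum>a=1..u. c (Suc n) a * Ln (1 - unity_root u a * q ^ Suc n))"
      by (intro sums_sum sums_mult)
    also have "(\<lambda>m. \<Sum>a=1..u. c (Suc n) a * (- ((unity_root u a * q ^ Suc n) ^ Suc m) / of_nat (Suc m))) =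
      (\<lambda>m. b (Suc n) (Suc m) * (q ^ Suc n) ^ Suc m)"
      unfolding b_def power_mult_distrib
      by (simp add: sum_distrib_left sum_distrib_right sum_divide_distrib sum_negf mult_ac del: power_Suc of_nat_Suc)
    finally show "(\<lambda>m. b (Suc n) (Suc m) * (q ^ Suc n) ^ Suc m) sums (\<Sum>a=1..u. c (Suc n) a * Ln (1 - unity_root u a * q ^ Suc n))" .
  qed
  then obtain S where S: "(\<lambda>n. \<Sum>a=1..u. c (Suc n) a * Ln (1 - unity_root u a * q ^ Suc n)) sums S"
     "(\<lambda>M. (\<Sum>n | n dvd Suc M. b n (Suc M div n)) * q ^ Suc M) sums S" by blast
  have SL: "S = log_product u c q" unfolding log_product_def using S(1) by (rule sums_unique)
  show ?A using S(1) unfolding SL .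
  show ?B using S(2) unfolding SL log_product_coeff_def b_def .
qed

lemma log_product_power_series:
  assumes c: "bounded_coeff c" and q: "norm q < 1"
  shows "(\<lambda>M. (if M = 0 then 0 else log_product_coeff u c M) * q ^ M) sums log_product u c q"
  by (rule sums_Suc_imp) (use log_product_sums(2)[OF assms, of u] in simp_all)

lemma log_product_holomorphic_disc:
  assumes c: "bounded_coeff c" shows "log_product u c holomorphic_on ball 0 1"
proof (rule power_series_holomorphic[of 0 1 "\<lambda>M. if M = 0 then 0 else log_product_coeff u c M"])
  fix w :: complex assume "w \<in> ball 0 1"
  then have "norm w < 1" by simp
  from log_product_power_series[OF c this, of u]
  show "(\<lambda>n. (if n = 0 then 0 else log_product_coeff u c n) * (w - 0) ^ n) sums log_product u c w" unfolding diff_zero .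
qed

lemma log_product_0: "bounded_coeff c \<Longrightarrow> log_product u c 0 = 0"
  by (simp add: log_product_def)

lemma log_product_lincomb:
  assumes "\<And>i. i \<in> I \<Longrightarrow> bounded_coeff (c i)" "norm q < 1"
  shows "log_product u (\<lambda>n a. \<Sum>i\<in>I. x i * c i n a) q = (\<Sum>i\<in>I. x i * log_product u (c i) q)"
proof -
  have "(\<lambda>n. \<Sum>i\<in>I. x i * (\<Sum>a=1..u. c i (Suc n) a * Ln (1 - unity_root u a * q ^ Suc n))) sums (\<Sum>i\<in>I. x i * log_product u (c i) q)"
    by (intro sums_sum sums_mult log_product_sums(1) assms)
  also have "(\<lambda>n. \<Sum>i\<in>I. x i * (\<Sum>a=1..u. c i (Suc n) a * Ln (1 - unity_root u a * q ^ Suc n))) =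
    (\<lambda>n. \<Sum>a=1..u. (\<Sum>i\<in>I. x i * c i (Suc n) a) * Ln (1 - unity_root u a * q ^ Suc n))"
    (is "?l = ?r")
  proof
    fix n
    show "?l n = ?r n"
      unfolding sum_distrib_left sum_distrib_right by (subst sum.swap) (simp only: mult.assoc)
  qed
  finally show ?thesis by (simp add: log_product_def sums_iff)
qed

lemma one_minus_unity_root_nonzero: "norm q < 1 \<Longrightarrow> 1 - unity_root u a * q ^ Suc n \<noteq> 0"
proof
  assume q: "norm q < 1" and 0: "1 - unity_root u a * q ^ Suc n = 0"
  from 0 have "unity_root u a * q ^ Suc n = 1" unfolding right_minus_eq by (rule sym)
  then show False using norm_unity_root_power_less_1[OF q, where u = u and a = a and n = n] by (simp only: norm_one)
qed

lemma eta_character_exp: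
  assumes "bounded_coeff (\<lambda>n a. cnj (chi (int (a * n))))" "Im \<tau> > 0"
  shows "eta_character u chi \<tau> = exp (log_product u (\<lambda>n a. cnj (chi (int (a * n)))) (nome \<tau>))"
proof -
  note q = norm_nome_less_1[OF assms(2)]
  have "eta_character u chi \<tau> = (\<Prod>n. exp (\<Sum>a=1..u. cnj (chi (int (a * Suc n))) * Ln (1 - unity_root u a * nome \<tau> ^ Suc n)))"
    unfolding eta_character_def using one_minus_unity_root_nonzero[OF q]
    by (intro prodinf_cong) (simp add: exp_sum powr_def del: power_Suc)
  also have "\<dots> = exp (log_product u (\<lambda>n a. cnj (chi (int (a * n)))) (nome \<tau>))"
    unfolding log_product_def by (intro prodinf_exp sums_summable[OF log_product_sums(1)] assms q)
  finally show ?thesis .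
qed

definition log_eta :: "complex \<Rightarrow> complex" where
  "log_eta \<tau> = 2 * of_real pi * \<i> * \<tau> / 24 + log_product 1 (\<lambda>_ _. 1) (nome \<tau>)"

lemma bounded_coeff_1 [simp]: "bounded_coeff (\<lambda>_ _. 1)"
  by (auto simp: bounded_coeff_def)

lemma unity_root_self [simp]: "u > 0 \<Longrightarrow> unity_root u u = 1"
  by (simp add: exp_eq_1)

lemma dedekind_eta_exp:
  assumes "Im \<tau> > 0" shows "dedekind_eta \<tau> = exp (log_eta \<tau>)"
proof -
  note q = norm_nome_less_1[OF assms(1)]
  have e: "(\<lambda>n. \<Sum>a=1..1. 1 * Ln (1 - unity_root 1 a * nome \<tau> ^ Suc n)) = (\<lambda>n. Ln (1 - nome \<tau> ^ Suc n))"
    using unity_root_self[of 1] by (simp del: power_Suc)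
  have "(\<Prod>n. 1 - nome \<tau> ^ Suc n) = (\<Prod>n. exp (Ln (1 - nome \<tau> ^ Suc n)))"
    using one_minus_unity_root_nonzero[OF q, of 1 1] unity_root_self[of 1] by (intro prodinf_cong) (simp del: power_Suc)
  also have "\<dots> = exp (log_product 1 (\<lambda>_ _. 1) (nome \<tau>))"
    using sums_summable[OF log_product_sums(1)[OF bounded_coeff_1 q, of 1]]
    unfolding log_product_def e by (rule prodinf_exp)
  finally show ?thesis by (simp add: dedekind_eta_def log_eta_def exp_add)
qed

lemma log_product_nome_holomorphic:
  assumes "bounded_coeff c" "t > 0"
  shows "(\<lambda>\<tau>. log_product u c (nome (of_nat t * \<tau>))) holomorphic_on {\<tau>. Im \<tau> > 0}"
proof -
  have "(log_product u c \<circ> (\<lambda>\<tau>. nome (of_nat t * \<tau>))) holomorphic_on {\<tau>. Im \<tau> > 0}"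
    by (rule holomorphic_on_compose_gen[OF _ log_product_holomorphic_disc[OF assms(1)]])
      (use assms(2) in \<open>auto intro!: holomorphic_intros norm_nome_less_1\<close>)
  then show ?thesis by (simp add: o_def)
qed

text \<open>On the imaginary axis the linear term is real and the nome tends to 0, where
  \<open>log_product\<close> is continuous with value 0. High up on the axis therefore |Im L| < 1 <
  pi, and L is the principal logarithm there.\<close>

lemma log_branch_intro:
  assumes c: "bounded_coeff c" and t: "t > 0"
    and L: "\<And>\<tau>. Im \<tau> > 0 \<Longrightarrow> L \<tau> = \<i> * of_real x * \<tau> + log_product u c (nome (of_nat t * \<tau>))"
    and g: "\<And>\<tau>. Im \<tau> > 0 \<Longrightarrow> g \<tau> = exp (L \<tau>)"
  shows "log_branch g L"
  unfolding log_branch_def upper_half_plane_def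
proof (intro conjI)
  have "(\<lambda>\<tau>. \<i> * of_real x * \<tau> + log_product u c (nome (of_nat t * \<tau>))) holomorphic_on {\<tau>. Im \<tau> > 0}"
    by (intro holomorphic_intros log_product_nome_holomorphic c t)
  then have "L holomorphic_on {\<tau>. Im \<tau> > 0}" by (rule holomorphic_transform) (simp add: L)
  then show "continuous_on {\<tau>. Im \<tau> > 0} L" by (rule holomorphic_on_imp_continuous_on)
  show "\<forall>\<tau>\<in>{\<tau>. Im \<tau> > 0}. exp (L \<tau>) = g \<tau>" using g by simp
  have "continuous_on (ball 0 1) (log_product u c)" by (intro holomorphic_on_imp_continuous_on log_product_holomorphic_disc c)
  then have "isCont (log_product u c) 0" by (simp add: continuous_on_eq_continuous_at)
  then have "log_product u c \<midarrow>0\<rightarrow> 0" using log_product_0[OF c] by (simp add: isCont_def)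
  then have "eventually (\<lambda>q. norm (log_product u c q) < 1) (at 0)" using tendstoD[of "log_product u c" 0 "at 0" 1] by (simp add: dist_norm)
  moreover have "filterlim (\<lambda>y. nome (of_nat t * (\<i> * of_real y))) (at 0) at_top"
    unfolding filterlim_at
  proof
    have "((\<lambda>y::real. exp (- 2 * pi * (of_nat t * y))) \<longlongrightarrow> 0) at_top"
      using t by real_asymp
    then have "((\<lambda>y. norm (nome (of_nat t * (\<i> * of_real y)))) \<longlongrightarrow> 0) at_top" by (simp add: norm_nome)
    then show "((\<lambda>y. nome (of_nat t * (\<i> * of_real y))) \<longlongrightarrow> 0) at_top" by (rule tendsto_norm_zero_cancel)
  qed simp
  ultimately have "eventually (\<lambda>y::real. norm (log_product u c (nome (of_nat t * (\<i> * of_real y)))) < 1) at_top"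
    by (auto simp: filterlim_iff)
  then show "\<forall>\<^sub>F y in at_top. L (\<i> * of_real y) = Ln (g (\<i> * of_real y))"
    using eventually_gt_at_top[of 0]
  proof eventually_elim
    case (elim y)
    have "Im (L (\<i> * of_real y)) = Im (log_product u c (nome (of_nat t * (\<i> * of_real y))))" using elim by (simp add: L)
    moreover have "\<bar>Im (log_product u c (nome (of_nat t * (\<i> * of_real y))))\<bar> < 1" using elim abs_Im_le_cmod order_le_less_trans by blast
    ultimately have "\<bar>Im (L (\<i> * of_real y))\<bar> < pi" using pi_gt3 by simp
    then show ?case using elim by (simp add: g)
  qed
qed

section \<open>Products over residue classes in terms of Klein forms\<close>

lemma ln_qpoch_sums:
  assumes Q: "norm Q < 1" and x: "norm x < 1"
  shows "(\<lambda>k. ln (norm (1 - x * Q ^ k))) sums ln (norm (qpoch x Q))"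
proof -
  have nz: "1 - x * Q ^ k \<noteq> 0" for k
  proof -
    have "qpoch x Q \<noteq> 0" using qpoch_nonzero Q x by blast
    then have "x * Q ^ k \<noteq> 1" using qpoch_eq_0_iff[OF Q, of x] by blast
    then show ?thesis by simp
  qed
  have "(\<lambda>N. norm (\<Prod>k<N. 1 - x * Q ^ k)) \<longlonglongrightarrow> norm (qpoch x Q)" by (intro tendsto_norm qpoch_tendsto Q)
  then have "(\<lambda>N. ln (norm (\<Prod>k<N. 1 - x * Q ^ k))) \<longlonglongrightarrow> ln (norm (qpoch x Q))"
    by (rule tendsto_ln) (use qpoch_nonzero Q x in auto)
  also have "(\<lambda>N. ln (norm (\<Prod>k<N. 1 - x * Q ^ k))) = (\<lambda>N. \<Sum>k<N. ln (norm (1 - x * Q ^ k)))"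
    using nz by (simp add: prod_norm[symmetric] ln_prod)
  finally show ?thesis by (simp add: sums_def)
qed

lemma Ln_one_minus_bound:
  fixes x :: complex
  assumes "norm x \<le> r" "r < 1" shows "norm (Ln (1 - x)) \<le> norm x / (1 - r)"
proof -
  have x1: "norm x < 1" using assms by simp
  have r0: "r \<ge> 0" using assms norm_ge_zero[of x] by linarith
  have s: "(\<lambda>m. - (x ^ Suc m) / of_nat (Suc m)) sums Ln (1 - x)" by (rule Ln_one_minus_sums[OF x1])
  have g: "(\<lambda>m. norm x * r ^ m) sums (norm x * (1 / (1 - r)))" using r0 assms by (intro sums_mult geometric_sums) simp
  have le: "norm (- (x ^ Suc m) / of_nat (Suc m)) \<le> norm x * r ^ m" for m
  proof -
    have "norm (- (x ^ Suc m) / of_nat (Suc m)) = norm x ^ Suc m / of_nat (Suc m)"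
      by (simp add: norm_divide norm_power norm_mult del: of_nat_Suc)
    also have "\<dots> \<le> norm x ^ Suc m / 1" by (intro divide_left_mono) auto
    also have "\<dots> \<le> norm x * r ^ m" using assms by (simp add: mult_left_mono power_mono)
    finally show ?thesis .
  qed
  have "norm (Ln (1 - x)) \<le> norm x * (1 / (1 - r))"
    using norm_suminf_le[of "\<lambda>m. - (x ^ Suc m) / of_nat (Suc m)" "\<lambda>m. norm x * r ^ m"] le sums_summable[OF g] sums_unique[OF s] sums_unique[OF g] by simp
  then show ?thesis by simp
qed

text \<open>One factor 1/(1 - r) comes from the logarithm of each term, the other from the geometric
  sum over k. The bound depends on r alone, which makes the estimates at the cusps uniform.\<close>

lemma ln_qpoch_bound:
  assumes r: "r < 1" and Q: "norm Q \<le> r" and x: "norm x \<le> r"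
  shows "\<bar>ln (norm (qpoch x Q))\<bar> \<le> 1 / (1 - r)\<^sup>2"
proof -
  have r0: "r \<ge> 0" using x norm_ge_zero[of x] by linarith
  have le: "norm (ln (norm (1 - x * Q ^ k))) \<le> (1 / (1 - r)) * r ^ k" for k
  proof -
    have n: "norm (x * Q ^ k) \<le> r * r ^ k" unfolding norm_mult norm_power
      by (intro mult_mono x power_mono Q) (use r0 in auto)
    also have nr: "r * r ^ k \<le> r * 1" using r r0 by (intro mult_left_mono power_le_one) auto
    finally have n1: "norm (x * Q ^ k) \<le> r" by simp
    then have "1 - x * Q ^ k \<noteq> 0" using r by (metis eq_iff_diff_eq_0 norm_one not_le)
    then have "\<bar>ln (norm (1 - x * Q ^ k))\<bar> = \<bar>Re (Ln (1 - x * Q ^ k))\<bar>" by simp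
    also have "\<dots> \<le> norm (Ln (1 - x * Q ^ k))" by (rule abs_Re_le_cmod)
    also have "\<dots> \<le> norm (x * Q ^ k) / (1 - r)" by (rule Ln_one_minus_bound[OF n1 r])
    also have "\<dots> \<le> r ^ k / (1 - r)"
    proof (rule divide_right_mono)
      have "r * r ^ k \<le> 1 * r ^ k" using r r0 by (intro mult_right_mono) auto
      then show "norm (x * Q ^ k) \<le> r ^ k" using n by simp
    qed (use r in simp)
    finally show ?thesis by simp
  qed
  have g: "(\<lambda>k. (1 / (1 - r)) * r ^ k) sums ((1 / (1 - r)) * (1 / (1 - r)))" using r r0 by (intro sums_mult geometric_sums) simp
  have s: "(\<lambda>k. ln (norm (1 - x * Q ^ k))) sums ln (norm (qpoch x Q))" by (rule ln_qpoch_sums) (use Q x r in auto)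
  have "norm (ln (norm (qpoch x Q))) \<le> (1 / (1 - r)) * (1 / (1 - r))"
    using norm_suminf_le[of "\<lambda>k. ln (norm (1 - x * Q ^ k))" "\<lambda>k. (1 / (1 - r)) * r ^ k"] le
      sums_summable[OF g] sums_unique[OF s] sums_unique[OF g] by simp
  then show ?thesis by (simp add: power2_eq_square)
qed

lemma Re_log_eta:
  assumes "Im \<tau> > 0"
  shows "Re (log_eta \<tau>) = - pi * Im \<tau> / 12 + ln (norm (qpoch (nome \<tau>) (nome \<tau>)))"
proof -
  note q = norm_nome_less_1[OF assms]
  have "(\<lambda>n. Re (\<Sum>a=1..1. 1 * Ln (1 - unity_root 1 a * nome \<tau> ^ Suc n))) sums Re (log_product 1 (\<lambda>_ _. 1) (nome \<tau>))"
    by (intro sums_Re log_product_sums(1) bounded_coeff_1 q)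
  also have "(\<lambda>n. Re (\<Sum>a=1..1. 1 * Ln (1 - unity_root 1 a * nome \<tau> ^ Suc n))) = (\<lambda>n. ln (norm (1 - nome \<tau> * nome \<tau> ^ n)))"
    using one_minus_unity_root_nonzero[OF q, of 1 1] unity_root_self[of 1] by simp
  finally have "Re (log_product 1 (\<lambda>_ _. 1) (nome \<tau>)) = ln (norm (qpoch (nome \<tau>) (nome \<tau>)))"
    using sums_unique2 ln_qpoch_sums[OF q q] by blast
  then show ?thesis by (simp add: log_eta_def)
qed

text \<open>\<kappa> is half the weight, and \<eta> has weight 1/2. After taking logarithms in
  \<open>eta_moebius\<close>, the contribution of |j| cancels against ln Im \<tau>' = ln Im \<tau> -
  2 ln |j|.\<close>

lemma eta_invariant:
  assumes g: "g \<in> SL2Z" and \<tau>: "Im \<tau> > 0"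
  shows "log_abs log_eta (1/4) (moebius_act g \<tau>) = log_abs log_eta (1/4) \<tau>"
proof -
  obtain a b c d where ge: "g = (a, b, c, d)" by (cases g)
  have det: "a * d - b * c = 1" using g by (simp add: ge SL2Z_iff)
  define \<tau>' where "\<tau>' = moebius_act g \<tau>"
  define j where "j = automorphy_factor g \<tau>"
  have \<tau>': "Im \<tau>' > 0" unfolding \<tau>'_def by (rule Im_moebius_act_pos[OF g \<tau>])
  have j0: "j \<noteq> 0" unfolding j_def by (rule automorphy_factor_nonzero[OF g \<tau>])
  have p: "exp (- pi * Im \<tau>' / 6) * (norm (qpoch (nome \<tau>') (nome \<tau>')))\<^sup>2 =
       norm j * (exp (- pi * Im \<tau> / 6) * (norm (qpoch (nome \<tau>) (nome \<tau>)))\<^sup>2)"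
    using eta_moebius[OF det \<tau>] by (simp add: \<tau>'_def j_def ge moebius_act_def automorphy_factor_def)
  have nz: "qpoch (nome \<tau>') (nome \<tau>') \<noteq> 0" "qpoch (nome \<tau>) (nome \<tau>) \<noteq> 0"
    using qpoch_nonzero norm_nome_less_1 \<tau> \<tau>' by blast+
  have "ln (exp (- pi * Im \<tau>' / 6) * (norm (qpoch (nome \<tau>') (nome \<tau>')))\<^sup>2) = 2 * Re (log_eta \<tau>')"
    using nz by (simp add: Re_log_eta[OF \<tau>'] ln_mult ln_realpow)
  moreover have "ln (norm j * (exp (- pi * Im \<tau> / 6) * (norm (qpoch (nome \<tau>) (nome \<tau>)))\<^sup>2)) = ln (norm j) + 2 * Re (log_eta \<tau>)"
    using nz j0 by (simp add: Re_log_eta[OF \<tau>] ln_mult ln_realpow)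
  ultimately have e: "2 * Re (log_eta \<tau>') = ln (norm j) + 2 * Re (log_eta \<tau>)" using p by simp
  have "Im \<tau>' = Im \<tau> / (norm j)\<^sup>2" unfolding \<tau>'_def j_def by (rule Im_moebius_act[OF g \<tau>])
  then have "ln (Im \<tau>') = ln (Im \<tau>) - 2 * ln (norm j)" using j0 \<tau> by (simp add: ln_div ln_realpow)
  then show ?thesis using e unfolding \<tau>'_def by linarith
qed

text \<open>Invariance: t g \<tau> = h (t \<tau>) for h = (a, t b, c/t, d), which lies in SL2(Z)
  because t divides c. Growth: the Hermite normal form writes t g \<tau> = h \<sigma> with Im
  \<sigma> = (A/D) Im \<tau>, and the term -pi Im \<sigma> / 12 of Re (\<open>log_eta\<close>) at
  \<sigma> gives the order.\<close>

lemma admissible_eta: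
  assumes t: "t dvd N" and N: "N > 0"
  shows "\<exists>r. admissible N (\<lambda>\<tau>. log_eta (of_nat t * \<tau>)) (1/4) r"
proof -
  have t0: "t > 0" using t N by (auto intro: Nat.gr0I)
  have key: "\<exists>R. \<exists>B C. \<forall>\<tau>. Im \<tau> > 0 \<longrightarrow> Im \<tau> \<ge> B \<longrightarrow>
       \<bar>Re (log_eta (of_nat t * moebius_act g \<tau>)) + (1/4) * ln (Im (moebius_act g \<tau>)) - (1/4) * ln (Im \<tau>) + R * Im \<tau>\<bar> \<le> C"
    if g: "g \<in> SL2Z" for g
  proof -
    obtain h A B D where h: "h \<in> SL2Z" and A: "(A::int) > 0" and D: "(D::int) > 0" and
      eq: "\<And>\<tau>. Im \<tau> > 0 \<Longrightarrow> of_nat t * moebius_act g \<tau> = moebius_act h ((of_int A * \<tau> + of_int B) / of_int D)"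
      using hermite_normal_form[OF t0 g] by blast
    define \<rho> :: real where "\<rho> = of_int A / of_int D"
    have \<rho>: "\<rho> > 0" using A D by (simp add: \<rho>_def)
    define K where "K = 1 / (1 - exp (- 2 * pi))\<^sup>2 + \<bar>(1/4) * (ln \<rho> - ln t)\<bar>"
    show ?thesis
    proof (rule exI[of _ "pi * \<rho> / 12"], rule exI[of _ "1 / \<rho>"], rule exI[of _ K], intro allI impI)
      fix \<tau> assume \<tau>: "Im \<tau> > 0" and B: "1 / \<rho> \<le> Im \<tau>"
      define \<sigma> where "\<sigma> = (of_int A * \<tau> + of_int B) / of_int D"
      have Im\<sigma>: "Im \<sigma> = \<rho> * Im \<tau>" by (simp add: \<sigma>_def \<rho>_def Im_divide_of_real[of _ "of_int D", simplified])
      have \<sigma>0: "Im \<sigma> > 0" using \<rho> \<tau> by (simp add: Im\<sigma>)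
      have \<sigma>1: "Im \<sigma> \<ge> 1" using \<rho> B by (simp add: Im\<sigma> divide_le_eq mult.commute)
      have gp: "Im (moebius_act g \<tau>) > 0" by (rule Im_moebius_act_pos[OF g \<tau>])
      have "Im (of_nat t * moebius_act g \<tau>) = of_nat t * Im (moebius_act g \<tau>)" by simp
      then have l1: "ln (Im (moebius_act h \<sigma>)) = ln t + ln (Im (moebius_act g \<tau>))"
        using eq[OF \<tau>] t0 gp by (simp add: ln_mult flip: \<sigma>_def)
      have l2: "ln (Im \<sigma>) = ln \<rho> + ln (Im \<tau>)" using \<rho> \<tau> by (simp add: Im\<sigma> ln_mult)
      have "log_abs log_eta (1/4) (moebius_act h \<sigma>) = log_abs log_eta (1/4) \<sigma>"
        by (rule eta_invariant[OF h \<sigma>0])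
      then have "Re (log_eta (of_nat t * moebius_act g \<tau>)) + (1/4) * ln (Im (moebius_act g \<tau>)) - (1/4) * ln (Im \<tau>) + pi * \<rho> / 12 * Im \<tau> =
        (1/4) * (ln \<rho> - ln t) + ln (norm (qpoch (nome \<sigma>) (nome \<sigma>)))"
        unfolding l1 l2 Re_log_eta[OF \<sigma>0] eq[OF \<tau>] \<sigma>_def[symmetric] by (simp add: Im\<sigma> algebra_simps diff_divide_distrib add_divide_distrib)
      moreover have "\<bar>ln (norm (qpoch (nome \<sigma>) (nome \<sigma>)))\<bar> \<le> 1 / (1 - exp (- 2 * pi))\<^sup>2"
        by (rule ln_qpoch_bound) (use \<sigma>1 in \<open>auto simp: norm_nome\<close>)
      ultimately show "\<bar>Re (log_eta (of_nat t * moebius_act g \<tau>)) + (1/4) * ln (Im (moebius_act g \<tau>)) - (1/4) * ln (Im \<tau>) + pi * \<rho> / 12 * Im \<tau>\<bar> \<le> K"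
        unfolding K_def by linarith
    qed
  qed
  have "(\<lambda>\<tau>. log_eta (of_nat t * \<tau>)) holomorphic_on {\<tau>. Im \<tau> > 0}"
    unfolding log_eta_def by (intro holomorphic_intros log_product_nome_holomorphic bounded_coeff_1 t0) simp
  moreover have "Re (log_eta (of_nat t * moebius_act g \<tau>)) + (1/4) * ln (Im (moebius_act g \<tau>)) =
      Re (log_eta (of_nat t * \<tau>)) + (1/4) * ln (Im \<tau>)" if gN: "g \<in> Gamma0 N" and \<tau>: "Im \<tau> > 0" for g \<tau>
  proof -
    obtain a b c d where ge: "g = (a, b, c, d)" by (cases g)
    have g: "g \<in> SL2Z" using gN by (rule Gamma0_imp_SL2Z)
    have "int t dvd c" using gN t by (auto simp: ge Gamma0_iff intro: dvd_trans[of _ "int N"])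
    then obtain c' where c: "c = int t * c'" by auto
    define h where "h = (a, int t * b, c', d)"
    have h: "h \<in> SL2Z" using g by (simp add: ge h_def SL2Z_iff c mult_ac)
    have m: "of_nat t * moebius_act g \<tau> = moebius_act h (of_nat t * \<tau>)"
      by (simp add: moebius_act_def ge h_def c algebra_simps)
    have gp: "Im (moebius_act g \<tau>) > 0" by (rule Im_moebius_act_pos[OF g \<tau>])
    have t\<tau>: "Im (of_nat t * \<tau>) > 0" using t0 \<tau> by simp
    have "Re (log_eta (of_nat t * moebius_act g \<tau>)) + (1/4) * ln (Im (of_nat t * moebius_act g \<tau>)) = Re (log_eta (of_nat t * \<tau>)) + (1/4) * ln (Im (of_nat t * \<tau>))"
      unfolding m by (rule eta_invariant[OF h t\<tau>])
    then show ?thesis using t0 gp \<tau> by (simp add: ln_mult add_divide_distrib)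
  qed
  moreover obtain r where "\<forall>g\<in>SL2Z. \<exists>B C. \<forall>\<tau>. Im \<tau> > 0 \<longrightarrow> Im \<tau> \<ge> B \<longrightarrow>
       \<bar>Re (log_eta (of_nat t * moebius_act g \<tau>)) + (1/4) * ln (Im (moebius_act g \<tau>)) - (1/4) * ln (Im \<tau>) + r g * Im \<tau>\<bar> \<le> C"
    using key by metis
  ultimately show ?thesis unfolding admissible_def by blast
qed

text \<open>The slope is hidden by the quantifier, so that sums and multiples can be formed without
  keeping track of it.\<close>

definition grows_linearly :: "(complex \<Rightarrow> real) \<Rightarrow> bool" where
  "grows_linearly F \<longleftrightarrow> (\<exists>R B C. \<forall>\<tau>. Im \<tau> > 0 \<longrightarrow> Im \<tau> \<ge> B \<longrightarrow> \<bar>F \<tau> + R * Im \<tau>\<bar> \<le> C)"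

lemma grows_linearly_zero: "grows_linearly (\<lambda>_. 0)"
  unfolding grows_linearly_def by (rule exI[of _ 0], rule exI[of _ 0], rule exI[of _ 0]) simp

lemma grows_linearly_add:
  assumes "grows_linearly F" "grows_linearly G" shows "grows_linearly (\<lambda>\<tau>. F \<tau> + G \<tau>)"
proof -
  obtain R B C where 1: "\<And>\<tau>. Im \<tau> > 0 \<Longrightarrow> Im \<tau> \<ge> B \<Longrightarrow> \<bar>F \<tau> + R * Im \<tau>\<bar> \<le> C"
    using assms(1) unfolding grows_linearly_def by blast
  obtain R' B' C' where 2: "\<And>\<tau>. Im \<tau> > 0 \<Longrightarrow> Im \<tau> \<ge> B' \<Longrightarrow> \<bar>G \<tau> + R' * Im \<tau>\<bar> \<le> C'"
    using assms(2) unfolding grows_linearly_def by blast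
  have "\<bar>F \<tau> + G \<tau> + (R + R') * Im \<tau>\<bar> \<le> C + C'" if "Im \<tau> > 0" "Im \<tau> \<ge> max B B'" for \<tau>
    using 1[of \<tau>] 2[of \<tau>] that by (simp add: algebra_simps abs_le_iff)
  then show ?thesis unfolding grows_linearly_def by blast
qed

lemma grows_linearly_cmult:
  assumes "grows_linearly F" shows "grows_linearly (\<lambda>\<tau>. x * F \<tau>)"
proof -
  obtain R B C where 1: "\<And>\<tau>. Im \<tau> > 0 \<Longrightarrow> Im \<tau> \<ge> B \<Longrightarrow> \<bar>F \<tau> + R * Im \<tau>\<bar> \<le> C"
    using assms(1) unfolding grows_linearly_def by blast
  have "\<bar>x * F \<tau> + (x * R) * Im \<tau>\<bar> \<le> \<bar>x\<bar> * C" if "Im \<tau> > 0" "Im \<tau> \<ge> B" for \<tau>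
  proof -
    have "x * F \<tau> + (x * R) * Im \<tau> = x * (F \<tau> + R * Im \<tau>)" by (simp add: algebra_simps)
    then show ?thesis using 1[OF that] by (simp add: abs_mult mult_left_mono)
  qed
  then show ?thesis unfolding grows_linearly_def by blast
qed

lemma grows_linearly_sum:
  assumes "\<And>i. i \<in> I \<Longrightarrow> grows_linearly (F i)" shows "grows_linearly (\<lambda>\<tau>. \<Sum>i\<in>I. F i \<tau>)"
  using assms by (induction I rule: infinite_finite_induct) (auto intro: grows_linearly_zero grows_linearly_add)

text \<open>The first index belongs to 1 and the second to \<tau>, in accordance with the weights
  w(a b), where a is the exponent of the root of unity and b that of q.\<close>

definition siegel_torsion :: "nat \<Rightarrow> int \<Rightarrow> int \<Rightarrow> complex \<Rightarrow> real" where
  "siegel_torsion u a b \<tau> = siegel_abs \<tau> ((of_int b * \<tau> + of_int a) / of_nat u)"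

lemma siegel_torsion_cong:
  assumes "u > 0" "Im \<tau> > 0" "[a = a'] (mod int u)" "[b = b'] (mod int u)"
  shows "siegel_torsion u a b \<tau> = siegel_torsion u a' b' \<tau>"
proof -
  obtain k where k: "a - a' = int u * k" using assms(3) by (auto simp: cong_iff_dvd_diff)
  obtain l where l: "b - b' = int u * l" using assms(4) by (auto simp: cong_iff_dvd_diff)
  have a: "a = a' + int u * k" and b: "b = b' + int u * l" using k l by auto
  have "(of_int b * \<tau> + of_int a) / of_nat u = (of_int b' * \<tau> + of_int a') / of_nat u + of_int k + of_int l * \<tau>"
    using assms(1) unfolding a b by (simp add: field_simps)
  then show ?thesis unfolding siegel_torsion_def by (simp only: siegel_abs_lattice[OF assms(2)])
qed

text \<open>The matrix acts from the right on the row vector (b, a): multiplying (b \<tau>' + a)/u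
  by j gives b (\<alpha> \<tau> + \<beta>) + a (c \<tau> + \<delta>), divided by u.\<close>

lemma siegel_torsion_moebius:
  assumes "(\<alpha>, \<beta>, c, \<delta>) \<in> SL2Z" "Im \<tau> > 0"
  shows "siegel_torsion u a b (moebius_act (\<alpha>, \<beta>, c, \<delta>) \<tau>) = siegel_torsion u (b * \<beta> + a * \<delta>) (b * \<alpha> + a * c) \<tau>"
proof -
  define j where "j = of_int c * \<tau> + of_int \<delta>"
  define \<tau>' where "\<tau>' = (of_int \<alpha> * \<tau> + of_int \<beta>) / j"
  have det: "\<alpha> * \<delta> - \<beta> * c = 1" using assms(1) by (simp add: SL2Z_iff)
  have j0: "j \<noteq> 0" unfolding j_def by (rule denominator_nonzero[OF det assms(2)])
  have tj: "\<tau>' * j = of_int \<alpha> * \<tau> + of_int \<beta>" using j0 by (simp add: \<tau>'_def)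
  define z where "z = j * ((of_int b * \<tau>' + of_int a) / of_nat u)"
  have "siegel_abs \<tau>' (z / j) = siegel_abs \<tau> z"
    using siegel_abs_moebius[OF det assms(2), of z] by (simp add: \<tau>'_def j_def)
  moreover have "z / j = (of_int b * \<tau>' + of_int a) / of_nat u" using j0 by (simp add: z_def)
  moreover have "z = (of_int (b * \<alpha> + a * c) * \<tau> + of_int (b * \<beta> + a * \<delta>)) / of_nat u"
  proof -
    have "z = (of_int b * (\<tau>' * j) + of_int a * j) / of_nat u" by (simp add: z_def algebra_simps)
    then show ?thesis unfolding tj by (simp add: j_def algebra_simps)
  qed
  ultimately show ?thesis by (simp add: siegel_torsion_def moebius_act_def \<tau>'_def j_def)
qed

text \<open>With x the fractional part of b/u, the slope is pi times the Bernoulli polynomial x^2 -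
  x + 1/6. If u divides b, the factor 1 - \<zeta> does not tend to 1 but is a constant, nonzero
  since u does not divide a. All other factors are controlled by
  \<open>ln_qpoch_bound\<close>.\<close>

lemma ln_siegel_torsion_grows:
  assumes u: "u > 0" and ab: "\<not> (int u dvd a \<and> int u dvd b)"
  shows "grows_linearly (\<lambda>\<tau>. ln (siegel_torsion u a b \<tau>))"
proof -
  define b0 where "b0 = b mod int u"
  define x :: real where "x = of_int b0 / of_nat u"
  have b0: "0 \<le> b0" "b0 < int u" using u by (auto simp: b0_def)
  then have "of_int b0 < real u" by linarith
  then have x: "0 \<le> x" "x < 1" using u b0 by (auto simp: x_def)
  define \<zeta> where "\<zeta> = nome (of_int a / of_nat u)"
  have n\<zeta>: "norm \<zeta> = 1" by (simp add: \<zeta>_def norm_nome Im_divide)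
  have \<zeta>1: "\<zeta> \<noteq> 1" if "b0 = 0"
  proof
    assume "\<zeta> = 1"
    then obtain n :: int where "(of_int a :: complex) / of_nat u = of_int n" by (auto simp: \<zeta>_def nome_eq_1_iff)
    then have "(of_int a :: complex) = of_int (n * int u)" using u by (simp add: field_simps)
    then have "a = n * int u" by (simp only: of_int_eq_iff)
    then show False using ab that by (simp add: b0_def dvd_eq_mod_eq_0)
  qed
  \<comment> \<open>The smallest positive number among 1, x and 1 - x. For Im \<tau> \<ge> 1 all
    arguments of the products, apart from \<zeta> in the case x = 0, have absolute value at most
    exp(-2 pi s).\<close>
  define s where "s = (if b0 = 0 then 1 else min x (1 - x))"
  have s: "0 < s" "s \<le> 1" "s \<le> 1 - x" using x b0 u by (auto simp: s_def x_def)
  define r where "r = exp (- 2 * pi * s)"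
  have r: "r < 1" using s by (simp add: r_def)
  define c0 where "c0 = (if b0 = 0 then ln (norm (1 - \<zeta>)) else 0)"
  define K where "K = \<bar>c0\<bar> + 1 / (1 - r)\<^sup>2 + 1 / (1 - r)\<^sup>2"
  have "\<bar>ln (siegel_torsion u a b \<tau>) + (pi * (x\<^sup>2 - x + 1/6)) * Im \<tau>\<bar> \<le> K" if \<tau>: "Im \<tau> > 0" and \<tau>1: "Im \<tau> \<ge> 1" for \<tau>
  proof -
    define z where "z = of_real x * \<tau> + of_int a / of_nat u"
    have "siegel_torsion u a b \<tau> = siegel_torsion u a b0 \<tau>" by (rule siegel_torsion_cong[OF u \<tau>]) (auto simp: b0_def cong_def)
    also have "\<dots> = siegel_abs \<tau> z" by (simp add: siegel_torsion_def z_def x_def add_divide_distrib)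
    finally have 1: "siegel_torsion u a b \<tau> = siegel_abs \<tau> z" .
    have Imz: "Im z = x * Im \<tau>" by (simp add: z_def Im_divide)
    let ?q = "nome \<tau>"
    note q = norm_nome_less_1[OF \<tau>]
    have mono: "exp (- 2 * pi * (p * Im \<tau>)) \<le> r" if "p \<ge> s" for p
    proof -
      have "s * 1 \<le> p * Im \<tau>" using that s \<tau>1 by (intro mult_mono) auto
      then show ?thesis by (simp add: r_def)
    qed
    have nq: "norm ?q \<le> r" using mono[of 1] s by (simp add: norm_nome)
    have n2: "norm (?q * nome (-z)) \<le> r"
    proof -
      have "norm (?q * nome (-z)) = norm (nome (\<tau> + -z))" by (simp only: nome_add)
      also have "\<dots> = exp (- 2 * pi * ((1 - x) * Im \<tau>))" by (simp only: norm_nome) (simp add: Imz algebra_simps)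
      also have "\<dots> \<le> r" by (rule mono) (use s in simp)
      finally show ?thesis .
    qed
    have e2: "\<bar>ln (norm (qpoch (?q * nome (-z)) ?q))\<bar> \<le> 1 / (1 - r)\<^sup>2" by (rule ln_qpoch_bound[OF r nq n2])
    have nz2: "qpoch (?q * nome (-z)) ?q \<noteq> 0" using qpoch_nonzero[OF q] n2 r by simp
    have e1: "qpoch (nome z) ?q \<noteq> 0 \<and> \<bar>ln (norm (qpoch (nome z) ?q)) - c0\<bar> \<le> 1 / (1 - r)\<^sup>2"
    proof (cases "b0 = 0")
      case True
      then have z: "nome z = \<zeta>" by (simp add: z_def x_def \<zeta>_def)
      have n1: "norm (\<zeta> * ?q) \<le> r" using nq by (simp add: norm_mult n\<zeta>)
      have nz: "qpoch (\<zeta> * ?q) ?q \<noteq> 0" using qpoch_nonzero[OF q] n1 r by simp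
      have rec: "qpoch \<zeta> ?q = (1 - \<zeta>) * qpoch (\<zeta> * ?q) ?q" by (rule qpoch_rec[OF q])
      have "ln (norm (qpoch \<zeta> ?q)) - c0 = ln (norm (qpoch (\<zeta> * ?q) ?q))"
        using \<zeta>1 True nz unfolding rec by (simp add: norm_mult ln_mult c0_def)
      then show ?thesis using ln_qpoch_bound[OF r nq n1] nz \<zeta>1 True rec by (simp add: z)
    next
      case False
      have "norm (nome z) \<le> r" using mono[of x] False by (simp add: norm_nome Imz s_def)
      then show ?thesis using ln_qpoch_bound[OF r nq] qpoch_nonzero[OF q] r False by (simp add: c0_def)
    qed
    have "ln (siegel_abs \<tau> z) = (- pi * (Im z)\<^sup>2 / Im \<tau> + pi * Im z - pi * Im \<tau> / 6) + (ln (norm (qpoch (nome z) ?q)) + ln (norm (qpoch (?q * nome (-z)) ?q)))"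
      unfolding siegel_abs_def using e1 nz2 by (simp add: ln_mult)
    also have "- pi * (Im z)\<^sup>2 / Im \<tau> + pi * Im z - pi * Im \<tau> / 6 = - (pi * (x\<^sup>2 - x + 1/6)) * Im \<tau>"
      unfolding Imz using \<tau> by (simp add: power2_eq_square field_simps)
    finally have "ln (siegel_torsion u a b \<tau>) + (pi * (x\<^sup>2 - x + 1/6)) * Im \<tau> = ln (norm (qpoch (nome z) ?q)) + ln (norm (qpoch (?q * nome (-z)) ?q))"
      unfolding 1 by simp
    then show ?thesis using e1 e2 unfolding K_def by linarith
  qed
  then show ?thesis unfolding grows_linearly_def by blast
qed

text \<open>
  The exponents \<open>w (a n)\<close> of the factors \<open>1 - \<zeta>\<^sup>a q\<^sup>n\<close>, \<open>\<zeta> = e\<^bsup>2 pi i/u\<^esup>\<close>, of a real multiplicative combination of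
  the functions \<open>\<eta>\<^sub>\<chi>\<close>, \<open>\<chi>\<close> non-principal modulo \<open>u\<close>.
\<close>
definition weight :: "nat \<Rightarrow> (int \<Rightarrow> real) \<Rightarrow> bool" where
  "weight u w \<longleftrightarrow> (\<forall>n. w (n + int u) = w n) \<and> (\<forall>n. \<not> coprime n (int u) \<longrightarrow> w n = 0) \<and> (\<Sum>a=0..<int u. w a) = 0"

lemma periodic_cong:
  fixes w :: "int \<Rightarrow> 'a"
  assumes "\<And>n. w (n + int u) = w n" "[m = n] (mod int u)" shows "w m = w n"
proof -
  have p: "w (n + int u * k) = w n" for n k
  proof (induction k rule: int_induct[where k = 0])
    case (step1 i) then show ?case using assms(1)[of "n + int u * i"] by (simp add: algebra_simps)
  next
    case (step2 i) then show ?case using assms(1)[of "n + int u * (i - 1)"] by (simp add: algebra_simps)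
  qed simp
  obtain k where "m - n = int u * k" using assms(2) by (auto simp: cong_iff_dvd_diff)
  then have "m = n + int u * k" by simp
  then show ?thesis using p by simp
qed

lemma weight_cong: "weight u w \<Longrightarrow> [m = n] (mod int u) \<Longrightarrow> w m = w n"
  using periodic_cong[of w u m n] by (simp add: weight_def)

lemma periodic_bounded_coeff:
  fixes w :: "int \<Rightarrow> complex"
  assumes "u > 0" "\<And>n. w (n + int u) = w n" shows "bounded_coeff (\<lambda>n a. w (int (a * n)))"
proof -
  have "norm (w m) \<le> (\<Sum>a=0..<int u. norm (w a))" for m
  proof -
    have "w m = w (m mod int u)" by (rule periodic_cong[where w = w and u = u]) (use assms in \<open>auto simp: cong_def\<close>)
    also have "norm \<dots> \<le> (\<Sum>a=0..<int u. norm (w a))" using assms(1) by (intro member_le_sum) auto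
    finally show ?thesis .
  qed
  then show ?thesis unfolding bounded_coeff_def by blast
qed

lemma weight_bounded_coeff:
  assumes "u > 0" "weight u w" shows "bounded_coeff (\<lambda>n a. of_real (w (int (a * n))))"
  using periodic_bounded_coeff[of u "\<lambda>n. of_real (w n)"] assms by (simp add: weight_def)

lemma sum_mult_mod:
  assumes "u > 0" "coprime d (int u)"
  shows "(\<Sum>a=0..<int u. f ((a * d) mod int u)) = (\<Sum>a=0..<int u. f a)"
proof -
  have inj: "inj_on (\<lambda>a. (a * d) mod int u) {0..<int u}"
  proof (rule inj_onI)
    fix a b assume *: "a \<in> {0..<int u}" "b \<in> {0..<int u}" "(a * d) mod int u = (b * d) mod int u"
    then have "[a * d = b * d] (mod int u)" by (simp add: cong_def)
    then have "[a = b] (mod int u)" using assms(2) by (simp add: cong_mult_rcancel)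
    then show "a = b" using * by (simp add: cong_def)
  qed
  have "(\<lambda>a. (a * d) mod int u) ` {0..<int u} = {0..<int u}"
    by (rule endo_inj_surj[OF _ _ inj]) (use assms(1) in auto)
  then show ?thesis using sum.reindex[OF inj, of f] by simp
qed

text \<open>Multiplication by a unit b permutes the residues; for any other b every term is
  0.\<close>

lemma weight_row_sum:
  assumes "u > 0" "weight u w" shows "(\<Sum>a=0..<int u. w (a * b)) = 0"
proof (cases "coprime b (int u)")
  case True
  have "(\<Sum>a=0..<int u. w (a * b)) = (\<Sum>a=0..<int u. w ((a * b) mod int u))"
    by (intro sum.cong refl weight_cong[OF assms(2)]) (simp add: cong_def)
  then show ?thesis using sum_mult_mod[OF assms(1) True, of w] assms(2) by (simp add: weight_def)
next
  case False
  then have "w (a * b) = 0" for a using assms(2) by (simp add: weight_def)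
  then show ?thesis by simp
qed

text \<open>Since the rows of \<open>w (a b)\<close> sum to \<open>0\<close>, the leading powers of \<open>q\<close> of the Siegel functions cancel.\<close>
lemma Re_log_product_klein:
  assumes u: "u \<ge> 2" and w: "weight u w" and \<tau>: "Im \<tau> > 0"
  shows "Re (weighted_product u w (nome \<tau>)) =
    (1/2) * (\<Sum>a<u. \<Sum>b<u. w (int (a * b)) * ln (siegel_torsion u (int a) (int b) (of_nat u * \<tau>)))"
proof -
  let ?c = "\<lambda>n a. complex_of_real (w (int (a * n)))"
  define q Q where "q = nome \<tau>" and "Q = nome (of_nat u * \<tau>)"
  have u0: "u > 0" using u by simp
  have q: "norm q < 1" unfolding q_def by (rule norm_nome_less_1[OF \<tau>])
  have u\<tau>: "Im (of_nat u * \<tau>) > 0" using u0 \<tau> by simp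
  have Q: "norm Q < 1" unfolding Q_def by (rule norm_nome_less_1[OF u\<tau>])
  have Qq: "Q = q ^ u" by (simp add: Q_def q_def nome_of_nat_mult)
  have w0: "w n = 0" if "int u dvd n" for n
  proof -
    have "\<not> coprime n (int u)"
    proof
      assume "coprime n (int u)"
      then have "is_unit (int u)" using that by (metis coprime_common_divisor dvd_refl)
      then show False using u by simp
    qed
    then show ?thesis using w by (simp add: weight_def)
  qed
  have z0: "\<not> Suc 0 \<le> i \<longleftrightarrow> i = 0" for i :: nat by auto
  define T where "T = (\<lambda>a b. ln (norm (qpoch (unity_root u a * q ^ b) Q)))"
  define g where "g = (\<lambda>n. Re (\<Sum>a=1..u. ?c (Suc n) a * Ln (1 - unity_root u a * q ^ Suc n)))"
  have g: "g n = (\<Sum>a=1..u. w (int (a * Suc n)) * ln (norm (1 - unity_root u a * q ^ Suc n)))" for n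
    using one_minus_unity_root_nonzero[OF q, where u = u and n = n] by (simp add: g_def del: power_Suc)
  have "g sums Re (log_product u ?c q)" unfolding g_def
    by (intro sums_Re log_product_sums(1) weight_bounded_coeff[OF u0 w] q)
  \<comment> \<open>Blocks of u consecutive n: the weights of n = b + u k do not depend on k, so
    summing over k produces a \<open>qpoch\<close> with base Q = q^u for each pair (a, b).\<close>
  then have grp: "(\<lambda>k. sum g {k * u..<k * u + u}) sums Re (log_product u ?c q)" using u0 by (rule sums_group)
  have blk: "sum g {k * u..<k * u + u} = (\<Sum>b=1..u. \<Sum>a=1..u. w (int (a * b)) * ln (norm (1 - unity_root u a * q ^ b * Q ^ k)))" for k
  proof -
    have "sum g {k * u..<k * u + u} = (\<Sum>b=1..u. g (k * u + (b - 1)))"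
      by (rule sum.reindex_bij_witness[of _ "\<lambda>b. k * u + (b - 1)" "\<lambda>n. n - k * u + 1"]) auto
    also have "\<dots> = (\<Sum>b=1..u. \<Sum>a=1..u. w (int (a * b)) * ln (norm (1 - unity_root u a * q ^ b * Q ^ k)))"
    proof (rule sum.cong)
      fix b assume b: "b \<in> {1..u}"
      then have e: "Suc (k * u + (b - 1)) = b + u * k" by (simp add: mult.commute)
      have "w (int (a * (b + u * k))) = w (int (a * b))" for a
        by (rule weight_cong[OF w]) (simp add: cong_iff_dvd_diff algebra_simps)
      then show "g (k * u + (b - 1)) = (\<Sum>a=1..u. w (int (a * b)) * ln (norm (1 - unity_root u a * q ^ b * Q ^ k)))"
        unfolding g e by (simp only: power_add power_mult Qq mult.assoc)
    qed simp
    finally show ?thesis .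
  qed
  have nx: "norm (unity_root u a * q ^ b) < 1" if "b \<ge> 1" for a b
    using norm_unity_root_power_less_1[OF q, where u = u and a = a and n = "b - 1"] that by (simp only: Suc_diff_1[OF less_le_trans[OF zero_less_one]])
  have "(\<lambda>k. \<Sum>b=1..u. \<Sum>a=1..u. w (int (a * b)) * ln (norm (1 - unity_root u a * q ^ b * Q ^ k))) sums (\<Sum>b=1..u. \<Sum>a=1..u. w (int (a * b)) * T a b)"
    unfolding T_def by (intro sums_sum sums_mult ln_qpoch_sums Q nx) auto
  then have "Re (log_product u ?c q) = (\<Sum>b=1..u. \<Sum>a=1..u. w (int (a * b)) * T a b)"
    using grp unfolding blk by (rule sums_unique2[symmetric])
  also have "\<dots> = (\<Sum>b\<in>{1..<u}. \<Sum>a\<in>{1..<u}. w (int (a * b)) * T a b)"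
  proof -
    have "(\<Sum>a=1..u. w (int (a * b)) * T a b) = (\<Sum>a\<in>{1..<u}. w (int (a * b)) * T a b)" for b
      by (rule sum.mono_neutral_right) (auto simp: w0)
    moreover have "(\<Sum>b=1..u. \<Sum>a\<in>{1..<u}. w (int (a * b)) * T a b) = (\<Sum>b\<in>{1..<u}. \<Sum>a\<in>{1..<u}. w (int (a * b)) * T a b)"
      by (rule sum.mono_neutral_right) (auto simp: w0)
    ultimately show ?thesis by simp
  qed
  also have "\<dots> = (\<Sum>a\<in>{1..<u}. \<Sum>b\<in>{1..<u}. w (int (a * b)) * T a b)" by (rule sum.swap)
  finally have ReL: "Re (log_product u ?c q) = (\<Sum>a\<in>{1..<u}. \<Sum>b\<in>{1..<u}. w (int (a * b)) * T a b)" .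
  define E where "E = (\<lambda>b::nat. - pi * (of_nat b * Im \<tau>)\<^sup>2 / (of_nat u * Im \<tau>) + pi * (of_nat b * Im \<tau>) - pi * (of_nat u * Im \<tau>) / 6)"
  \<comment> \<open>The point z = b \<tau> + a/u has the nome \<zeta>^a q^b, and Q divided by it is
    \<zeta>^(u-a) q^(u-b). One Siegel function thus covers the two residue pairs (a, b) and (u - a,
    u - b).\<close>
  have sgE: "ln (siegel_torsion u (int a) (int b) (of_nat u * \<tau>)) = E b + (T a b + T (u - a) (u - b))"
    if a: "a \<in> {1..<u}" and b: "b \<in> {1..<u}" for a b
  proof -
    define z where "z = of_nat b * \<tau> + of_nat a / of_nat u"
    have z: "(of_int (int b) * (of_nat u * \<tau>) + of_int (int a)) / of_nat u = z"
      using u0 by (simp add: z_def field_simps)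
    have Imz: "Im z = of_nat b * Im \<tau>" by (simp add: z_def Im_divide)
    have ez: "nome z = unity_root u a * q ^ b"
      unfolding z_def nome_add nome_of_nat_mult unity_root_nome q_def by (rule mult.commute)
    have "of_nat u * \<tau> + - z + 1 = of_nat (u - b) * \<tau> + of_nat (u - a) / of_nat u"
      using a b u0 by (simp add: z_def of_nat_diff field_simps)
    then have "nome (of_nat u * \<tau> + - z + 1) = nome (of_nat (u - b) * \<tau> + of_nat (u - a) / of_nat u)" by simp
    then have e: "nome \<tau> ^ u * nome (- z) = nome \<tau> ^ (u - b) * nome (of_nat (u - a) / of_nat u)"
      by (simp only: nome_add nome_of_nat_mult nome_one mult_1_right)
    have ez': "nome (of_nat u * \<tau>) * nome (- z) = unity_root u (u - a) * q ^ (u - b)"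
      unfolding nome_of_nat_mult unity_root_nome q_def e by (rule mult.commute)
    have nz: "qpoch (unity_root u a * q ^ b) Q \<noteq> 0" "qpoch (unity_root u (u - a) * q ^ (u - b)) Q \<noteq> 0"
      by (rule qpoch_nonzero[OF Q nx], use b in force)+
    have "siegel_torsion u (int a) (int b) (of_nat u * \<tau>) = exp (E b) * (norm (qpoch (unity_root u a * q ^ b) Q) * norm (qpoch (unity_root u (u - a) * q ^ (u - b)) Q))"
      unfolding siegel_torsion_def z siegel_abs_def ez' Imz by (simp add: ez E_def Q_def)
    then show ?thesis unfolding T_def using nz by (simp add: ln_mult)
  qed
  have row: "(\<Sum>a\<in>{1..<u}. w (int (a * b))) = 0" for b
  proof -
    have "(\<Sum>a\<in>{1..<u}. w (int (a * b))) = (\<Sum>a\<in>{0..<u}. w (int (a * b)))"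
      by (rule sum.mono_neutral_left) (auto simp: w0 z0)
    also have "\<dots> = (\<Sum>a=0..<int u. w (a * int b))"
      using sum.atLeast_int_lessThan_int_shift[of "\<lambda>a. w (a * int b)" 0 u] by simp
    finally show ?thesis using weight_row_sum[OF u0 w] by simp
  qed
  have "(\<Sum>a<u. \<Sum>b<u. w (int (a * b)) * ln (siegel_torsion u (int a) (int b) (of_nat u * \<tau>))) =
    (\<Sum>a\<in>{1..<u}. \<Sum>b\<in>{1..<u}. w (int (a * b)) * ln (siegel_torsion u (int a) (int b) (of_nat u * \<tau>)))"
  proof -
    have "(\<Sum>b<u. w (int (a * b)) * ln (siegel_torsion u (int a) (int b) (of_nat u * \<tau>))) = (\<Sum>b\<in>{1..<u}. w (int (a * b)) * ln (siegel_torsion u (int a) (int b) (of_nat u * \<tau>)))" for a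
      by (rule sum.mono_neutral_right) (auto simp: w0 z0)
    moreover have "(\<Sum>a<u. \<Sum>b\<in>{1..<u}. w (int (a * b)) * ln (siegel_torsion u (int a) (int b) (of_nat u * \<tau>))) = (\<Sum>a\<in>{1..<u}. \<Sum>b\<in>{1..<u}. w (int (a * b)) * ln (siegel_torsion u (int a) (int b) (of_nat u * \<tau>)))"
      by (rule sum.mono_neutral_right) (auto simp: w0 z0)
    ultimately show ?thesis by simp
  qed
  also have "\<dots> = (\<Sum>a\<in>{1..<u}. \<Sum>b\<in>{1..<u}. w (int (a * b)) * (E b + (T a b + T (u - a) (u - b))))"
    by (intro sum.cong refl) (simp add: sgE)
  also have "\<dots> = (\<Sum>a\<in>{1..<u}. \<Sum>b\<in>{1..<u}. w (int (a * b)) * E b) + (\<Sum>a\<in>{1..<u}. \<Sum>b\<in>{1..<u}. w (int (a * b)) * T a b)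
     + (\<Sum>a\<in>{1..<u}. \<Sum>b\<in>{1..<u}. w (int (a * b)) * T (u - a) (u - b))"
    by (simp add: distrib_left sum.distrib)
  also have "(\<Sum>a\<in>{1..<u}. \<Sum>b\<in>{1..<u}. w (int (a * b)) * E b) = 0"
    by (subst sum.swap) (simp only: sum_distrib_right[symmetric] row mult_zero_left sum.neutral_const)
  \<comment> \<open>(u - a)(u - b) = a b modulo u, so the reflected products repeat the original
    ones; hence the factor 1/2 in the formula.\<close>
  also have "(\<Sum>a\<in>{1..<u}. \<Sum>b\<in>{1..<u}. w (int (a * b)) * T (u - a) (u - b)) = (\<Sum>a\<in>{1..<u}. \<Sum>b\<in>{1..<u}. w (int (a * b)) * T a b)"
  proof -
    have ww: "w (int ((u - a) * (u - b))) = w (int (a * b))" if "a \<le> u" "b \<le> u" for a b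
    proof (rule weight_cong[OF w])
      have "int ((u - a) * (u - b)) - int (a * b) = int u * (int u - int a - int b)"
        using that by (simp only: of_nat_mult of_nat_diff) (simp add: algebra_simps)
      then show "[int ((u - a) * (u - b)) = int (a * b)] (mod int u)"
        by (simp only: cong_iff_dvd_diff dvd_triv_left)
    qed
    have "(\<Sum>a\<in>{1..<u}. \<Sum>b\<in>{1..<u}. w (int (a * b)) * T (u - a) (u - b)) =
      (\<Sum>a\<in>{1..<u}. \<Sum>b\<in>{1..<u}. w (int ((u - a) * (u - b))) * T (u - a) (u - b))"
      by (intro sum.cong refl) (simp add: ww del: of_nat_mult)
    also have "\<dots> = (\<Sum>a\<in>{1..<u}. \<Sum>b\<in>{1..<u}. w (int (a * (u - b))) * T a (u - b))"
      by (rule sum.reindex_bij_witness[of _ "\<lambda>a. u - a" "\<lambda>a. u - a"]) auto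
    also have "\<dots> = (\<Sum>a\<in>{1..<u}. \<Sum>b\<in>{1..<u}. w (int (a * b)) * T a b)"
      by (intro sum.cong refl sum.reindex_bij_witness[of _ "\<lambda>a. u - a" "\<lambda>a. u - a"]) auto
    finally show ?thesis .
  qed
  finally show ?thesis unfolding q_def[symmetric] ReL by simp
qed

text \<open>Conjugation by u t turns a matrix whose lower left entry is divisible by u^2 t into one
  congruent to diag(\<alpha>, \<delta>) modulo u. This sends the torsion index (a, b) to (a
  \<delta>, b \<alpha>) and keeps w(a b), as \<alpha> \<delta> = 1 modulo u. At a general cusp a
  nonzero weight forces a to be a unit, so the transformed torsion point is never a lattice point
  and its logarithm grows linearly.\<close>

lemma admissible_klein:
  assumes u: "u \<ge> 2" and w: "weight u w" and t: "u\<^sup>2 * t dvd N" and N: "N > 0"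
  shows "\<exists>r. admissible N (\<lambda>\<tau>. weighted_product u w (nome (of_nat t * \<tau>))) 0 r"
proof -
  let ?L = "\<lambda>\<tau>. weighted_product u w (nome (of_nat t * \<tau>))"
  have u0: "u > 0" using u by simp
  have t0: "t > 0" using t N by (auto intro: Nat.gr0I)
  have ReL: "Re (?L \<tau>) = (1/2) * (\<Sum>a<u. \<Sum>b<u. w (int (a * b)) * ln (siegel_torsion u (int a) (int b) (of_nat (u * t) * \<tau>)))" if "Im \<tau> > 0" for \<tau>
  proof -
    have "Im (of_nat t * \<tau>) > 0" using t0 that by simp
    from Re_log_product_klein[OF u w this] show ?thesis by (simp add: mult.assoc)
  qed
  have hol: "?L holomorphic_on {\<tau>. Im \<tau> > 0}" by (intro log_product_nome_holomorphic weight_bounded_coeff[OF u0 w] t0)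
  have inv: "Re (?L (moebius_act g \<tau>)) = Re (?L \<tau>)" if gN: "g \<in> Gamma0 N" and \<tau>: "Im \<tau> > 0" for g \<tau>
  proof -
    obtain \<alpha> \<beta> c \<delta> where ge: "g = (\<alpha>, \<beta>, c, \<delta>)" by (cases g)
    have g: "g \<in> SL2Z" using gN by (rule Gamma0_imp_SL2Z)
    have det: "\<alpha> * \<delta> - \<beta> * c = 1" using g by (simp add: ge SL2Z_iff)
    have "int (u\<^sup>2 * t) dvd c" using gN t by (auto simp: ge Gamma0_iff intro: dvd_trans[of _ "int N"] simp del: of_nat_mult)
    then obtain c' where c: "c = int (u\<^sup>2 * t) * c'" by auto
    define h where "h = (\<alpha>, int (u * t) * \<beta>, int u * c', \<delta>)"
    have ch: "c = int (u * t) * (int u * c')" by (simp add: c power2_eq_square)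
    have h: "h \<in> SL2Z" using det by (simp add: h_def SL2Z_iff ch mult_ac)
    define \<sigma> where "\<sigma> = of_nat (u * t) * \<tau>"
    have \<sigma>: "Im \<sigma> > 0" using u0 t0 \<tau> by (simp add: \<sigma>_def)
    have m: "of_nat (u * t) * moebius_act g \<tau> = moebius_act h \<sigma>"
      by (simp add: moebius_act_def ge h_def ch \<sigma>_def algebra_simps)
    have det1: "[\<alpha> * \<delta> = 1] (mod int u)"
    proof -
      have "\<alpha> * \<delta> - 1 = \<beta> * c" using det by simp
      moreover have "int u dvd \<beta> * c" by (simp add: ch)
      ultimately show ?thesis by (simp add: cong_iff_dvd_diff)
    qed
    have cop: "coprime \<delta> (int u)" "coprime \<alpha> (int u)"
      using det1 by (metis cong_imp_coprime cong_sym coprime_1_left coprime_mult_left_iff)+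
    define F where "F = (\<lambda>a b. w (a * b) * ln (siegel_torsion u a b \<sigma>))"
    have Fc: "F a b = F (a mod int u) (b mod int u)" for a b
    proof -
      have ab: "[a = a mod int u] (mod int u)" "[b = b mod int u] (mod int u)" by (simp_all add: cong_def)
      show ?thesis unfolding F_def siegel_torsion_cong[OF u0 \<sigma> ab] weight_cong[OF w cong_mult[OF ab]] ..
    qed
    have "w (a * b) * ln (siegel_torsion u a b (moebius_act h \<sigma>)) = F (a * \<delta>) (b * \<alpha>)" for a b
    proof -
      have "siegel_torsion u a b (moebius_act h \<sigma>) = siegel_torsion u (a * \<delta>) (b * \<alpha>) \<sigma>"
        unfolding h_def siegel_torsion_moebius[OF h[unfolded h_def] \<sigma>]
        by (intro siegel_torsion_cong u0 \<sigma>) (simp_all add: cong_iff_dvd_diff)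
      moreover have "w (a * b) = w (a * \<delta> * (b * \<alpha>))"
      proof (rule weight_cong[OF w])
        have "[a * b * 1 = a * b * (\<alpha> * \<delta>)] (mod int u)" by (intro cong_mult cong_refl cong_sym[OF det1])
        then show "[a * b = a * \<delta> * (b * \<alpha>)] (mod int u)" by (simp add: mult_ac)
      qed
      ultimately show ?thesis by (simp add: F_def)
    qed
    note Fm = this
    have conv: "(\<Sum>a<u. \<Sum>b<u. f (int a) (int b)) = (\<Sum>a=0..<int u. \<Sum>b=0..<int u. f a b)" for f :: "int \<Rightarrow> int \<Rightarrow> real"
    proof -
      have s: "sum g {0..<int u} = (\<Sum>a<u. g (int a))" for g :: "int \<Rightarrow> real"
        using sum.atLeast_int_lessThan_int_shift[of g 0 u] by (simp add: lessThan_atLeast0 o_def)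
      show ?thesis unfolding s ..
    qed
    have "(\<Sum>a<u. \<Sum>b<u. w (int (a * b)) * ln (siegel_torsion u (int a) (int b) (moebius_act h \<sigma>))) = (\<Sum>a=0..<int u. \<Sum>b=0..<int u. F (a * \<delta>) (b * \<alpha>))"
      using conv[of "\<lambda>a b. w (a * b) * ln (siegel_torsion u a b (moebius_act h \<sigma>))"] by (simp add: Fm)
    also have "\<dots> = (\<Sum>a=0..<int u. \<Sum>b=0..<int u. F ((a * \<delta>) mod int u) ((b * \<alpha>) mod int u))"
      by (intro sum.cong refl Fc)
    also have "\<dots> = (\<Sum>a=0..<int u. \<Sum>b=0..<int u. F a b)"
      unfolding sum_mult_mod[OF u0 cop(2)] by (rule sum_mult_mod[OF u0 cop(1), of "\<lambda>x. \<Sum>b=0..<int u. F x b"])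
    also have "\<dots> = (\<Sum>a<u. \<Sum>b<u. w (int (a * b)) * ln (siegel_torsion u (int a) (int b) \<sigma>))"
      using conv[of F] by (simp add: F_def)
    finally show ?thesis
      unfolding ReL[OF \<tau>] ReL[OF Im_moebius_act_pos[OF g \<tau>]] m \<sigma>_def[symmetric] by simp
  qed
  have key: "\<exists>R. \<exists>B C. \<forall>\<tau>. Im \<tau> > 0 \<longrightarrow> Im \<tau> \<ge> B \<longrightarrow> \<bar>Re (?L (moebius_act g \<tau>)) + R * Im \<tau>\<bar> \<le> C" if g: "g \<in> SL2Z" for g
  proof -
    have ut: "u * t > 0" using u0 t0 by simp
    obtain h A B D where h: "h \<in> SL2Z" and A: "(A::int) > 0" and D: "(D::int) > 0" and
      eq: "\<And>\<tau>. Im \<tau> > 0 \<Longrightarrow> of_nat (u * t) * moebius_act g \<tau> = moebius_act h ((of_int A * \<tau> + of_int B) / of_int D)"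
      using hermite_normal_form[OF ut g] by blast
    obtain \<alpha> \<beta> c \<delta> where he: "h = (\<alpha>, \<beta>, c, \<delta>)" by (cases h)
    have det: "\<alpha> * \<delta> - \<beta> * c = 1" using h by (simp add: he SL2Z_iff)
    define \<rho> :: real where "\<rho> = of_int A / of_int D"
    have \<rho>: "\<rho> > 0" using A D by (simp add: \<rho>_def)
    define P where "P = (\<lambda>\<sigma>. \<Sum>a<u. \<Sum>b<u. w (int (a * b)) * ln (siegel_torsion u (int b * \<beta> + int a * \<delta>) (int b * \<alpha> + int a * c) \<sigma>))"
    have "grows_linearly (\<lambda>\<sigma>. w (int (a * b)) * ln (siegel_torsion u (int b * \<beta> + int a * \<delta>) (int b * \<alpha> + int a * c) \<sigma>))" for a b
    proof (cases "w (int (a * b)) = 0")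
      case True
      then show ?thesis by (simp add: grows_linearly_zero)
    next
      case False
      then have "coprime (int a * int b) (int u)" using w unfolding weight_def of_nat_mult by blast
      then have cop: "coprime (int a) (int u)" by simp
      have "\<not> (int u dvd int b * \<beta> + int a * \<delta> \<and> int u dvd int b * \<alpha> + int a * c)"
      proof
        assume *: "int u dvd int b * \<beta> + int a * \<delta> \<and> int u dvd int b * \<alpha> + int a * c"
        have "(int b * \<beta> + int a * \<delta>) * \<alpha> - (int b * \<alpha> + int a * c) * \<beta> = int a * (\<alpha> * \<delta> - \<beta> * c)"
          by (simp add: algebra_simps)
        then have "int a = (int b * \<beta> + int a * \<delta>) * \<alpha> - (int b * \<alpha> + int a * c) * \<beta>" using det by simp
        then have "int u dvd int a" using * by (metis dvd_diff dvd_mult2)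
        then have "is_unit (int u)" using cop by (metis coprime_common_divisor dvd_refl)
        then show False using u by simp
      qed
      then show ?thesis by (intro grows_linearly_cmult ln_siegel_torsion_grows u0)
    qed
    then have "grows_linearly P" unfolding P_def by (intro grows_linearly_sum)
    then obtain R B' C where RBC: "\<And>\<sigma>. Im \<sigma> > 0 \<Longrightarrow> Im \<sigma> \<ge> B' \<Longrightarrow> \<bar>P \<sigma> + R * Im \<sigma>\<bar> \<le> C"
      unfolding grows_linearly_def by blast
    show ?thesis
    proof (rule exI[of _ "(1/2) * R * \<rho>"], rule exI[of _ "B' / \<rho>"], rule exI[of _ "C / 2"], intro allI impI)
      fix \<tau> assume \<tau>: "Im \<tau> > 0" and B: "B' / \<rho> \<le> Im \<tau>"
      define \<sigma> where "\<sigma> = (of_int A * \<tau> + of_int B) / of_int D"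
      have Im\<sigma>: "Im \<sigma> = \<rho> * Im \<tau>" by (simp add: \<sigma>_def \<rho>_def Im_divide_of_real[of _ "of_int D", simplified])
      have \<sigma>0: "Im \<sigma> > 0" using \<rho> \<tau> by (simp add: Im\<sigma>)
      have \<sigma>1: "Im \<sigma> \<ge> B'" using \<rho> B by (simp add: Im\<sigma> divide_le_eq mult.commute)
      have "siegel_torsion u a b (of_nat (u * t) * moebius_act g \<tau>) = siegel_torsion u (b * \<beta> + a * \<delta>) (b * \<alpha> + a * c) \<sigma>" for a b
        unfolding eq[OF \<tau>] \<sigma>_def[symmetric] he by (rule siegel_torsion_moebius[OF h[unfolded he] \<sigma>0])
      then have "Re (?L (moebius_act g \<tau>)) = (1/2) * P \<sigma>"
        unfolding ReL[OF Im_moebius_act_pos[OF g \<tau>]] P_def by simp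
      then have "Re (?L (moebius_act g \<tau>)) + (1/2) * R * \<rho> * Im \<tau> = (1/2) * (P \<sigma> + R * Im \<sigma>)"
        by (simp add: Im\<sigma> algebra_simps)
      then show "\<bar>Re (?L (moebius_act g \<tau>)) + (1/2) * R * \<rho> * Im \<tau>\<bar> \<le> C / 2"
        using RBC[OF \<sigma>0 \<sigma>1] by (simp only: abs_mult) simp
    qed
  qed
  then obtain r where "\<forall>g\<in>SL2Z. \<exists>B C. \<forall>\<tau>. Im \<tau> > 0 \<longrightarrow> Im \<tau> \<ge> B \<longrightarrow> \<bar>Re (?L (moebius_act g \<tau>)) + r g * Im \<tau>\<bar> \<le> C"
    by metis
  then have "admissible N ?L 0 r" unfolding admissible_def using hol inv by simp
  then show ?thesis by blast
qed

section \<open>Modular functions with cuspidal divisor\<close>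

text \<open>Having neither zeros nor poles, f is the exponential of a holomorphic L on the
  contractible half-plane. At a cusp, f is described by a meromorphic G in the parameter e^(2 pi i
  \<tau>/h), and the order n of G at 0 gives the slope 2 pi n / h.\<close>

lemma admissible_modular:
  assumes mf: "meromorphic_modular_function k N f" and cd: "cuspidal_divisor f"
  shows "\<exists>L r. (\<forall>\<tau>. Im \<tau> > 0 \<longrightarrow> f \<tau> = exp (L \<tau>)) \<and> admissible N L (of_int k / 2) r"
proof -
  let ?H = "{\<tau>. Im \<tau> > 0}"
  have H: "upper_half_plane = ?H" by (simp add: upper_half_plane_def)
  have op: "open ?H" by (simp add: open_halfspace_Im_gt)
  have "f analytic_on {z}" if "z \<in> ?H" for z
    using mf cd that H nicely_meromorphic_on_imp_analytic_at[of f upper_half_plane z]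
    by (auto simp: meromorphic_modular_function_def cuspidal_divisor_def)
  then have "f analytic_on ?H" using analytic_on_analytic_at by blast
  then have hf: "f holomorphic_on ?H" by (rule analytic_imp_holomorphic)
  have nz: "f \<tau> \<noteq> 0" if "Im \<tau> > 0" for \<tau> using cd that by (auto simp: cuspidal_divisor_def H)
  have "contractible ?H" by (intro convex_imp_contractible) (simp add: convex_halfspace_Im_gt)
  then obtain L where L: "L holomorphic_on ?H" "\<And>\<tau>. \<tau> \<in> ?H \<Longrightarrow> f \<tau> = exp (L \<tau>)"
    using contractible_imp_holomorphic_log[OF hf] nz by auto
  have ReL: "Re (L \<tau>) = ln (norm (f \<tau>))" if "Im \<tau> > 0" for \<tau> using L(2)[of \<tau>] that by simp
  have lnpow: "ln (x powi m) = of_int m * ln x" if "x > 0" for x :: real and m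
    using that by (simp add: powr_real_of_int'[symmetric] ln_powr)
  have lnIm: "(of_int k / 2) * ln (Im (moebius_act g \<tau>)) = (of_int k / 2) * ln (Im \<tau>) - of_int k * ln (norm (automorphy_factor g \<tau>))"
    if "g \<in> SL2Z" "Im \<tau> > 0" for g \<tau>
    using that automorphy_factor_nonzero[OF that] by (simp add: Im_moebius_act ln_div ln_realpow algebra_simps)
  have inv: "log_abs L (of_int k / 2) (moebius_act g \<tau>) = log_abs L (of_int k / 2) \<tau>"
    if g: "g \<in> Gamma0 N" and \<tau>: "Im \<tau> > 0" for g \<tau>
  proof -
    have gS: "g \<in> SL2Z" using g by (rule Gamma0_imp_SL2Z)
    have j: "norm (automorphy_factor g \<tau>) > 0" using automorphy_factor_nonzero[OF gS \<tau>] by simp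
    have "f (moebius_act g \<tau>) = automorphy_factor g \<tau> powi k * f \<tau>"
      using mf g \<tau> by (auto simp: meromorphic_modular_function_def H)
    then have "norm (f (moebius_act g \<tau>)) = norm (automorphy_factor g \<tau>) powi k * norm (f \<tau>)"
      by (simp add: norm_mult norm_power_int)
    then have "ln (norm (f (moebius_act g \<tau>))) = of_int k * ln (norm (automorphy_factor g \<tau>)) + ln (norm (f \<tau>))"
      using j nz[OF \<tau>] by (simp add: ln_mult lnpow)
    then show ?thesis unfolding ReL[OF \<tau>] ReL[OF Im_moebius_act_pos[OF gS \<tau>]] lnIm[OF gS \<tau>] by simp
  qed
  have key: "\<exists>R. \<exists>B C. \<forall>\<tau>. Im \<tau> > 0 \<longrightarrow> Im \<tau> \<ge> B \<longrightarrow>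
     \<bar>log_abs L (of_int k / 2) (moebius_act g \<tau>) - (of_int k / 2) * ln (Im \<tau>) + R * Im \<tau>\<bar> \<le> C"
    if g: "g \<in> SL2Z" for g
  proof -
    have "meromorphic_at_ii_inf (\<lambda>\<tau>. automorphy_factor g \<tau> powi (-k) * f (moebius_act g \<tau>))"
      using mf g unfolding meromorphic_modular_function_def meromorphic_at_cusps_def by blast
    then obtain h :: nat and G B where h: "h > 0" and G: "G meromorphic_on {0}" and
      eq: "\<And>\<tau>. Im \<tau> > B \<Longrightarrow> automorphy_factor g \<tau> powi (-k) * f (moebius_act g \<tau>) = G (exp (2 * of_real pi * \<i> * \<tau> / of_nat h))"
      unfolding meromorphic_at_ii_inf_def by blast
    let ?e = "\<lambda>\<tau>. exp (2 * of_real pi * \<i> * \<tau> / of_nat h)"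
    have ne: "norm (?e \<tau>) = exp (- 2 * pi * Im \<tau> / of_nat h)" for \<tau>
      by (simp add: norm_exp_eq_Re Re_divide_of_nat)
    have lhs: "norm (automorphy_factor g \<tau> powi (-k) * f (moebius_act g \<tau>)) > 0" if "Im \<tau> > 0" for \<tau>
      using automorphy_factor_nonzero[OF g that] nz[OF Im_moebius_act_pos[OF g that]] by simp
    have small: "norm (?e \<tau>) \<le> s" if s: "s > 0" and \<tau>: "Im \<tau> \<ge> - of_nat h * ln s / (2 * pi)" for s \<tau>
    proof -
      have "- of_nat h * ln s / (2 * pi) \<le> Im \<tau>" using \<tau> .
      then have "- 2 * pi * Im \<tau> / of_nat h \<le> ln s" using h pi_gt_zero by (simp add: field_simps)
      then show ?thesis unfolding ne using s by (metis exp_le_cancel_iff exp_ln)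
    qed
    \<comment> \<open>The order is meaningful only if G does not vanish identically near 0. Points
      high in the half-plane, where f is nonzero, provide arbitrarily small w with G w \<noteq>
      0.\<close>
    have fr: "\<exists>\<^sub>F w in at 0. G w \<noteq> 0"
      unfolding frequently_at
    proof (intro allI impI)
      fix d :: real assume d: "d > 0"
      define y where "y = max (max 1 (B + 1)) (- of_nat h * ln (d/2) / (2 * pi))"
      define \<tau> where "\<tau> = Complex 0 y"
      have "norm (?e \<tau>) \<le> d/2" by (rule small) (use d in \<open>auto simp: \<tau>_def y_def\<close>)
      moreover have "Im \<tau> > B" "Im \<tau> > 0" by (auto simp: \<tau>_def y_def)
      ultimately show "\<exists>w\<in>UNIV. w \<noteq> 0 \<and> dist w 0 < d \<and> G w \<noteq> 0"
        using lhs[of \<tau>] eq[of \<tau>] d by (intro bexI[of _ "?e \<tau>"]) auto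
    qed
    define n where "n = zorder G 0"
    define P where "P = zor_poly G 0"
    have iso: "isolated_singularity_at G 0" and ness: "not_essential G 0"
      using G by (simp_all add: meromorphic_at_iff)
    obtain r where r: "r > 0" and hP: "P holomorphic_on cball 0 r" and P0: "P 0 \<noteq> 0"
      and GP: "\<And>w. w \<in> cball 0 r - {0} \<Longrightarrow> G w = P w * w powi n \<and> P w \<noteq> 0"
      using zorder_exist[OF iso ness fr] by (auto simp: n_def P_def)
    have Pnz: "P w \<noteq> 0" if "w \<in> cball 0 r" for w using GP[of w] P0 that by (cases "w = 0") auto
    have "continuous_on (cball 0 r) (\<lambda>w. ln (norm (P w)))"
      using holomorphic_on_imp_continuous_on[OF hP] Pnz by (intro continuous_intros) auto
    then have "bounded ((\<lambda>w. ln (norm (P w))) ` cball 0 r)"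
      by (intro compact_imp_bounded compact_continuous_image) auto
    then obtain C where "\<forall>x\<in>(\<lambda>w. ln (norm (P w))) ` cball 0 r. norm x \<le> C" unfolding bounded_iff by blast
    then have C: "\<bar>ln (norm (P w))\<bar> \<le> C" if "w \<in> cball 0 r" for w using that by fastforce
    show ?thesis
    proof (rule exI[of _ "2 * pi * of_int n / of_nat h"], rule exI[of _ "max (B + 1) (- of_nat h * ln r / (2 * pi))"], rule exI[of _ C], intro allI impI)
      fix \<tau> assume \<tau>: "Im \<tau> > 0" and B: "max (B + 1) (- of_nat h * ln r / (2 * pi)) \<le> Im \<tau>"
      have er: "?e \<tau> \<in> cball 0 r" using small[OF r, of \<tau>] B by simp
      have j: "norm (automorphy_factor g \<tau>) > 0" using automorphy_factor_nonzero[OF g \<tau>] by simp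
      have gp: "Im (moebius_act g \<tau>) > 0" by (rule Im_moebius_act_pos[OF g \<tau>])
      have "automorphy_factor g \<tau> powi (-k) * f (moebius_act g \<tau>) = P (?e \<tau>) * ?e \<tau> powi n"
        using eq[of \<tau>] GP[of "?e \<tau>"] er B by simp
      then have "norm (automorphy_factor g \<tau>) powi (-k) * norm (f (moebius_act g \<tau>)) = norm (P (?e \<tau>)) * norm (?e \<tau>) powi n"
        by (metis norm_mult norm_power_int)
      then have "ln (norm (automorphy_factor g \<tau>) powi (-k) * norm (f (moebius_act g \<tau>))) = ln (norm (P (?e \<tau>)) * norm (?e \<tau>) powi n)" by simp
      moreover have "ln (norm (automorphy_factor g \<tau>) powi (-k) * norm (f (moebius_act g \<tau>))) = - of_int k * ln (norm (automorphy_factor g \<tau>)) + ln (norm (f (moebius_act g \<tau>)))"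
        using j nz[OF gp] lnpow[OF j, of "-k"] by (simp add: ln_mult)
      moreover have "ln (norm (P (?e \<tau>)) * norm (?e \<tau>) powi n) = ln (norm (P (?e \<tau>))) + of_int n * (- 2 * pi * Im \<tau> / of_nat h)"
        using Pnz[OF er] lnpow[of "norm (?e \<tau>)" n] by (simp add: ln_mult ne)
      ultimately have "ln (norm (f (moebius_act g \<tau>))) = of_int k * ln (norm (automorphy_factor g \<tau>)) + ln (norm (P (?e \<tau>))) + of_int n * (- 2 * pi * Im \<tau> / of_nat h)"
        by linarith
      then have "log_abs L (of_int k / 2) (moebius_act g \<tau>) - (of_int k / 2) * ln (Im \<tau>) + 2 * pi * of_int n / of_nat h * Im \<tau> = ln (norm (P (?e \<tau>)))"
        unfolding lnIm[OF g \<tau>] ReL[OF gp] by simp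
      then show "\<bar>log_abs L (of_int k / 2) (moebius_act g \<tau>) - (of_int k / 2) * ln (Im \<tau>) + 2 * pi * of_int n / of_nat h * Im \<tau>\<bar> \<le> C"
        using C[OF er] by simp
    qed
  qed
  then obtain r where "\<forall>g\<in>SL2Z. \<exists>B C. \<forall>\<tau>. Im \<tau> > 0 \<longrightarrow> Im \<tau> \<ge> B \<longrightarrow>
     \<bar>log_abs L (of_int k / 2) (moebius_act g \<tau>) - (of_int k / 2) * ln (Im \<tau>) + r g * Im \<tau>\<bar> \<le> C"
    by metis
  then have "admissible N L (of_int k / 2) r" unfolding admissible_def using L(1) inv by blast
  then show ?thesis using L(2) by blast
qed

section \<open>Linear relations\<close>

text \<open>Gaussian elimination: an unknown i with nonzero coefficient in the new equation serves
  as pivot and is eliminated from all the others.\<close>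

lemma nontrivial_relation:
  fixes r :: "'j \<Rightarrow> 'k \<Rightarrow> real"
  assumes "finite K" "finite J" "card K < card J"
  shows "\<exists>x. (\<exists>j\<in>J. x j \<noteq> 0) \<and> (\<forall>k\<in>K. (\<Sum>j\<in>J. x j * r j k) = 0)"
  using assms
proof (induction K arbitrary: J r rule: finite_induct)
  case empty
  then have "J \<noteq> {}" by auto
  then show ?case by (intro exI[of _ "\<lambda>_. 1"]) auto
next
  case (insert k K)
  show ?case
  proof (cases "\<forall>j\<in>J. r j k = 0")
    case True
    have "card K < card J" using insert by simp
    from insert.IH[OF insert.prems(1) this, of r] obtain x where
      x: "\<exists>j\<in>J. x j \<noteq> 0" "\<forall>k\<in>K. (\<Sum>j\<in>J. x j * r j k) = 0" by blast
    have "(\<Sum>j\<in>J. x j * r j k) = 0" using True by simp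
    then show ?thesis using x by blast
  next
    case False
    then obtain i where i: "i \<in> J" "r i k \<noteq> 0" by auto
    define J' where "J' = J - {i}"
    have J': "finite J'" "card K < card J'" using insert i by (auto simp: J'_def)
    obtain x where x: "\<exists>j\<in>J'. x j \<noteq> 0" and
      rel: "\<And>m. m \<in> K \<Longrightarrow> (\<Sum>j\<in>J'. x j * (r j m - r j k / r i k * r i m)) = 0"
      using insert.IH[OF J', of "\<lambda>j m. r j m - r j k / r i k * r i m"] by blast
    define y where "y = x(i := - (\<Sum>j\<in>J'. x j * r j k) / r i k)"
    have y: "y j = x j" if "j \<in> J'" for j using that by (simp add: y_def J'_def)
    have split: "(\<Sum>j\<in>J. y j * r j m) = y i * r i m + (\<Sum>j\<in>J'. x j * r j m)" for m
      using sum.remove[OF insert.prems(1) i(1), of "\<lambda>j. y j * r j m"] y by (simp add: J'_def)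
    have "(\<Sum>j\<in>J. y j * r j m) = 0" if "m \<in> insert k K" for m
    proof (cases "m = k")
      case True
      then show ?thesis using i unfolding split by (simp add: y_def)
    next
      case False
      then have "m \<in> K" using that by simp
      from rel[OF this] have "(\<Sum>j\<in>J'. x j * r j m) - (\<Sum>j\<in>J'. x j * r j k) / r i k * r i m = 0"
        by (simp add: algebra_simps sum_subtractf sum_distrib_left sum_distrib_right sum_divide_distrib)
      then show ?thesis unfolding split by (simp add: y_def)
    qed
    moreover obtain j where "j \<in> J'" "x j \<noteq> 0" using x by blast
    then have "j \<in> J" "y j \<noteq> 0" using y[of j] by (auto simp: J'_def)
    then have "\<exists>j\<in>J. y j \<noteq> 0" by blast
    ultimately show ?thesis by blast
  qed
qed

text \<open>The point q = 0 is excluded since the nome never takes that value; the lowest remaining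
  coefficient is recovered as a limit at 0 after division by q^n.\<close>

lemma powser_zero_imp_coeff_zero:
  fixes a :: "nat \<Rightarrow> complex"
  assumes "\<And>q. q \<noteq> 0 \<Longrightarrow> norm q < 1 \<Longrightarrow> (\<lambda>n. a n * q ^ n) sums 0"
  shows "a n = 0"
proof (induction n rule: less_induct)
  case (less n)
  have "(\<lambda>m. a (m + n) * q ^ m) sums 0" if q: "q \<noteq> 0" "norm q < 1" for q
  proof -
    have "(\<lambda>m. a (m + n) * q ^ (m + n)) sums (0 - (\<Sum>i<n. a i * q ^ i))"
      using assms[OF q] sums_iff_shift[of "\<lambda>n. a n * q ^ n" n "0 - (\<Sum>i<n. a i * q ^ i)"] by simp
    then have "(\<lambda>m. a (m + n) * q ^ (m + n)) sums 0" using less by simp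
    from sums_mult2[OF this, of "inverse (q ^ n)"] show ?thesis
      using q by (simp add: power_add mult.assoc)
  qed
  then have "((\<lambda>_. 0) \<longlongrightarrow> a (0 + n)) (at (0::complex))"
    by (intro powser_limit_0_strong[of 1 "\<lambda>m. a (m + n)"]) auto
  then show ?case by (simp add: tendsto_const_iff)
qed

lemma sum_unity_root_power:
  assumes u: "u > 0" shows "(\<Sum>e<u. unity_root u a ^ e) = (if u dvd a then of_nat u else 0)"
proof (cases "u dvd a")
  case True
  then obtain k where "a = u * k" by auto
  then have "unity_root u a = 1" using u by (simp add: exp_eq_1) (metis of_int_of_nat_eq)
  then show ?thesis using True by simp
next
  case False
  have "unity_root u a ^ u = 1" using u by (simp add: exp_of_nat_mult[symmetric] exp_eq_1) (metis of_int_of_nat_eq)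
  moreover have "unity_root u a \<noteq> 1"
  proof
    assume "unity_root u a = 1"
    then obtain n :: int where "(of_nat a :: complex) / of_nat u = of_int n" by (auto simp: unity_root_nome nome_eq_1_iff)
    then have "(of_int (int a) :: complex) = of_int (n * int u)" using u by (simp add: field_simps)
    then have "int a = n * int u" by (simp only: of_int_eq_iff)
    then have "int u dvd int a" by simp
    then show False using False by simp
  qed
  ultimately show ?thesis using False by (simp add: sum_gp_strict)
qed

lemma unity_root_mod_power:
  assumes u: "u > 0" and "[m = n] (mod u)" shows "unity_root u a ^ m = unity_root u a ^ n"
proof -
  have 1: "unity_root u a ^ u = 1" using u by (simp add: exp_of_nat_mult[symmetric] exp_eq_1) (metis of_int_of_nat_eq)
  have "unity_root u a ^ m = unity_root u a ^ (m mod u)" for m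
  proof -
    have "unity_root u a ^ m = unity_root u a ^ (u * (m div u) + m mod u)" by simp
    also have "\<dots> = unity_root u a ^ (m mod u)" by (simp only: power_add power_mult 1 power_one mult_1)
    finally show ?thesis .
  qed
  then show ?thesis using assms(2) unfolding cong_def by metis
qed

section \<open>Independence of the \<open>q\<close>-expansions\<close>

lemma log_product_dilate_sums:
  assumes c: "bounded_coeff c" and q: "norm q < 1" and t: "t > 0"
  shows "(\<lambda>M. (if M = 0 \<or> \<not> t dvd M then 0 else log_product_coeff u c (M div t)) * q ^ M) sums log_product u c (q ^ t)"
proof -
  define f where "f = (\<lambda>M. (if M = 0 \<or> \<not> t dvd M then 0 else log_product_coeff u c (M div t)) * q ^ M)"
  have "norm (q ^ t) < 1" using q t power_less_one_iff[of "norm q" t] by (simp add: norm_power)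
  from log_product_power_series[OF c this, of u]
  have "(\<lambda>M. (if M = 0 then 0 else log_product_coeff u c M) * (q ^ t) ^ M) sums log_product u c (q ^ t)" .
  also have "(\<lambda>M. (if M = 0 then 0 else log_product_coeff u c M) * (q ^ t) ^ M) = (\<lambda>M. f (t * M))"
    using t by (auto simp: f_def power_mult)
  finally have "(\<lambda>M. f (t * M)) sums log_product u c (q ^ t)" .
  moreover have "strict_mono (\<lambda>M. t * M)" using t by (simp add: strict_mono_def)
  moreover have "f n = 0" if "n \<notin> range (\<lambda>M. t * M)" for n using that by (auto simp: f_def dvd_def)
  ultimately have "f sums log_product u c (q ^ t)" using sums_mono_reindex[of "\<lambda>M. t * M" f] by blast
  then show ?thesis by (simp add: f_def)
qed

text \<open>
  The \<open>p\<^sup>k\<close>-th coefficient of the series gives \<open>\<Sum>j\<le>k. p\<^sup>-\<^sup>j (x + W(p\<^sup>k\<^sup>-\<^sup>2\<^sup>j)) = 0\<close>, where \<open>W\<close> is the finite Fourier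
  transform of \<open>w\<close>, up to inversion. Comparing two such relations yields \<open>x + W(e) = - p\<^sup>-\<^sup>k (x + W(e\<^sup>-\<^sup>1))\<close> for
  \<open>e = p\<^sup>k\<close>, and the same with \<open>e\<close> and \<open>e\<^sup>-\<^sup>1\<close> exchanged.
\<close>
lemma prime_power_coeffs_zero:
  fixes p u :: nat and x :: real and w :: "int \<Rightarrow> real"
  assumes u: "u \<ge> 2" and w: "weight u w" and p: "prime p"
    and gen: "\<And>e. coprime e u \<Longrightarrow> \<exists>k. [p ^ k = e] (mod u)" and pu: "coprime p u"
    and nonunit: "\<And>e. \<not> coprime e u \<Longrightarrow> \<exists>c. \<forall>b. coprime b u \<longrightarrow> unity_root u b ^ e = c"
    and coeff: "\<And>k. of_real x * log_product_coeff 1 (\<lambda>_ _. 1) (p ^ k) + log_product_coeff u (\<lambda>n a. of_real (w (int (a * n)))) (p ^ k) = 0"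
  shows "x = 0 \<and> (\<forall>n. w n = 0)"
proof -
  have u0: "u > 0" using u by simp
  have p2: "p \<ge> 2" using p by (rule prime_ge_2_nat)
  have p0: "p > 0" using p2 by simp
  \<comment> \<open>The sum of w(a n) \<zeta>^(a m). Since p is a unit modulo u, the substitution a
    -> a p gives \<open>W (p * n) (p * m) = W n m\<close>, so \<Phi> i j depends only on i -
    j.\<close>
  define W where "W = (\<lambda>n m. \<Sum>a=1..u. of_real (w (int (a * n))) * unity_root u a ^ m)"
  define \<Phi> where "\<Phi> = (\<lambda>i j. of_real x + W (p ^ i) (p ^ j))"
  have W_mod: "W n m = W n m'" if "[m = m'] (mod u)" for n m m'
    unfolding W_def using unity_root_mod_power[OF u0 that] by simp
  have W_mod1: "W n m = W n' m" if "[n = n'] (mod u)" for n n' m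
  proof -
    have "w (int (a * n)) = w (int (a * n'))" for a
    proof (rule weight_cong[OF w])
      have "[a * n = a * n'] (mod u)" using that by (intro cong_mult cong_refl)
      then show "[int (a * n) = int (a * n')] (mod int u)" by (simp only: cong_int_iff)
    qed
    then show ?thesis unfolding W_def by simp
  qed
  have W_int: "W n m = (\<Sum>a=0..<int u. of_real (w (a * int n)) * unity_root u (nat a) ^ m)" for n m
  proof -
    have "(\<Sum>a=0..<int u. of_real (w (a * int n)) * unity_root u (nat a) ^ m) = (\<Sum>a<u. of_real (w (int (a * n))) * unity_root u a ^ m)"
      using sum.atLeast_int_lessThan_int_shift[of "\<lambda>a. of_real (w (a * int n)) * unity_root u (nat a) ^ m" 0 u] by (simp add: lessThan_atLeast0)
    moreover have "W n m = (\<Sum>a<u. of_real (w (int (a * n))) * unity_root u a ^ m)"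
    proof -
      have e: "w (int (u * n)) = w (int (0 * n))" by (rule weight_cong[OF w]) (simp add: cong_iff_dvd_diff)
      have "W n m = (\<Sum>a<u. of_real (w (int (Suc a * n))) * unity_root u (Suc a) ^ m)"
        unfolding W_def by (rule sum.reindex_bij_witness[of _ Suc "\<lambda>a. a - 1"]) auto
      also have "\<dots> = (\<Sum>a<u. of_real (w (int (a * n))) * unity_root u a ^ m)"
        using sum.lessThan_Suc_shift[of "\<lambda>a. of_real (w (int (a * n))) * unity_root u a ^ m" u] e unity_root_self[OF u0]
        by (simp del: of_nat_mult of_nat_Suc mult_Suc)
      finally show ?thesis .
    qed
    ultimately show ?thesis by simp
  qed
  have W_shift: "W (p * n) (p * m) = W n m" for n m
  proof -
    define F where "F = (\<lambda>a::int. of_real (w (a * int n)) * unity_root u (nat (a mod int u)) ^ m)"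
    have Fm: "F a = F (a mod int u)" for a
    proof -
      have "w (a * int n) = w (a mod int u * int n)" by (rule weight_cong[OF w]) (simp add: cong_def mod_simps)
      then show ?thesis by (simp add: F_def)
    qed
    have pu': "coprime (int p) (int u)" using pu by simp
    have "W (p * n) (p * m) = (\<Sum>a=0..<int u. F (a * int p))"
      unfolding W_int
    proof (rule sum.cong)
      fix a assume a: "a \<in> {0..<int u}"
      have r: "unity_root u (nat a) ^ (p * m) = unity_root u (nat a * p) ^ m"
      proof -
        have "unity_root u (nat a * p) = unity_root u (nat a) ^ p" by (simp add: exp_of_nat_mult[symmetric] mult_ac)
        then show ?thesis by (simp add: power_mult)
      qed
      have "unity_root u (nat a * p) = unity_root u (nat ((a * int p) mod int u))"
      proof -
        have n: "nat ((a * int p) mod int u) = (nat a * p) mod u"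
          using a by (simp add: nat_mod_distrib nat_mult_distrib)
        have r1: "unity_root u b = unity_root u 1 ^ b" for b by (simp add: exp_of_nat_mult[symmetric] mult_ac)
        have "unity_root u 1 ^ (nat a * p) = unity_root u 1 ^ ((nat a * p) mod u)" by (rule unity_root_mod_power[OF u0]) (simp add: cong_def)
        then show ?thesis unfolding n using r1 by metis
      qed
      then show "of_real (w (a * int (p * n))) * unity_root u (nat a) ^ (p * m) = F (a * int p)"
        unfolding F_def r by (simp add: mult_ac)
    qed simp
    also have "\<dots> = (\<Sum>a=0..<int u. F ((a * int p) mod int u))" by (intro sum.cong refl Fm)
    also have "\<dots> = (\<Sum>a=0..<int u. F a)" by (rule sum_mult_mod[OF u0 pu'])
    also have "\<dots> = W n m" unfolding W_int F_def by (intro sum.cong) auto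
    finally show ?thesis .
  qed
  have \<Phi>_shift: "\<Phi> (i + l) (j + l) = \<Phi> i j" for i j l
  proof (induction l)
    case (Suc l)
    have "\<Phi> (i + Suc l) (j + Suc l) = of_real x + W (p * p ^ (i + l)) (p * p ^ (j + l))" by (simp add: \<Phi>_def)
    then show ?case using Suc unfolding W_shift by (simp add: \<Phi>_def)
  qed simp
  define s where "s = (\<lambda>k. \<Sum>j\<le>k. \<Phi> (k - j) j / of_nat p ^ j)"
  have s0: "s k = 0" for k
  proof -
    have dv: "{n. n dvd p ^ k} = (\<lambda>j. p ^ (k - j)) ` {..k}"
    proof -
      have rev: "(\<lambda>j. k - j) ` {..k} = {..k}"
      proof
        show "{..k} \<subseteq> (\<lambda>j. k - j) ` {..k}"
        proof
          fix j assume "j \<in> {..k}"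
          then show "j \<in> (\<lambda>j. k - j) ` {..k}" by (intro image_eqI[of _ _ "k - j"]) auto
        qed
      qed auto
      have "{n. n dvd p ^ k} = (\<lambda>i. p ^ i) ` ((\<lambda>j. k - j) ` {..k})"
        unfolding rev using divides_primepow_nat[OF p] by auto
      then show ?thesis by (simp only: image_image)
    qed
    have inj: "inj_on (\<lambda>j. p ^ (k - j)) {..k}"
      by (rule inj_onI) (use p2 in auto)
    have dd: "p ^ k div p ^ (k - j) = p ^ j" if "j \<le> k" for j
    proof -
      have "p ^ k = p ^ (k - j) * p ^ j" using that by (simp add: power_add[symmetric])
      then show ?thesis using p0 by simp
    qed
    have 1: "log_product_coeff 1 (\<lambda>_ _. 1) (p ^ k) = - (\<Sum>j\<le>k. 1 / of_nat p ^ j)"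
      unfolding log_product_coeff_def dv sum.reindex[OF inj] using unity_root_self[of 1] by (simp add: dd sum_negf)
    have 2: "log_product_coeff u (\<lambda>n a. of_real (w (int (a * n)))) (p ^ k) = - (\<Sum>j\<le>k. W (p ^ (k - j)) (p ^ j) / of_nat p ^ j)"
      unfolding log_product_coeff_def dv sum.reindex[OF inj] by (simp add: dd sum_negf W_def)
    have "s k = of_real x * (\<Sum>j\<le>k. 1 / of_nat p ^ j) + (\<Sum>j\<le>k. W (p ^ (k - j)) (p ^ j) / of_nat p ^ j)"
      by (simp add: s_def \<Phi>_def add_divide_distrib sum.distrib sum_distrib_left)
    also have "\<dots> = - (of_real x * (- (\<Sum>j\<le>k. 1 / of_nat p ^ j)) + - (\<Sum>j\<le>k. W (p ^ (k - j)) (p ^ j) / of_nat p ^ j))"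
      by simp
    also have "\<dots> = 0" using coeff[of k] unfolding 1 2 by (simp only: neg_equal_0_iff_equal)
    finally show ?thesis .
  qed
  \<comment> \<open>The two ends of the sum s k. For k \<ge> 2 the terms in between add up to s (k -
    2) / p, which is 0.\<close>
  define A B where "A = (\<lambda>k. \<Phi> k 0)" and "B = (\<lambda>k. \<Phi> 0 k)"
  have AB: "A (Suc k) = - B (Suc k) / of_nat p ^ Suc k" for k
  proof (cases k)
    case 0
    then show ?thesis using s0[of 1] by (simp add: s_def A_def B_def add_eq_0_iff)
  next
    case (Suc i)
    have "s (Suc (Suc i)) = \<Phi> (Suc (Suc i)) 0 + (\<Sum>j\<le>Suc i. \<Phi> (Suc i - j) (Suc j) / of_nat p ^ Suc j)"
      unfolding s_def by (subst sum.atMost_Suc_shift) simp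
    also have "(\<Sum>j\<le>Suc i. \<Phi> (Suc i - j) (Suc j) / of_nat p ^ Suc j) = (\<Sum>j\<le>i. \<Phi> (Suc i - j) (Suc j) / of_nat p ^ Suc j) + \<Phi> 0 (Suc (Suc i)) / of_nat p ^ Suc (Suc i)"
      by simp
    also have "(\<Sum>j\<le>i. \<Phi> (Suc i - j) (Suc j) / of_nat p ^ Suc j) = (\<Sum>j\<le>i. \<Phi> (i - j) j / of_nat p ^ j) / of_nat p"
      unfolding sum_divide_distrib
    proof (rule sum.cong)
      fix j assume "j \<in> {..i}"
      then have "\<Phi> (Suc i - j) (Suc j) = \<Phi> (i - j) j" using \<Phi>_shift[of "i - j" 1 j] by (simp add: Suc_diff_le)
      then show "\<Phi> (Suc i - j) (Suc j) / of_nat p ^ Suc j = \<Phi> (i - j) j / of_nat p ^ j / of_nat p" by simp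
    qed simp
    also have "(\<Sum>j\<le>i. \<Phi> (i - j) j / of_nat p ^ j) = s i" by (simp add: s_def)
    finally have "A (Suc (Suc i)) + B (Suc (Suc i)) / of_nat p ^ Suc (Suc i) = 0"
      using s0 by (simp add: A_def B_def)
    then show ?thesis unfolding Suc by (simp add: add_eq_0_iff)
  qed
  have nAB: "norm (A k) \<le> norm (B k) / 2" if k: "k > 0" for k
  proof -
    obtain i where i: "k = Suc i" using k by (cases k) auto
    have "p ^ 1 \<le> p ^ k" using k p2 by (intro power_increasing) auto
    then have "2 \<le> p ^ k" using p2 by simp
    then have "real 2 \<le> real (p ^ k)" by (simp only: of_nat_le_iff)
    then have "2 \<le> real p ^ k" by simp
    then have "norm (B k) / real p ^ k \<le> norm (B k) / 2" using p0 by (intro divide_left_mono) auto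
    moreover have "norm (A k) = norm (B k) / real p ^ k" using AB[of i] by (simp add: i norm_divide norm_power norm_mult)
    ultimately show ?thesis by simp
  qed
  have fermat: "[p ^ (totient u * l) = 1] (mod u)" for l
  proof -
    have "[p ^ totient u = 1] (mod u)" using pu by (rule euler_theorem)
    then have "[(p ^ totient u) ^ l = 1 ^ l] (mod u)" by (rule cong_pow)
    then show ?thesis by (simp add: power_mult)
  qed
  have tot: "totient u > 0" using u0 by simp
  have AeqB: "A k = B l" and BeqA: "B k = A l" if kl: "k + l = totient u * m" for k l m
  proof -
    have pp: "[p ^ (k + l) = p ^ 0] (mod u)" using fermat[of m] kl by simp
    have "B l = \<Phi> (0 + k) (l + k)" unfolding B_def by (rule \<Phi>_shift[symmetric])
    also have "\<dots> = A k" using W_mod[OF pp] by (simp add: \<Phi>_def A_def add.commute)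
    finally show "A k = B l" ..
    have "B k = \<Phi> (0 + l) (k + l)" unfolding B_def by (rule \<Phi>_shift[symmetric])
    also have "\<dots> = A l" using W_mod[OF pp] by (simp add: \<Phi>_def A_def)
    finally show "B k = A l" .
  qed
  have Bpos: "B k = 0" if k: "k > 0" for k
  proof -
    \<comment> \<open>p^l is inverse to p^k modulo u, so A and B are interchanged between k and l;
      the factor 2 keeps l positive even if totient u = 1. Applying |A| \<le> |B| / 2 at both k and
      l gives |B k| \<le> |B k| / 4.\<close>
    define l where "l = totient u * (2 * k) - k"
    have "1 * k \<le> totient u * k" by (rule mult_le_mono1) (use tot in linarith)
    moreover have "totient u * (2 * k) = totient u * k + totient u * k" by simp
    ultimately have kl: "k + l = totient u * (2 * k)" and l: "l > 0" using k unfolding l_def by linarith+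
    have "norm (B k) = norm (A l)" using BeqA[OF kl] by simp
    also have "\<dots> \<le> norm (B l) / 2" by (rule nAB[OF l])
    also have "B l = A k" using AeqB[OF kl] by simp
    finally have "norm (B k) \<le> norm (A k) / 2" .
    then have "norm (B k) \<le> 0" using nAB[OF k] norm_ge_zero[of "B k"] by linarith
    then show ?thesis by simp
  qed
  have B0: "B k = 0" for k
  proof (cases "k = 0")
    case True
    then show ?thesis using s0[of 0] by (simp add: s_def B_def)
  qed (use Bpos in simp)
  have unit: "W 1 e = - of_real x" if "coprime e u" for e
  proof -
    obtain k where "[p ^ k = e] (mod u)" using gen[OF \<open>coprime e u\<close>] by blast
    then have "W 1 e = W 1 (p ^ k)" by (rule W_mod[OF cong_sym])
    then show ?thesis using B0[of k] by (simp add: B_def \<Phi>_def eq_neg_iff_add_eq_0 add.commute)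
  qed
  have w0: "w n = 0" if "\<not> coprime n (int u)" for n using w that by (simp add: weight_def)
  have wsum: "(\<Sum>a=1..u. w (int a)) = 0"
  proof -
    have e: "w (int u) = w (int 0)" by (rule weight_cong[OF w]) (simp add: cong_iff_dvd_diff)
    have "(\<Sum>a=1..u. w (int a)) = (\<Sum>a<u. w (int (Suc a)))"
      by (rule sum.reindex_bij_witness[of _ Suc "\<lambda>a. a - 1"]) auto
    also have "\<dots> = (\<Sum>a<u. w (int a))"
      using sum.lessThan_Suc_shift[of "\<lambda>a. w (int a)" u] e by (simp del: of_nat_Suc)
    also have "\<dots> = (\<Sum>a=0..<int u. w a)"
      using sum.atLeast_int_lessThan_int_shift[of w 0 u] by (simp add: lessThan_atLeast0)
    finally show ?thesis using w by (simp add: weight_def)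
  qed
  \<comment> \<open>For a non-unit e the power \<zeta>^(b e) takes the same value at all units b, so
    W 1 e is a multiple of the sum of w.\<close>
  have non: "W 1 e = 0" if ne: "\<not> coprime e u" for e
  proof -
    obtain c where c: "\<And>b. coprime b u \<Longrightarrow> unity_root u b ^ e = c" using nonunit[OF ne] by blast
    have "W 1 e = (\<Sum>a=1..u. of_real (w (int a)) * c)"
      unfolding W_def
    proof (rule sum.cong)
      fix a show "of_real (w (int (a * 1))) * unity_root u a ^ e = of_real (w (int a)) * c"
        using c[of a] w0[of "int a"] by (cases "coprime a u") auto
    qed simp
    also have "\<dots> = of_real (\<Sum>a=1..u. w (int a)) * c" by (simp add: sum_distrib_right)
    finally show ?thesis by (simp only: wsum) simp
  qed
  have dft: "(\<Sum>e<u. unity_root u (u - b) ^ e * W 1 e) = of_nat u * of_real (w (int b))" if b: "b \<in> {1..u}" for b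
  proof -
    have "(\<Sum>e<u. unity_root u (u - b) ^ e * W 1 e) = (\<Sum>a=1..u. of_real (w (int a)) * (\<Sum>e<u. unity_root u (u - b + a) ^ e))"
    proof -
      have ee: "unity_root u (u - b) ^ e * (of_real (w (int (a * 1))) * unity_root u a ^ e) = of_real (w (int a)) * unity_root u (u - b + a) ^ e" for a e
      proof -
        have "unity_root u (u - b + a) = unity_root u (u - b) * unity_root u a" by (simp add: exp_add[symmetric] add_divide_distrib distrib_left)
        then show ?thesis by (simp add: power_mult_distrib mult_ac)
      qed
      show ?thesis unfolding W_def sum_distrib_left by (subst sum.swap) (intro sum.cong refl ee)
    qed
    also have "\<dots> = (\<Sum>a=1..u. if a = b then of_nat u * of_real (w (int b)) else 0)"
    proof (rule sum.cong)
      fix a assume a: "a \<in> {1..u}"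
      have "u dvd u - b + a \<longleftrightarrow> a = b"
      proof
        assume "u dvd u - b + a"
        then obtain k where k: "u - b + a = u * k" by auto
        have "1 \<le> a" "a \<le> u" "1 \<le> b" "b \<le> u" using a b by auto
        then have "0 < u - b + a" "u - b + a < u * 2" by linarith+
        then have "0 < k" "k < 2" unfolding k by simp_all
        then have "k = 1" by linarith
        then have "u - b + a = u" using k by (simp only: mult_1_right)
        then show "a = b" using \<open>b \<le> u\<close> by linarith
      qed (use b in simp)
      then show "of_real (w (int a)) * (\<Sum>e<u. unity_root u (u - b + a) ^ e) = (if a = b then of_nat u * of_real (w (int b)) else 0)"
        unfolding sum_unity_root_power[OF u0] by simp
    qed simp
    also have "\<dots> = of_nat u * of_real (w (int b))" using b by simp
    finally show ?thesis .
  qed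
  \<comment> \<open>Fourier inversion at the class 0, represented by u: w vanishes there, whereas
    its transform is -x at every unit and 0 elsewhere.\<close>
  have x0: "x = 0"
  proof -
    have "\<not> coprime (int u) (int u)" using u by simp
    then have "0 = (\<Sum>e<u. unity_root u (u - u) ^ e * W 1 e)" using dft[of u] u0 w0[of "int u"] by simp
    also have "\<dots> = (\<Sum>e<u. if coprime e u then - complex_of_real x else 0)"
      using unit non by (intro sum.cong) auto
    also have "\<dots> = - of_real x * of_nat (card {e. e < u \<and> coprime e u})"
      by (simp add: sum.If_cases Int_def)
    finally have "of_real x * of_nat (card {e. e < u \<and> coprime e u}) = (0::complex)" by simp
    moreover have "1 \<in> {e. e < u \<and> coprime e u}" using u by simp
    then have "card {e. e < u \<and> coprime e u} \<noteq> 0" by auto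
    ultimately show ?thesis by simp
  qed
  have W0: "W 1 e = 0" for e using unit[of e] non[of e] x0 by (cases "coprime e u") auto
  have "w n = 0" for n
  proof -
    define b where "b = (if nat (n mod int u) = 0 then u else nat (n mod int u))"
    have b: "b \<in> {1..u}" using u0 by (auto simp: b_def nat_le_iff less_imp_le)
    have "[n = int b] (mod int u)"
    proof (cases "n mod int u = 0")
      case False
      moreover have "n mod int u \<ge> 0" using u0 by simp
      ultimately have "int b = n mod int u" unfolding b_def by auto
      then show ?thesis by (simp add: cong_def)
    qed (simp add: b_def cong_def)
    then have "w n = w (int b)" by (rule weight_cong[OF w])
    moreover have "of_nat u * complex_of_real (w (int b)) = 0" using dft[OF b] W0 by simp
    then have "w (int b) = 0" using u0 by simp
    ultimately show ?thesis by simp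
  qed
  then show ?thesis using x0 by blast
qed

text \<open>The coefficient of q^(t p^k) isolates t: a divisor s of N that divides t p^k divides t,
  because p is coprime to N, and the induction has already disposed of the proper divisors of t. The
  relations left over, one for each k, are those of \<open>prime_power_coeffs_zero\<close>.\<close>

lemma quotient_independence:
  fixes x :: "nat \<Rightarrow> real" and W :: "nat \<Rightarrow> int \<Rightarrow> real"
  assumes N: "N > 0" and u: "u \<ge> 2" and W: "\<And>t. weight u (W t)" and p: "prime p" and pN: "coprime p N"
    and gen: "\<And>e. coprime e u \<Longrightarrow> \<exists>k. [p ^ k = e] (mod u)" and pu: "coprime p u"
    and nonunit: "\<And>e. \<not> coprime e u \<Longrightarrow> \<exists>c. \<forall>b. coprime b u \<longrightarrow> unity_root u b ^ e = c"
    and const: "\<And>\<tau>. Im \<tau> > 0 \<Longrightarrow> (\<Sum>t | t dvd N. of_real (x t) * log_eta (of_nat t * \<tau>) +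
       weighted_product u (W t) (nome (of_nat t * \<tau>))) = C"
    and t: "t dvd N"
  shows "x t = 0 \<and> (\<forall>n. W t n = 0)"
proof -
  have u0: "u > 0" using u by simp
  let ?D = "{t. t dvd N}"
  let ?c = "\<lambda>t n a. complex_of_real (W t (int (a * n)))"
  have fD: "finite ?D" using N by simp
  have pos: "t > 0" if "t \<in> ?D" for t using that N by (auto intro: Nat.gr0I)
  have bc: "bounded_coeff (?c t)" for t by (rule weight_bounded_coeff[OF u0 W])
  define F where "F = (\<lambda>q. \<Sum>t\<in>?D. of_real (x t) * log_product 1 (\<lambda>_ _. 1) (q ^ t) + log_product u (?c t) (q ^ t))"
  define S where "S = (\<Sum>t\<in>?D. of_real (x t) * (2 * of_real pi * \<i> * of_nat t / 24))"
  have FC: "S * \<tau> + F (nome \<tau>) = C" if \<tau>: "Im \<tau> > 0" for \<tau>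
  proof -
    have "C = (\<Sum>t\<in>?D. of_real (x t) * log_eta (of_nat t * \<tau>) + log_product u (?c t) (nome (of_nat t * \<tau>)))"
      using const[OF \<tau>] by simp
    also have "\<dots> = (\<Sum>t\<in>?D. of_real (x t) * (2 * of_real pi * \<i> * of_nat t / 24) * \<tau> +
       (of_real (x t) * log_product 1 (\<lambda>_ _. 1) (nome \<tau> ^ t) + log_product u (?c t) (nome \<tau> ^ t)))"
      unfolding log_eta_def nome_of_nat_mult by (intro sum.cong refl) (simp add: algebra_simps)
    also have "\<dots> = S * \<tau> + F (nome \<tau>)"
      by (simp add: S_def F_def sum.distrib sum_distrib_right)
    finally show ?thesis ..
  qed
  \<comment> \<open>All other terms are periodic under \<tau> -> \<tau> + 1, hence so is S
    \<tau>.\<close>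
  have S0: "S = 0"
  proof -
    have "S * \<i> + F (nome \<i>) = C" "S * (\<i> + 1) + F (nome (\<i> + 1)) = C" by (rule FC, simp)+
    moreover have "nome (\<i> + 1) = nome \<i>" by (simp add: nome_add)
    ultimately show ?thesis by (simp add: algebra_simps)
  qed
  have FqC: "F q = C" if q: "q \<noteq> 0" "norm q < 1" for q
  proof -
    define \<tau> where "\<tau> = Ln q / (2 * of_real pi * \<i>)"
    have n: "nome \<tau> = q" using q by (simp add: nome_def \<tau>_def)
    then have "exp (- 2 * pi * Im \<tau>) < exp 0" using norm_nome[of \<tau>] q by simp
    then have "Im \<tau> > 0" by (simp only: exp_less_cancel_iff) (simp add: mult_less_0_iff zero_less_mult_iff)
    then show ?thesis using FC[of \<tau>] S0 n by simp
  qed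
  define a where "a = (\<lambda>t M. of_real (x t) * log_product_coeff 1 (\<lambda>_ _. 1) M + log_product_coeff u (?c t) M)"
  define A where "A = (\<lambda>M. \<Sum>t\<in>?D. if M = 0 \<or> \<not> t dvd M then 0 else a t (M div t))"
  have "(\<lambda>M. (A M - (if M = 0 then C else 0)) * q ^ M) sums 0" if q: "q \<noteq> 0" "norm q < 1" for q
  proof -
    have "(\<lambda>M. \<Sum>t\<in>?D. of_real (x t) * ((if M = 0 \<or> \<not> t dvd M then 0 else log_product_coeff 1 (\<lambda>_ _. 1) (M div t)) * q ^ M) +
        (if M = 0 \<or> \<not> t dvd M then 0 else log_product_coeff u (?c t) (M div t)) * q ^ M) sums F q"
      unfolding F_def by (intro sums_sum sums_add sums_mult log_product_dilate_sums bounded_coeff_1 bc q pos)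
    also have "(\<lambda>M. \<Sum>t\<in>?D. of_real (x t) * ((if M = 0 \<or> \<not> t dvd M then 0 else log_product_coeff 1 (\<lambda>_ _. 1) (M div t)) * q ^ M) +
        (if M = 0 \<or> \<not> t dvd M then 0 else log_product_coeff u (?c t) (M div t)) * q ^ M) = (\<lambda>M. A M * q ^ M)"
      unfolding A_def sum_distrib_right by (intro ext sum.cong refl) (simp add: a_def algebra_simps)
    finally have 1: "(\<lambda>M. A M * q ^ M) sums C" using FqC[OF q] by simp
    have 2: "(\<lambda>M. (if M = 0 then C else 0) * q ^ M) sums C"
      using sums_single[of 0 "\<lambda>M. C * q ^ M"] by (simp add: if_distrib[of "\<lambda>y. y * _"] cong: if_cong)
    show ?thesis using sums_diff[OF 1 2] by (simp add: left_diff_distrib)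
  qed
  then have "A M - (if M = 0 then C else 0) = 0" for M by (rule powser_zero_imp_coeff_zero)
  then have A0: "A M = 0" if "M > 0" for M using that by (metis diff_zero neq0_conv)
  show ?thesis
    using t
  proof (induction t rule: less_induct)
    case (less t)
    have t0: "t > 0" using pos less by simp
    have "a t (p ^ k) = 0" for k
    proof -
      let ?M = "t * p ^ k"
      have p0: "p ^ k > 0" using p by (simp add: prime_gt_0_nat)
      then have M0: "?M > 0" using t0 by simp
      have M: "?M \<noteq> 0" using M0 by simp
      have "(if ?M = 0 \<or> \<not> s dvd ?M then 0 else a s (?M div s)) = (if s = t then a t (p ^ k) else 0)" if s: "s \<in> ?D" for s
      proof (cases "s dvd ?M")
        case True
        have "coprime s (p ^ k)" using pN s by (auto intro: coprime_divisors[OF _ dvd_refl] simp: coprime_commute)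
        then have "s dvd t" using True by (simp add: coprime_dvd_mult_left_iff)
        show ?thesis
        proof (cases "s = t")
          case True
          have "?M div t = p ^ k" using t0 by simp
          moreover have "p \<noteq> 0" using p by auto
          ultimately show ?thesis using True M by simp
        next
          case False
          then have "s < t" using \<open>s dvd t\<close> t0 dvd_imp_le by (metis le_neq_implies_less)
          then have "x s = 0 \<and> (\<forall>n. W s n = 0)" using less s by simp
          then have "a s m = 0" for m by (simp add: a_def log_product_coeff_def)
          then show ?thesis using False by simp
        qed
      next
        case False
        then show ?thesis by auto
      qed
      then have "A ?M = (\<Sum>s\<in>?D. if s = t then a t (p ^ k) else 0)" unfolding A_def by (intro sum.cong refl)
      also have "\<dots> = a t (p ^ k)" using fD less by simp
      finally show ?thesis using A0[OF M0] by simp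
    qed
    then show ?case
      using prime_power_coeffs_zero[OF u W p gen pu nonunit, of "x t" t] by (simp add: a_def)
  qed
qed

section \<open>Basis weights and the multiplicative relation that contains f\<close>

lemma admissible_cong:
  assumes "admissible N L \<kappa> r" "\<And>g. g \<in> SL2Z \<Longrightarrow> r g = r' g" shows "admissible N L \<kappa> r'"
  using assms unfolding admissible_def by simp

text \<open>For the units e \<noteq> 1 modulo u these form a basis of the weights, totient u - 1 in
  number; the coefficient at e is recovered by evaluating at e.\<close>

definition delta_weight :: "nat \<Rightarrow> nat \<Rightarrow> int \<Rightarrow> real" where
  "delta_weight u e n = of_bool ([n = int e] (mod int u)) - of_bool ([n = 1] (mod int u))"

lemma sum_of_bool_cong:
  assumes u: "u > 0" shows "(\<Sum>a=0..<int u. of_bool ([a = m] (mod int u)) :: real) = 1"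
proof -
  have "(\<Sum>a=0..<int u. of_bool ([a = m] (mod int u)) :: real) = (\<Sum>a=0..<int u. if a = m mod int u then 1 else 0)"
    by (intro sum.cong refl) (auto simp: cong_def)
  then show ?thesis using u by simp
qed

lemma weight_delta:
  assumes u: "u > 0" and e: "coprime e u" shows "weight u (delta_weight u e)"
proof -
  have "\<not> [n = m] (mod int u)" if "\<not> coprime n (int u)" "coprime m (int u)" for n m
    using that by (metis cong_imp_coprime cong_sym)
  moreover have "coprime (int e) (int u)" using e by simp
  ultimately have "delta_weight u e n = 0" if "\<not> coprime n (int u)" for n
    using that by (simp add: delta_weight_def)
  moreover have "delta_weight u e (n + int u) = delta_weight u e n" for n
    by (simp add: delta_weight_def cong_def)
  moreover have "(\<Sum>a=0..<int u. delta_weight u e a) = 0"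
    unfolding delta_weight_def sum_subtractf using sum_of_bool_cong[OF u] by simp
  ultimately show ?thesis by (auto simp: weight_def)
qed

lemma weight_sum:
  assumes "\<And>i. i \<in> I \<Longrightarrow> weight u (w i)" shows "weight u (\<lambda>n. \<Sum>i\<in>I. x i * w i n)"
proof -
  have "(\<Sum>a=0..<int u. \<Sum>i\<in>I. x i * w i a) = (\<Sum>i\<in>I. x i * (\<Sum>a=0..<int u. w i a))"
    by (subst sum.swap) (simp add: sum_distrib_left)
  then show ?thesis using assms unfolding weight_def by simp
qed

text \<open>The condition on squares dividing N makes the eta functions and Siegel products at least
  as many as the cusp labels, while p, \<open>gen\<close> and \<open>nonunit\<close> feed the
  independence argument. The latter shows that f occurs in the relation with a nonzero exponent, so
  the relation can be solved for f.\<close>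

theorem modular_unit_representation:
  assumes N: "N > 0" and u: "u \<ge> 2" and uN: "u\<^sup>2 dvd N" and sq: "\<And>g. g\<^sup>2 dvd N \<Longrightarrow> g = u \<or> totient g = 1"
    and p: "prime p" and pN: "coprime p N"
    and gen: "\<And>e. coprime e u \<Longrightarrow> \<exists>k. [p ^ k = e] (mod u)"
    and nonunit: "\<And>e. \<not> coprime e u \<Longrightarrow> \<exists>c. \<forall>b. coprime b u \<longrightarrow> unity_root u b ^ e = c"
    and f: "meromorphic_modular_function k N f" "cuspidal_divisor f"
  shows "\<exists>C (x :: nat \<Rightarrow> real) W. (\<forall>t. weight u (W t)) \<and> (\<forall>t n. \<not> t dvd N div u\<^sup>2 \<longrightarrow> W t n = 0) \<and>
    (\<forall>\<tau>. Im \<tau> > 0 \<longrightarrow> f \<tau> = exp (C + (\<Sum>t | t dvd N. of_real (x t) * log_eta (of_nat t * \<tau>) +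
       weighted_product u (W t) (nome (of_nat t * \<tau>)))))"
proof -
  have u0: "u > 0" using u by simp
  let ?D = "{t. t dvd N}" and ?D' = "{t. t dvd N div u\<^sup>2}"
  have Nu: "N div u\<^sup>2 > 0" using uN N u0 by (simp add: dvd_imp_le div_greater_zero_iff)
  have fD: "finite ?D" and fD': "finite ?D'" using N Nu by simp_all
  have D'D: "u\<^sup>2 * t dvd N" if "t \<in> ?D'" for t
    using that uN by (metis dvd_div_iff_mult dvd_mult_div_cancel mem_Collect_eq mult.commute mult_dvd_mono dvd_refl)
  have "u dvd N" using uN by (rule dvd_trans[rotated]) (simp add: power2_eq_square)
  then have pu: "coprime p u" by (rule coprime_divisors[OF dvd_refl _ pN])
  define E where "E = totatives u - {1}"
  have E: "coprime e u" "0 < e" "e < u" "e \<noteq> 1" if "e \<in> E" for e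
  proof -
    show *: "coprime e u" "0 < e" "e \<noteq> 1" using that by (auto simp: E_def totatives_def)
    have "e \<noteq> u" using * u by auto
    moreover have "e \<le> u" using that by (auto simp: E_def totatives_def)
    ultimately show "e < u" by simp
  qed
  have fE: "finite E" by (simp add: E_def)
  have cE: "card E = totient u - 1" using u by (simp add: E_def totient_def totatives_def)
  let ?w = "\<lambda>e n a. complex_of_real (delta_weight u e (int (a * n)))"
  define J where "J = ?D \<times> {0} \<union> ?D' \<times> E"
  have fJ: "finite J" using fD fD' fE by (simp add: J_def)
  have E0: "0 \<notin> E" using E by auto
  have cJ: "card J = card ?D + (totient u - 1) * card ?D'"
    unfolding J_def using fD fD' fE E0 cE
    by (subst card_Un_disjoint) (auto simp: card_cartesian_product mult.commute)
  obtain Lf rf where Lf: "\<And>\<tau>. Im \<tau> > 0 \<Longrightarrow> f \<tau> = exp (Lf \<tau>)" and af: "admissible N Lf (of_int k / 2) rf"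
    using admissible_modular[OF f] by blast
  \<comment> \<open>The index (0, 0) stands for f, (t, 0) for \<eta>(t \<tau>) and (t, e) with e in
    E for a Siegel product. These do not collide, as 0 is neither a divisor of N nor an element of
    E.\<close>
  define L where "L = (\<lambda>(t, e) \<tau>. if t = 0 then Lf \<tau> else if e = 0 then log_eta (of_nat t * \<tau>) else log_product u (?w e) (nome (of_nat t * \<tau>)))"
  define \<kappa> :: "nat \<times> nat \<Rightarrow> real" where "\<kappa> = (\<lambda>(t, e). if t = 0 then of_int k / 2 else if e = 0 then 1/4 else 0)"
  define J1 where "J1 = insert (0, 0) J"
  have D0: "t > 0" if "t \<in> ?D" for t using that N by (auto intro: Nat.gr0I)
  have D'0: "t > 0" if "t \<in> ?D'" for t using that Nu by (auto intro: Nat.gr0I)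
  have "\<exists>r. admissible N (L j) (\<kappa> j) r" if "j \<in> J1" for j
  proof -
    consider "j = (0, 0)" | t where "j = (t, 0)" "t \<in> ?D" | t e where "j = (t, e)" "t \<in> ?D'" "e \<in> E"
      using \<open>j \<in> J1\<close> by (auto simp: J1_def J_def)
    then show ?thesis
    proof cases
      case 1
      then show ?thesis using af by (auto simp: L_def \<kappa>_def)
    next
      case 2
      then show ?thesis using admissible_eta[of t N] N D0[of t] by (simp add: L_def \<kappa>_def)
    next
      case 3
      have "\<exists>r. admissible N (\<lambda>\<tau>. log_product u (?w e) (nome (of_nat t * \<tau>))) 0 r"
        by (rule admissible_klein[OF u weight_delta[OF u0 E(1)[OF 3(3)]] D'D[OF 3(2)] N])
      then show ?thesis using 3 D'0[OF 3(2)] E0 by (auto simp: L_def \<kappa>_def)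
    qed
  qed
  then obtain r where r: "\<And>j. j \<in> J1 \<Longrightarrow> admissible N (L j) (\<kappa> j) (r j)" by metis
  let ?K = "cusp_label N ` SL2Z"
  have fK: "finite ?K" and "card ?K \<le> card J"
    using card_cusp_labels[OF N] totient_gcd_sum_le[OF N uN sq] unfolding cJ by auto
  moreover have "(0, 0) \<notin> J" using D0 E0 by (auto simp: J_def)
  ultimately have cK: "card ?K < card J1" using fJ by (simp add: J1_def)
  have fJ1: "finite J1" using fJ by (simp add: J1_def)
  \<comment> \<open>One matrix per label turns the vanishing of all orders into finitely many linear
    conditions; \<open>admissible_order_unique\<close> carries them to all of SL2(Z).\<close>
  define rep where "rep = (\<lambda>y. SOME g. g \<in> SL2Z \<and> cusp_label N g = y)"
  have rep: "rep (cusp_label N g) \<in> SL2Z \<and> cusp_label N (rep (cusp_label N g)) = cusp_label N g" if "g \<in> SL2Z" for g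
    unfolding rep_def by (rule someI[of _ g]) (use that in simp)
  obtain x where xnz: "\<exists>j\<in>J1. x j \<noteq> 0" and xrel: "\<And>y. y \<in> ?K \<Longrightarrow> (\<Sum>j\<in>J1. x j * r j (rep y)) = 0"
    using nontrivial_relation[OF fK fJ1 cK, of "\<lambda>j y. r j (rep y)"] by blast
  have "admissible N (\<lambda>\<tau>. \<Sum>j\<in>J1. of_real (x j) * L j \<tau>) (\<Sum>j\<in>J1. x j * \<kappa> j) (\<lambda>g. \<Sum>j\<in>J1. x j * r j g)"
    by (rule admissible_sum[OF fJ1 r])
  then have "admissible N (\<lambda>\<tau>. \<Sum>j\<in>J1. of_real (x j) * L j \<tau>) (\<Sum>j\<in>J1. x j * \<kappa> j) (\<lambda>_. 0)"
  proof (rule admissible_cong)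
    fix g assume g: "g \<in> SL2Z"
    have "r j g = r j (rep (cusp_label N g))" if "j \<in> J1" for j
      using admissible_order_unique[OF r[OF that] N g] rep[OF g] by simp
    then show "(\<Sum>j\<in>J1. x j * r j g) = 0" using xrel[of "cusp_label N g"] g by simp
  qed
  then obtain C where C: "\<And>\<tau>. Im \<tau> > 0 \<Longrightarrow> (\<Sum>j\<in>J1. of_real (x j) * L j \<tau>) = C"
    using admissible_order_zero N by blast
  define W where "W = (\<lambda>t n. \<Sum>e\<in>E. (if t \<in> ?D' then x (t, e) else 0) * delta_weight u e n)"
  have W: "weight u (W t)" for t unfolding W_def by (intro weight_sum weight_delta u0 E)
  have W0: "W t n = 0" if "t \<notin> ?D'" for t n using that by (simp add: W_def)
  have LamW: "weighted_product u (W t) q = (\<Sum>e\<in>E. of_real (if t \<in> ?D' then x (t, e) else 0) * log_product u (?w e) q)"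
    if "norm q < 1" for t q
  proof -
    have "(\<lambda>n a. of_real (W t (int (a * n)))) = (\<lambda>n a. \<Sum>e\<in>E. of_real (if t \<in> ?D' then x (t, e) else 0) * ?w e n a)"
      by (simp only: W_def of_real_sum of_real_mult)
    then show ?thesis using log_product_lincomb[of E ?w q u "\<lambda>e. of_real (if t \<in> ?D' then x (t, e) else 0)"]
        weight_bounded_coeff[OF u0 weight_delta[OF u0 E(1)]] that by simp
  qed
  have sub: "?D' \<subseteq> ?D"
    using D'D by (auto intro: dvd_mult_right)
  have sumJ: "(\<Sum>j\<in>J. of_real (x j) * L j \<tau>) = (\<Sum>t\<in>?D. of_real (x (t, 0)) * log_eta (of_nat t * \<tau>) +
       weighted_product u (W t) (nome (of_nat t * \<tau>)))" if \<tau>: "Im \<tau> > 0" for \<tau>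
  proof -
    have "(\<Sum>j\<in>J. of_real (x j) * L j \<tau>) = (\<Sum>j\<in>?D \<times> {0}. of_real (x j) * L j \<tau>) + (\<Sum>j\<in>?D' \<times> E. of_real (x j) * L j \<tau>)"
      unfolding J_def by (rule sum.union_disjoint) (use fD fD' fE E0 in auto)
    also have "(\<Sum>j\<in>?D \<times> {0}. of_real (x j) * L j \<tau>) = (\<Sum>t\<in>?D. of_real (x (t, 0)) * log_eta (of_nat t * \<tau>))"
      by (rule sum.reindex_bij_witness[of _ "\<lambda>t. (t, 0)" fst]) (use N in \<open>auto simp: L_def\<close>)
    also have "(\<Sum>j\<in>?D' \<times> E. of_real (x j) * L j \<tau>) = (\<Sum>t\<in>?D'. \<Sum>e\<in>E. of_real (x (t, e)) * log_product u (?w e) (nome (of_nat t * \<tau>)))"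
      unfolding sum.cartesian_product
      by (rule sum.cong) (use Nu E0 in \<open>auto simp: L_def\<close>)
    also have "\<dots> = (\<Sum>t\<in>?D'. weighted_product u (W t) (nome (of_nat t * \<tau>)))"
    proof (rule sum.cong)
      fix t assume t: "t \<in> ?D'"
      have "norm (nome (of_nat t * \<tau>)) < 1" using D'0[OF t] \<tau> by (intro norm_nome_less_1) simp
      from LamW[OF this, of t] t show "(\<Sum>e\<in>E. of_real (x (t, e)) * log_product u (?w e) (nome (of_nat t * \<tau>))) = weighted_product u (W t) (nome (of_nat t * \<tau>))"
        by simp
    qed simp
    also have "\<dots> = (\<Sum>t\<in>?D. weighted_product u (W t) (nome (of_nat t * \<tau>)))"
      by (rule sum.mono_neutral_left[OF fD sub]) (simp add: W0 log_product_def)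
    finally show ?thesis by (simp add: sum.distrib)
  qed
  have sumJ1: "of_real (x (0, 0)) * Lf \<tau> + (\<Sum>j\<in>J. of_real (x j) * L j \<tau>) = C" if "Im \<tau> > 0" for \<tau>
    using C[OF that] \<open>(0, 0) \<notin> J\<close> fJ by (simp add: J1_def L_def)
  \<comment> \<open>With exponent 0 at f, independence would kill every x (t, 0) and every W t;
    evaluating W t at e gives x (t, e), so the relation would be trivial.\<close>
  have xf: "x (0, 0) \<noteq> 0"
  proof
    assume x0: "x (0, 0) = 0"
    have "(\<Sum>t\<in>?D. of_real (x (t, 0)) * log_eta (of_nat t * \<tau>) +
       weighted_product u (W t) (nome (of_nat t * \<tau>))) = C" if "Im \<tau> > 0" for \<tau>
      using sumJ1[OF that] x0 sumJ[OF that] by simp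
    from quotient_independence[OF N u W p pN gen pu nonunit this]
    have ind: "x (t, 0) = 0 \<and> (\<forall>n. W t n = 0)" if "t dvd N" for t using that by blast
    have "x j = 0" if j: "j \<in> J1" for j
    proof -
      consider "j = (0, 0)" | t where "j = (t, 0)" "t \<in> ?D" | t e where "j = (t, e)" "t \<in> ?D'" "e \<in> E"
        using j by (auto simp: J1_def J_def)
      then show ?thesis
      proof cases
        case 3
        have "delta_weight u e' (int e) = (if e' = e then 1 else 0)" if "e' \<in> E" for e'
        proof -
          have "[int e = int e'] (mod int u) \<longleftrightarrow> e' = e" "\<not> [int e = 1] (mod int u)"
            using E[OF that] E[OF 3(3)] u by (auto simp: cong_def)
          then show ?thesis by (simp add: delta_weight_def)
        qed
        then have "W t (int e) = (\<Sum>e'\<in>E. if e' = e then x (t, e) else 0)"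
          unfolding W_def using 3 by (intro sum.cong) auto
        also have "\<dots> = x (t, e)" using fE 3 by simp
        finally show ?thesis using ind[of t] 3 sub by auto
      qed (use x0 ind in auto)
    qed
    then show False using xnz by blast
  qed
  define y where "y = (\<lambda>t. - x (t, 0) / x (0, 0))"
  \<comment> \<open>The scalar multiple is written as a sum over one index so that
    \<open>weight_sum\<close> and \<open>log_product_lincomb\<close> apply.\<close>
  define W' where "W' = (\<lambda>t n. \<Sum>i\<in>{0::nat}. (- 1 / x (0, 0)) * W t n)"
  have W': "weight u (W' t)" for t unfolding W'_def by (rule weight_sum) (rule W)
  have "f \<tau> = exp (of_real (1 / x (0, 0)) * C + (\<Sum>t\<in>?D. of_real (y t) * log_eta (of_nat t * \<tau>) +
       weighted_product u (W' t) (nome (of_nat t * \<tau>))))" if \<tau>: "Im \<tau> > 0" for \<tau>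
  proof -
    have l: "weighted_product u (W' t) (nome (of_nat t * \<tau>)) = of_real (- 1 / x (0, 0)) * weighted_product u (W t) (nome (of_nat t * \<tau>))"
      if t: "t \<in> ?D" for t
    proof -
      have "norm (nome (of_nat t * \<tau>)) < 1" using D0[OF t] \<tau> by (intro norm_nome_less_1) simp
      then show ?thesis
        using log_product_lincomb[of "{0::nat}" "\<lambda>_ n a. of_real (W t (int (a * n)))" "nome (of_nat t * \<tau>)" u "\<lambda>_. of_real (- 1 / x (0, 0))"]
          weight_bounded_coeff[OF u0 W] by (simp add: W'_def)
    qed
    have "(\<Sum>t\<in>?D. of_real (y t) * log_eta (of_nat t * \<tau>) + weighted_product u (W' t) (nome (of_nat t * \<tau>))) =
       of_real (- 1 / x (0, 0)) * (\<Sum>j\<in>J. of_real (x j) * L j \<tau>)"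
      unfolding sumJ[OF \<tau>] sum_distrib_left
      by (intro sum.cong refl) (simp add: l y_def distrib_left del: of_nat_mult)
    also have "\<dots> = of_real (- 1 / x (0, 0)) * (C - of_real (x (0, 0)) * Lf \<tau>)"
      using sumJ1[OF \<tau>] by (simp add: eq_diff_eq add.commute)
    finally have "of_real (1 / x (0, 0)) * C + (\<Sum>t\<in>?D. of_real (y t) * log_eta (of_nat t * \<tau>) +
       weighted_product u (W' t) (nome (of_nat t * \<tau>))) = Lf \<tau>"
      using xf by (simp add: field_simps)
    then show ?thesis using Lf[OF \<tau>] by simp
  qed
  moreover have "W' t n = 0" if "\<not> t dvd N div u\<^sup>2" for t n using that W0 by (simp add: W'_def)
  ultimately show ?thesis using W' by blast
qed

section \<open>Characters of small modulus\<close>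

text \<open>\<open>span\<close> converts each real weight into a complex combination of conjugate
  characters, and its coefficients become the exponents. The explicit logarithms are the branches
  prescribed by \<open>log_branch\<close>, so the complex powers are the exponentials of their
  multiples. Index 0 of the list is \<eta>, index i + 1 the i-th character.\<close>

lemma quotient_from_representation:
  fixes chs :: "(int \<Rightarrow> complex) list" and x :: "nat \<Rightarrow> real"
  assumes N: "N > 0" and u: "u > 0" and W: "\<And>t. weight u (W t)" and W0: "\<And>t n. \<not> t dvd N div u\<^sup>2 \<Longrightarrow> W t n = 0"
    and per: "\<And>chi n. chi \<in> set chs \<Longrightarrow> chi (n + int u) = chi n"
    and span: "\<And>w. weight u w \<Longrightarrow> \<exists>\<alpha>. \<forall>n. of_real (w n) = (\<Sum>i<length chs. \<alpha> i * cnj ((chs ! i) n))"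
    and f: "\<And>\<tau>. Im \<tau> > 0 \<Longrightarrow> f \<tau> = exp (C + (\<Sum>t | t dvd N. of_real (x t) * log_eta (of_nat t * \<tau>) +
       weighted_product u (W t) (nome (of_nat t * \<tau>))))"
  shows "is_quotient_of_level (dedekind_eta # map (eta_character u) chs) N f"
proof -
  let ?k = "length chs"
  let ?c = "\<lambda>i n a. cnj ((chs ! i) (int (a * n)))"
  have bc: "bounded_coeff (?c i)" if "i < ?k" for i
    using periodic_bounded_coeff[of u "\<lambda>n. cnj ((chs ! i) n)"] u per that by simp
  obtain \<alpha> where \<alpha>: "\<And>t n. of_real (W t n) = (\<Sum>i<?k. \<alpha> t i * cnj ((chs ! i) n))"
    using span[OF W] by metis
  define a where "a = (\<lambda>t i. case i of 0 \<Rightarrow> of_real (x t) | Suc i \<Rightarrow> \<alpha> t i)"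
  define L where "L = (\<lambda>t i \<tau>. case i of 0 \<Rightarrow> log_eta (of_nat t * \<tau>) | Suc i \<Rightarrow> log_product u (?c i) (nome (of_nat t * \<tau>)))"
  define P where "P = (\<lambda>t i \<tau>. exp (a t i * L t i \<tau>))"
  let ?fs = "dedekind_eta # map (eta_character u) chs"
  have pos: "t > 0" if "t dvd N" for t using that N by (auto intro: Nat.gr0I)
  have "is_complex_power (V_op t (?fs ! i)) (a t i) (P t i)" if t: "t dvd N" and i: "i < length ?fs" for t i
  proof -
    have t0: "t > 0" using pos[OF t] .
    have It: "Im (of_nat t * \<tau>) > 0" if "Im \<tau> > 0" for \<tau> using t0 that by simp
    have "log_branch (V_op t (?fs ! i)) (L t i)"
    proof (cases i)
      case 0
      show ?thesis
      proof (rule log_branch_intro[OF bounded_coeff_1 t0])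
        show "L t i \<tau> = \<i> * of_real (2 * pi * real t / 24) * \<tau> + log_product 1 (\<lambda>_ _. 1) (nome (of_nat t * \<tau>))" if "Im \<tau> > 0" for \<tau>
          by (simp add: L_def 0 log_eta_def)
        show "V_op t (?fs ! i) \<tau> = exp (L t i \<tau>)" if "Im \<tau> > 0" for \<tau>
          using dedekind_eta_exp[OF It[OF that]] by (simp add: L_def 0 V_op_def)
      qed
    next
      case (Suc j)
      have j: "j < ?k" using i Suc by simp
      show ?thesis
      proof (rule log_branch_intro[OF bc[OF j] t0])
        show "L t i \<tau> = \<i> * of_real 0 * \<tau> + log_product u (?c j) (nome (of_nat t * \<tau>))" if "Im \<tau> > 0" for \<tau>
          by (simp add: L_def Suc)
        show "V_op t (?fs ! i) \<tau> = exp (L t i \<tau>)" if "Im \<tau> > 0" for \<tau>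
          using eta_character_exp[OF bc[OF j] It[OF that], of u] j by (simp add: L_def Suc V_op_def)
      qed
    qed
    then show ?thesis unfolding is_complex_power_def P_def by blast
  qed
  moreover have "f \<tau> = exp C * (\<Prod>t | t dvd N. \<Prod>i<length ?fs. P t i \<tau>)" if "\<tau> \<in> upper_half_plane" for \<tau>
  proof -
    have \<tau>: "Im \<tau> > 0" using that by (simp add: upper_half_plane_def)
    have pr: "(\<Prod>i<length ?fs. P t i \<tau>) = exp (of_real (x t) * log_eta (of_nat t * \<tau>) + weighted_product u (W t) (nome (of_nat t * \<tau>)))"
      if t: "t dvd N" for t
    proof -
      have "norm (nome (of_nat t * \<tau>)) < 1" using pos[OF t] \<tau> by (intro norm_nome_less_1) simp
      then have "weighted_product u (W t) (nome (of_nat t * \<tau>)) = (\<Sum>i<?k. \<alpha> t i * log_product u (?c i) (nome (of_nat t * \<tau>)))"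
        unfolding \<alpha> using log_product_lincomb[of "{..<?k}" ?c "nome (of_nat t * \<tau>)" u "\<alpha> t"] bc by simp
      moreover have "(\<Prod>i<length ?fs. P t i \<tau>) = P t 0 \<tau> * (\<Prod>i<?k. P t (Suc i) \<tau>)"
      proof -
        have "length ?fs = Suc ?k" by simp
        then show ?thesis by (simp only: prod.lessThan_Suc_shift)
      qed
      ultimately show ?thesis by (simp add: P_def a_def L_def exp_add exp_sum)
    qed
    have "(\<Prod>t | t dvd N. \<Prod>i<length ?fs. P t i \<tau>) = (\<Prod>t | t dvd N. exp (of_real (x t) * log_eta (of_nat t * \<tau>) + weighted_product u (W t) (nome (of_nat t * \<tau>))))"
      by (intro prod.cong refl pr) simp
    then show ?thesis using N unfolding f[OF \<tau>] exp_add[of C] by (simp only:) (simp add: exp_sum)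
  qed
  ultimately show ?thesis unfolding is_quotient_of_level_def by blast
qed

text \<open>The square of a prime s \<noteq> r dividing g would divide M. So g is a power of r, and
  M contributes no factor r.\<close>

lemma square_dvd_prime_power_times_squarefree:
  fixes r e M g :: nat
  assumes r: "prime r" and M: "squarefree M" "coprime M r" and g: "g\<^sup>2 dvd r ^ e * M"
  shows "\<exists>k. g = r ^ k \<and> 2 * k \<le> e"
proof -
  have M0: "M > 0" using M(1) by (metis gr0I not_squarefree_0)
  have r0: "r > 1" using r by (rule prime_gt_1_nat)
  have g0: "g \<noteq> 0"
  proof
    assume "g = 0"
    then have "r ^ e * M = 0" using g by simp
    then show False using M0 r0 by simp
  qed
  obtain y where y: "g = r ^ multiplicity r g * y" "\<not> r dvd y"
    using multiplicity_decompose'[of g r] g0 r0 by auto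
  define k where "k = multiplicity r g"
  have "y = 1"
  proof (rule ccontr)
    assume "y \<noteq> 1"
    then obtain s where s: "prime s" "s dvd y" using prime_factor_nat by blast
    have "s\<^sup>2 dvd g\<^sup>2" using s y(1) by (metis dvd_mult dvd_power_same)
    then have "s\<^sup>2 dvd r ^ e * M" using g by (rule dvd_trans)
    moreover have "s \<noteq> r" using s y(2) by auto
    then have "coprime (s\<^sup>2) (r ^ e)" using s r by (simp add: primes_coprime)
    ultimately have "s\<^sup>2 dvd M" by (simp add: coprime_dvd_mult_right_iff)
    then show False using M(1) s(1) by (metis not_prime_unit squarefree_def)
  qed
  then have gk: "g = r ^ k" using y by (simp add: k_def)
  have "r ^ (2 * k) dvd r ^ e * M" using g unfolding gk by (simp add: power_mult[symmetric] mult.commute)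
  moreover have "coprime (r ^ (2 * k)) M" using M(2) by (simp add: coprime_commute)
  ultimately have "r ^ (2 * k) dvd r ^ e" by (simp add: coprime_dvd_mult_left_iff)
  then have "2 * k \<le> e" using r0 by (simp add: power_dvd_imp_le)
  then show ?thesis using gk by blast
qed

lemma multiplicative_induct:
  fixes n :: nat
  assumes "n > 0" "S 1" "\<And>a b. S a \<Longrightarrow> S b \<Longrightarrow> S (a * b)" "\<And>p. prime p \<Longrightarrow> p dvd n \<Longrightarrow> S p"
  shows "S n"
  using assms(1,4)
proof (induction n rule: less_induct)
  case (less n)
  show ?case
  proof (cases "n = 1")
    case False
    then obtain p where p: "prime p" "p dvd n" using prime_factor_nat by blast
    obtain m where m: "n = p * m" using p by auto
    have p1: "p > 1" using p(1) by (rule prime_gt_1_nat)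
    have "m > 0" using less m by auto
    moreover from this have "m < n" using m p1 by simp
    ultimately have "S m" using less m by auto
    then show ?thesis unfolding m using less p by (intro assms(3)) auto
  qed (use assms(2) in simp)
qed

text \<open>A substitute for Dirichlet's theorem on primes in progressions. The Chinese remainder
  theorem gives n in the class c modulo u and congruent to 1 modulo M; a set that contains 1, is
  closed under products and misses n must miss a prime factor of n. In the applications S is the
  subgroup of classes that a generator has to avoid.\<close>

lemma exists_prime_outside:
  fixes M u c :: nat
  assumes "coprime M u" "coprime c u" "u > 1" "S 1" "\<And>a b. S a \<Longrightarrow> S b \<Longrightarrow> S (a * b)"
    and c: "\<And>n. [n = c] (mod u) \<Longrightarrow> \<not> S n"
  shows "\<exists>p. prime p \<and> coprime p M \<and> coprime p u \<and> \<not> S p"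
proof -
  obtain n where n: "[n = c] (mod u)" "[n = 1] (mod M)"
    using binary_chinese_remainder_nat[of u M c 1] assms(1) by (auto simp: coprime_commute)
  have cu: "coprime n u" using n(1) assms(2) by (metis cong_imp_coprime cong_sym)
  have cM: "coprime n M" using n(2) by (metis cong_imp_coprime cong_sym coprime_1_left)
  have "n > 0" using cu assms(3) by (auto intro: Nat.gr0I)
  then obtain p where p: "prime p" "p dvd n" "\<not> S p"
    using multiplicative_induct[of n S] assms(4,5) c[OF n(1)] by blast
  have "coprime p u" "coprime p M" using p(2) cu cM by (metis coprime_divisors dvd_refl)+
  then show ?thesis using p by blast
qed

section \<open>Values of the Legendre symbols and characters modulo 3, 4 and 5, and their
  span\<close>

lemma legendre_cong: "[m = n] (mod int p) \<Longrightarrow> legendre_character p m = legendre_character p n"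
proof -
  assume mn: "[m = n] (mod int p)"
  have "[m = 0] (mod int p) \<longleftrightarrow> [n = 0] (mod int p)" using mn by (metis cong_sym cong_trans)
  moreover have "QuadRes (int p) m \<longleftrightarrow> QuadRes (int p) n" using mn unfolding QuadRes_def by (metis cong_sym cong_trans)
  ultimately show ?thesis by (simp add: legendre_character_def Legendre_def)
qed

lemma legendre_period: "legendre_character p (n + int p) = legendre_character p n"
  by (rule legendre_cong) (simp add: cong_def)

lemma legendre_3: "legendre_character 3 0 = 0" "legendre_character 3 1 = 1" "legendre_character 3 2 = -1"
proof -
  have "\<not> QuadRes 3 2"
  proof
    assume "QuadRes 3 2"
    then obtain y :: int where "y\<^sup>2 mod 3 = 2" by (auto simp: QuadRes_def cong_def)
    moreover have "y mod 3 = 0 \<or> y mod 3 = 1 \<or> y mod 3 = 2" by presburger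
    then have "y\<^sup>2 mod 3 = 0 \<or> y\<^sup>2 mod 3 = 1" by (auto simp: power2_eq_square mod_mult_eq[of y 3 y, symmetric])
    ultimately show False by auto
  qed
  moreover have "QuadRes 3 1" unfolding QuadRes_def by (rule exI[of _ 1]) simp
  ultimately show "legendre_character 3 0 = 0" "legendre_character 3 1 = 1" "legendre_character 3 2 = -1"
    by (simp_all add: legendre_character_def Legendre_def cong_def)
qed

lemma legendre_5: "legendre_character 5 0 = 0" "legendre_character 5 1 = 1" "legendre_character 5 2 = -1"
  "legendre_character 5 3 = -1" "legendre_character 5 4 = 1"
proof -
  have sq: "y\<^sup>2 mod 5 = 0 \<or> y\<^sup>2 mod 5 = 1 \<or> y\<^sup>2 mod 5 = 4" for y :: int
  proof -
    have "y mod 5 = 0 \<or> y mod 5 = 1 \<or> y mod 5 = 2 \<or> y mod 5 = 3 \<or> y mod 5 = 4" by presburger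
    then show ?thesis by (auto simp: power2_eq_square mod_mult_eq[of y 5 y, symmetric])
  qed
  have "\<not> QuadRes 5 2" "\<not> QuadRes 5 3"
  proof -
    show "\<not> QuadRes 5 2"
    proof
      assume "QuadRes 5 2"
      then obtain y :: int where "y\<^sup>2 mod 5 = 2" by (auto simp: QuadRes_def cong_def)
      then show False using sq[of y] by simp
    qed
    show "\<not> QuadRes 5 3"
    proof
      assume "QuadRes 5 3"
      then obtain y :: int where "y\<^sup>2 mod 5 = 3" by (auto simp: QuadRes_def cong_def)
      then show False using sq[of y] by simp
    qed
  qed
  moreover have "QuadRes 5 1" unfolding QuadRes_def by (rule exI[of _ 1]) simp
  moreover have "QuadRes 5 4" unfolding QuadRes_def by (rule exI[of _ 2]) simp
  ultimately show "legendre_character 5 0 = 0" "legendre_character 5 1 = 1" "legendre_character 5 2 = -1"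
      "legendre_character 5 3 = -1" "legendre_character 5 4 = 1"
    by (simp_all add: legendre_character_def Legendre_def cong_def)
qed

lemma mod_residues:
  fixes n :: int
  shows "n mod 3 \<in> {0, 1, 2}" "n mod 4 \<in> {0, 1, 2, 3}" "n mod 5 \<in> {0, 1, 2, 3, 4}"
  by (simp_all, presburger+)

text \<open>A weight modulo 3 is determined by w(1), since w(0) = 0 and w(2) = -w(1).\<close>

lemma span_3:
  assumes w: "weight 3 w"
  shows "\<exists>\<alpha>. \<forall>n. of_real (w n) = (\<Sum>i<length [legendre_character 3]. \<alpha> i * cnj (([legendre_character 3] ! i) n))"
proof (rule exI[of _ "\<lambda>_. of_real (w 1)"], rule allI)
  fix n
  have "w 0 = 0" using w by (simp add: weight_def)
  moreover have "(\<Sum>a=0..<int 3. w a) = 0" using w unfolding weight_def by blast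
  moreover have "{0..<int 3} = {0, 1, 2}" by auto
  ultimately have "w 0 = 0" "w 0 + w 1 + w 2 = 0" by (simp_all add: add.assoc)
  moreover have "w n = w (n mod 3)" by (rule weight_cong[OF w]) (simp add: cong_def)
  moreover have "legendre_character 3 n = legendre_character 3 (n mod 3)" by (rule legendre_cong) (simp add: cong_def)
  ultimately have "of_real (w n) = of_real (w 1) * cnj (legendre_character 3 n)"
    using mod_residues(1)[of n] by (auto simp: legendre_3 eq_neg_iff_add_eq_0 simp flip: of_real_minus of_real_add)
  then show "of_real (w n) = (\<Sum>i<length [legendre_character 3]. of_real (w 1) * cnj (([legendre_character 3] ! i) n))"
    by simp
qed

lemma dirichlet_cong:
  assumes "dirichlet_character m chi" "[a = b] (mod int m)" shows "chi a = chi b"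
  using periodic_cong[of chi m a b] assms by (simp add: dirichlet_character_def)

lemma dirichlet_one: "dirichlet_character m chi \<Longrightarrow> chi 1 = 1"
proof -
  assume d: "dirichlet_character m chi"
  then have "chi (1 * 1) = chi 1 * chi 1" unfolding dirichlet_character_def by blast
  moreover have "chi 1 \<noteq> 0" using d by (simp add: dirichlet_character_def)
  ultimately show ?thesis by simp
qed

lemma dirichlet_mult: "dirichlet_character m chi \<Longrightarrow> chi (a * b) = chi a * chi b"
  by (simp add: dirichlet_character_def)

text \<open>\<psi>(3)^2 = \<psi>(9) = 1 leaves only a sign, and the positive one would give the
  principal character.\<close>

lemma character_4_values:
  assumes d: "dirichlet_character 4 \<psi>" and np: "\<psi> \<noteq> principal_character 4"
  shows "\<psi> 0 = 0" "\<psi> 1 = 1" "\<psi> 2 = 0" "\<psi> 3 = -1"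
proof -
  show 1: "\<psi> 1 = 1" by (rule dirichlet_one[OF d])
  have c2: "\<not> coprime (2::int) 4" by (simp add: coprime_iff_gcd_eq_1)

  have "\<psi> 0 \<noteq> 0 \<longleftrightarrow> coprime 0 (int 4)" using d unfolding dirichlet_character_def by blast
  then show 0: "\<psi> 0 = 0" by simp
  have "\<psi> 2 \<noteq> 0 \<longleftrightarrow> coprime 2 (int 4)" using d unfolding dirichlet_character_def by blast
  then show 2: "\<psi> 2 = 0" using c2 by simp
  have "\<psi> 3 * \<psi> 3 = \<psi> (3 * 3)" by (rule dirichlet_mult[OF d, symmetric])
  also have "\<dots> = \<psi> 1" by (rule dirichlet_cong[OF d]) (simp add: cong_def)
  finally have "\<psi> 3 * \<psi> 3 = 1" using 1 by simp
  then have "\<psi> 3 = 1 \<or> \<psi> 3 = -1" by (simp add: square_eq_1_iff)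
  moreover have "\<psi> 3 \<noteq> 1"
  proof
    assume 3: "\<psi> 3 = 1"
    have "\<psi> n = principal_character 4 n" for n
    proof -
      have "\<psi> n = \<psi> (n mod 4)" by (rule dirichlet_cong[OF d]) (simp add: cong_def)
      moreover have "\<psi> n \<noteq> 0 \<longleftrightarrow> coprime n (int 4)" using d unfolding dirichlet_character_def by blast
      ultimately show ?thesis using mod_residues(2)[of n] 0 1 2 3 by (auto simp: principal_character_def)
    qed
    then show False using np by auto
  qed
  ultimately show "\<psi> 3 = -1" by simp
qed

lemma span_4:
  assumes d: "dirichlet_character 4 \<psi>" and np: "\<psi> \<noteq> principal_character 4" and w: "weight 4 w"
  shows "\<exists>\<alpha>. \<forall>n. of_real (w n) = (\<Sum>i<length [\<psi>]. \<alpha> i * cnj (([\<psi>] ! i) n))"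
proof (rule exI[of _ "\<lambda>_. of_real (w 1)"], rule allI)
  fix n
  have "\<not> coprime (2::int) 4" by (simp add: coprime_iff_gcd_eq_1)
  then have w02: "w 0 = 0" "w 2 = 0" using w by (simp_all add: weight_def)
  have "(\<Sum>a=0..<int 4. w a) = 0" using w unfolding weight_def by blast
  moreover have "{0..<int 4} = {0, 1, 2, 3}" by auto
  ultimately have "w 0 + w 1 + w 2 + w 3 = 0" by (simp add: add.assoc)
  moreover have "w n = w (n mod 4)" by (rule weight_cong[OF w]) (simp add: cong_def)
  moreover have "\<psi> n = \<psi> (n mod 4)" by (rule dirichlet_cong[OF d]) (simp add: cong_def)
  ultimately have "of_real (w n) = of_real (w 1) * cnj (\<psi> n)"
    using mod_residues(2)[of n] w02 by (auto simp: character_4_values[OF d np] eq_neg_iff_add_eq_0 simp flip: of_real_minus of_real_add)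
  then show "of_real (w n) = (\<Sum>i<length [\<psi>]. of_real (w 1) * cnj (([\<psi>] ! i) n))"
    by simp
qed

text \<open>2 generates the units modulo 5, so z = chi(2) determines the character and z^4 = 1. The
  value 1 gives conductor 1 and the value -1 the Legendre symbol, which leaves z^2 = -1.\<close>

lemma character_5_values:
  assumes pr: "primitive_character 5 chi" and nl: "chi \<noteq> legendre_character 5"
  shows "chi 0 = 0" "chi 1 = 1" "chi 3 = - chi 2" "chi 4 = -1" "(chi 2)\<^sup>2 = -1"
proof -
  have d: "dirichlet_character 5 chi" using pr by (simp add: primitive_character_def)
  define z where "z = chi 2"
  show 1: "chi 1 = 1" by (rule dirichlet_one[OF d])
  have "chi 0 \<noteq> 0 \<longleftrightarrow> coprime 0 (int 5)" using d unfolding dirichlet_character_def by blast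
  then show 0: "chi 0 = 0" by simp
  have 4: "chi 4 = z * z" using dirichlet_mult[OF d, of 2 2] by (simp add: z_def)
  have "chi 3 = chi (2 * 4)" by (rule dirichlet_cong[OF d]) (simp add: cong_def)
  then have 3: "chi 3 = z * (z * z)" using dirichlet_mult[OF d, of 2 4] 4 by (simp add: z_def)
  have "chi (4 * 4) = chi 1" by (rule dirichlet_cong[OF d]) (simp add: cong_def)
  then have z4: "(z * z) * (z * z) = 1" using dirichlet_mult[OF d, of 4 4] 4 1 by simp
  have res: "chi n = chi (n mod 5)" for n by (rule dirichlet_cong[OF d]) (simp add: cong_def)
  have "z * z \<noteq> 1"
  proof
    assume "z * z = 1"
    then consider "z = 1" | "z = -1" by (auto simp: square_eq_1_iff)
    then show False
    proof cases
      case 1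
      have "chi a = 1" if "coprime a (int 5)" for a
      proof -
        have "a mod 5 \<noteq> 0" using that by auto
        then show ?thesis using mod_residues(3)[of a] res[of a] \<open>chi 1 = 1\<close> 3 4 1 by (auto simp: z_def)
      qed
      then have "conductor 5 chi \<le> 1" unfolding conductor_def by (intro Least_le) auto
      then show False using pr by (simp add: primitive_character_def)
    next
      case 2
      have "chi n = legendre_character 5 n" for n
      proof -
        have "legendre_character 5 n = legendre_character 5 (n mod 5)" by (rule legendre_cong) (simp add: cong_def)
        then show ?thesis using mod_residues(3)[of n] res[of n] 0 1 3 4 2 by (auto simp: legendre_5 z_def)
      qed
      then show False using nl by auto
    qed
  qed
  then have zz: "z * z = -1" using z4 by (simp add: square_eq_1_iff)
  then show "chi 3 = - chi 2" "chi 4 = -1" "(chi 2)\<^sup>2 = -1" using 3 4 by (simp_all add: z_def power2_eq_square)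
qed

text \<open>The even part of a weight has sum 0 and is a multiple of the Legendre symbol. The odd
  part has two degrees of freedom and is spanned by the two odd characters, which are told apart by
  the opposite values at 2.\<close>

lemma span_5:
  assumes p1: "primitive_character 5 chi1" "chi1 \<noteq> legendre_character 5"
    and p2: "primitive_character 5 chi2" "chi2 \<noteq> legendre_character 5" and ne: "chi1 \<noteq> chi2" and w: "weight 5 w"
  shows "\<exists>\<alpha>. \<forall>n. of_real (w n) = (\<Sum>i<length [legendre_character 5, chi1, chi2]. \<alpha> i * cnj (([legendre_character 5, chi1, chi2] ! i) n))"
proof -
  have d1: "dirichlet_character 5 chi1" and d2: "dirichlet_character 5 chi2" using p1 p2 by (simp_all add: primitive_character_def)
  note v1 = character_5_values[OF p1] and v2 = character_5_values[OF p2]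
  have r1: "chi1 n = chi1 (n mod 5)" for n by (rule dirichlet_cong[OF d1]) (simp add: cong_def)
  have r2: "chi2 n = chi2 (n mod 5)" for n by (rule dirichlet_cong[OF d2]) (simp add: cong_def)
  have rl: "legendre_character 5 n = legendre_character 5 (n mod 5)" for n by (rule legendre_cong) (simp add: cong_def)
  have rw: "w n = w (n mod 5)" for n by (rule weight_cong[OF w]) (simp add: cong_def)
  have "chi1 2 \<noteq> chi2 2"
  proof
    assume e: "chi1 2 = chi2 2"
    have "chi1 n = chi2 n" for n using mod_residues(3)[of n] r1[of n] r2[of n] v1 v2 e by auto
    then show False using ne by auto
  qed
  moreover have "(chi1 2)\<^sup>2 = (chi2 2)\<^sup>2" using v1(5) v2(5) by simp
  ultimately have opp: "chi2 2 = - chi1 2" by (auto simp: power2_eq_iff)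
  define v where "v = cnj (chi1 2)"
  have vv: "v * v = -1"
  proof -
    have "v * v = cnj ((chi1 2)\<^sup>2)" by (simp add: v_def power2_eq_square)
    then show ?thesis by (simp add: v1(5))
  qed
  \<comment> \<open>\<open>a0\<close> is the even part at 1 and \<open>b\<close> the odd part at 1.
    Matching the values at 1 and 2 demands a1 + a2 = b and v (a1 - a2) = (w 2 - w 3) / 2, and c is
    the solution a1 - a2 of the latter, as v^2 = -1.\<close>
  define a0 where "a0 = (of_real (w 1) + of_real (w 4)) / (2 :: complex)"
  define b where "b = (of_real (w 1) - of_real (w 4)) / (2 :: complex)"
  define c where "c = - v * (of_real (w 2) - of_real (w 3)) / (2 :: complex)"
  define a1 where "a1 = (b + c) / 2"
  define a2 where "a2 = (b - c) / 2"
  have w0: "w 0 = 0" using w by (simp add: weight_def)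
  have "(\<Sum>a=0..<int 5. w a) = 0" using w unfolding weight_def by blast
  moreover have "{0..<int 5} = {0, 1, 2, 3, 4}" by auto
  ultimately have ws: "w 1 + w 2 + w 3 + w 4 = 0" using w0 by (simp add: add.assoc)
  have wc: "complex_of_real (w 2) + of_real (w 3) = - (of_real (w 1) + of_real (w 4))"
    using ws by (simp add: eq_neg_iff_add_eq_0 add_ac flip: of_real_add)
  have vc: "v * c = (of_real (w 2) - of_real (w 3)) / 2"
  proof -
    have "v * c = - (v * v) * (of_real (w 2) - of_real (w 3)) / 2" by (simp add: c_def)
    then show ?thesis unfolding vv by simp
  qed
  have e1: "of_real (w 1) = a0 + a1 + a2" and e4: "of_real (w 4) = a0 - a1 - a2"
    by (simp_all add: a0_def a1_def a2_def b_def field_simps)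
  have va: "v * a1 - v * a2 = v * c" by (simp add: a1_def a2_def field_simps)
  have e2: "of_real (w 2) = - a0 + (v * a1 - v * a2)" and e3: "of_real (w 3) = - a0 - (v * a1 - v * a2)"
  proof -
    have na: "- a0 = (of_real (w 2) + of_real (w 3)) / 2" unfolding a0_def wc by (simp only: minus_divide_left)
    show "of_real (w 2) = - a0 + (v * a1 - v * a2)" "of_real (w 3) = - a0 - (v * a1 - v * a2)"
      unfolding va vc na by (simp_all add: field_simps)
  qed
  define \<alpha> where "\<alpha> = (\<lambda>i::nat. if i = 0 then a0 else if i = 1 then a1 else a2)"
  have "of_real (w n) = a0 * cnj (legendre_character 5 n) + a1 * cnj (chi1 n) + a2 * cnj (chi2 n)" for n
  proof -
    consider "n mod 5 = 0" | "n mod 5 = 1" | "n mod 5 = 2" | "n mod 5 = 3" | "n mod 5 = 4" using mod_residues(3)[of n] by auto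
    then show ?thesis
    proof cases
      case 1 then show ?thesis using rw[of n] r1[of n] r2[of n] rl[of n] w0 v1 v2 legendre_5 by simp
    next
      case 2 then show ?thesis using rw[of n] r1[of n] r2[of n] rl[of n] v1 v2 legendre_5 e1 by simp
    next
      case 3 then show ?thesis using rw[of n] r1[of n] r2[of n] rl[of n] legendre_5 e2 opp by (simp add: v_def mult.commute)
    next
      case 4 then show ?thesis using rw[of n] r1[of n] r2[of n] rl[of n] v1 v2 legendre_5 e3 opp by (simp add: v_def mult.commute)
    next
      case 5 then show ?thesis using rw[of n] r1[of n] r2[of n] rl[of n] v1 v2 legendre_5 e4 by simp
    qed
  qed
  then have "\<forall>n. of_real (w n) = (\<Sum>i<length [legendre_character 5, chi1, chi2]. \<alpha> i * cnj (([legendre_character 5, chi1, chi2] ! i) n))"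
    by (simp add: \<alpha>_def numeral_2_eq_2 numeral_3_eq_3 lessThan_Suc add_ac)
  then show ?thesis by blast
qed

lemma coprime_not_dvd: "coprime e u \<Longrightarrow> u > 1 \<Longrightarrow> \<not> u dvd e" for e u :: nat
  by (auto simp: coprime_absorb_right)

text \<open>The bounds 2 d \<le> e \<le> 2 d + 1 ensure that u^2 divides N and that every g with g^2
  | N is r^k with k \<le> d, so \<open>tot\<close> settles all cases other than g = u. The pair c, S
  certifies that some prime outside the divisors of N generates the units modulo u.\<close>

theorem quotient_of_level_prime_power:
  fixes r d e M N u c :: nat and S :: "nat \<Rightarrow> bool"
  assumes r: "prime r" and d: "d > 0" and e: "2 * d \<le> e" "e \<le> 2 * d + 1" and u: "u = r ^ d"
    and M: "squarefree M" "coprime M r" and N: "N = r ^ e * M"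
    and tot: "\<And>k. k < d \<Longrightarrow> totient (r ^ k) = 1"
    and S: "coprime c u" "S 1" "\<And>a b. S a \<Longrightarrow> S b \<Longrightarrow> S (a * b)" "\<And>n. [n = c] (mod u) \<Longrightarrow> \<not> S n"
    and gen: "\<And>p m. coprime p u \<Longrightarrow> \<not> S p \<Longrightarrow> coprime m u \<Longrightarrow> \<exists>k. [p ^ k = m] (mod u)"
    and nonunit: "\<And>m. \<not> coprime m u \<Longrightarrow> \<exists>z. \<forall>b. coprime b u \<longrightarrow> unity_root u b ^ m = z"
    and per: "\<And>chi n. chi \<in> set chs \<Longrightarrow> chi (n + int u) = chi n"
    and span: "\<And>w. weight u w \<Longrightarrow> \<exists>\<alpha>. \<forall>n. of_real (w n) = (\<Sum>i<length chs. \<alpha> i * cnj ((chs ! i) n))"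
    and f: "meromorphic_modular_function k N f" "cuspidal_divisor f"
  shows "is_quotient_of_level (dedekind_eta # map (eta_character u) chs) N f"
proof -
  have r1: "r > 1" using r by (rule prime_gt_1_nat)
  have M0: "M > 0" using M(1) by (metis gr0I not_squarefree_0)
  have N0: "N > 0" using M0 r1 by (simp add: N)
  have "r ^ 1 \<le> r ^ d" using d r1 by (intro power_increasing) auto
  then have u2: "u \<ge> 2" using r1 by (simp add: u)
  have Mu: "coprime M u" using M(2) by (simp add: u)
  obtain p where p: "prime p" "coprime p M" "coprime p u" "\<not> S p"
    using exists_prime_outside[where M = M and u = u and c = c and S = S] Mu S u2 by auto
  have "coprime p r" using p(3) d by (simp add: u coprime_power_right_iff)
  then have pN: "coprime p N" using p(2) by (simp add: N)
  have uN: "u\<^sup>2 dvd N" using e(1) by (simp add: u N power_mult[symmetric] le_imp_power_dvd mult.commute[of d] dvd_mult2)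
  have sq: "g = u \<or> totient g = 1" if g: "g\<^sup>2 dvd N" for g
  proof -
    obtain k where k: "g = r ^ k" "2 * k \<le> e"
      using square_dvd_prime_power_times_squarefree[OF r M g[unfolded N]] by blast
    then have "k < d \<or> k = d" using e(2) by linarith
    then show ?thesis using tot k(1) u by auto
  qed
  obtain C x W where W: "\<And>t. weight u (W t)" "\<And>t n. \<not> t dvd N div u\<^sup>2 \<Longrightarrow> W t n = 0" and
    rep: "\<And>\<tau>. Im \<tau> > 0 \<Longrightarrow> f \<tau> = exp (C + (\<Sum>t | t dvd N. of_real (x t :: real) * log_eta (of_nat t * \<tau>) +
       weighted_product u (W t) (nome (of_nat t * \<tau>))))"
    using modular_unit_representation[OF N0 u2 uN sq p(1) pN gen[OF p(3,4)] nonunit f] by blast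
  show ?thesis
    by (rule quotient_from_representation[OF N0 _ W per span rep]) (use u2 in auto)
qed

lemma nonunit_prime:
  assumes "prime u" "\<not> coprime m u" shows "\<exists>z. \<forall>b. coprime b u \<longrightarrow> unity_root u b ^ m = z"
proof -
  have "u dvd m" using assms by (metis coprime_commute prime_imp_coprime)
  then have "[m = 0] (mod u)" by (simp add: cong_0_iff)
  then have "unity_root u b ^ m = unity_root u b ^ 0" for b using assms(1) by (intro unity_root_mod_power) (simp add: prime_gt_0_nat)
  then show ?thesis by simp
qed

lemma coprime_4_iff: "coprime m 4 \<longleftrightarrow> odd m" for m :: nat
  using coprime_power_right_iff[of m 2 2] by simp

text \<open>The modulus is not prime, so besides m = 0 there is the class m = 2. There the value is
  i^(2b) = (-1)^b, which is -1 for every odd b.\<close>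

lemma nonunit_4:
  assumes "\<not> coprime m 4" shows "\<exists>z. \<forall>b. coprime b 4 \<longrightarrow> unity_root 4 b ^ m = z"
proof -
  have "even m" using assms by (simp add: coprime_4_iff)
  then have "m mod 4 = 0 \<or> m mod 4 = 2" by presburger
  then show ?thesis
  proof
    assume "m mod 4 = 0"
    then have "[m = 0] (mod 4)" by (simp add: cong_def)
    then have "unity_root 4 b ^ m = unity_root 4 b ^ 0" for b by (rule unity_root_mod_power[rotated]) simp
    then show ?thesis by auto
  next
    assume "m mod 4 = 2"
    then have "[m = 2] (mod 4)" by (simp add: cong_def)
    then have 1: "unity_root 4 b ^ m = unity_root 4 b ^ 2" for b by (rule unity_root_mod_power[rotated]) simp
    have "unity_root 4 b ^ 2 = -1" if "coprime b 4" for b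
    proof -
      have "unity_root 4 1 ^ 2 = exp (of_real pi * \<i>)" by (simp add: exp_of_nat_mult[symmetric] mult_ac)
      then have "unity_root 4 1 ^ 2 = -1" by simp
      moreover have "unity_root 4 b = unity_root 4 1 ^ b" by (simp add: exp_of_nat_mult[symmetric] mult_ac)
      then have "unity_root 4 b ^ 2 = (unity_root 4 1 ^ 2) ^ b" by (simp only: power_mult[symmetric] mult.commute)
      ultimately show ?thesis using that by (simp add: coprime_4_iff)
    qed
    then show ?thesis using 1 by auto
  qed
qed

lemma generator_3:
  fixes p m :: nat
  assumes "coprime p 3" "p mod 3 \<noteq> 1" "coprime m 3" shows "\<exists>k. [p ^ k = m] (mod 3)"
proof -
  have "p mod 3 \<noteq> 0" "m mod 3 \<noteq> 0" using coprime_not_dvd[of _ 3] assms by (auto simp: dvd_eq_mod_eq_0)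
  then have "p mod 3 = 2" "m mod 3 = 1 \<or> m mod 3 = 2" using assms(2) by presburger+
  then have "[p ^ 0 = m] (mod 3) \<or> [p ^ 1 = m] (mod 3)" by (auto simp: cong_def)
  then show ?thesis by blast
qed

lemma generator_4:
  fixes p m :: nat
  assumes "coprime p 4" "p mod 4 \<noteq> 1" "coprime m 4" shows "\<exists>k. [p ^ k = m] (mod 4)"
proof -
  have "odd p" "odd m" using assms by (simp_all add: coprime_4_iff)
  then have "p mod 4 = 3" "m mod 4 = 1 \<or> m mod 4 = 3" using assms(2) by presburger+
  then have "[p ^ 0 = m] (mod 4) \<or> [p ^ 1 = m] (mod 4)" by (auto simp: cong_def)
  then show ?thesis by blast
qed

text \<open>In the cyclic group of order 4 every nonsquare is a generator, so an exponent at most 3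
  suffices.\<close>

lemma generator_5:
  fixes p m :: nat
  assumes "coprime p 5" "\<not> (p mod 5 = 1 \<or> p mod 5 = 4)" "coprime m 5" shows "\<exists>k. [p ^ k = m] (mod 5)"
proof -
  have "p mod 5 \<noteq> 0" "m mod 5 \<noteq> 0" using coprime_not_dvd[of _ 5] assms by (auto simp: dvd_eq_mod_eq_0)
  then have pm: "p mod 5 = 2 \<or> p mod 5 = 3" "m mod 5 = 1 \<or> m mod 5 = 2 \<or> m mod 5 = 3 \<or> m mod 5 = 4"
    using assms(2) by presburger+
  have k: "[p ^ k = m] (mod 5) \<longleftrightarrow> (p mod 5) ^ k mod 5 = m mod 5" for k
    by (simp add: cong_def power_mod)
  have "(p mod 5) ^ 0 mod 5 = m mod 5 \<or> (p mod 5) ^ 1 mod 5 = m mod 5 \<or> (p mod 5) ^ 2 mod 5 = m mod 5 \<or> (p mod 5) ^ 3 mod 5 = m mod 5"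
    using pm by auto
  then show ?thesis unfolding k[symmetric] by blast
qed

theorem theorem4:
  fixes chi1 chi2 \<psi> :: "int \<Rightarrow> complex"
    and f :: "complex \<Rightarrow> complex" and k :: int and N :: nat
  assumes "primitive_character 5 chi1" and "primitive_character 5 chi2"
    and "chi1 \<noteq> legendre_character 5" and "chi2 \<noteq> legendre_character 5" and "chi1 \<noteq> chi2"
    and "dirichlet_character 4 \<psi>" and "\<psi> \<noteq> principal_character 4"
    and "meromorphic_modular_function k N f"
    and "cuspidal_divisor f"
  shows
    "(\<forall>M. (N = 9 * M \<or> N = 27 * M) \<and> squarefree M \<and> coprime M 3 \<longrightarrow>
        is_quotient_of_level
          [dedekind_eta, eta_character 3 (legendre_character 3)] N f) \<and>
     (\<forall>M. (N = 16 * M \<or> N = 32 * M) \<and> odd M \<and> squarefree M \<longrightarrow>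
        is_quotient_of_level
          [dedekind_eta, eta_character 4 \<psi>] N f) \<and>
     (\<forall>M. (N = 25 * M \<or> N = 125 * M) \<and> squarefree M \<and> coprime M 5 \<longrightarrow>
        is_quotient_of_level
          [dedekind_eta, eta_character 5 (legendre_character 5),
           eta_character 5 chi1, eta_character 5 chi2] N f)"
proof (intro conjI allI impI)
  fix M :: nat
  assume M: "(N = 9 * M \<or> N = 27 * M) \<and> squarefree M \<and> coprime M 3"
  then have "N = 3 ^ 2 * M \<or> N = 3 ^ 3 * M" by auto
  then obtain e where e: "e = 2 \<or> e = 3" "N = 3 ^ e * M" by blast
  have "is_quotient_of_level (dedekind_eta # map (eta_character 3) [legendre_character 3]) N f"
  \<comment> \<open>A unit modulo 3 generates as soon as it differs from 1, so S is the class of 1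
    and 2 lies outside it.\<close>
  proof (rule quotient_of_level_prime_power[where r = 3 and d = 1 and e = e and M = M and c = 2 and S = "\<lambda>m. m mod 3 = 1" and k = k])
    show "coprime 2 (3::nat)" by simp
    show "(a * b) mod 3 = 1" if "a mod 3 = 1" "b mod 3 = 1" for a b :: nat
      using mod_mult_eq[of a 3 b] that by simp
    show "chi (n + int 3) = chi n" if "chi \<in> set [legendre_character 3]" for chi n
      using that legendre_period[of 3] by simp
  qed (use M e assms(8,9) generator_3 nonunit_prime[of 3] span_3 in \<open>auto simp: cong_def\<close>)
  then show "is_quotient_of_level [dedekind_eta, eta_character 3 (legendre_character 3)] N f" by simp
next
  fix M :: nat
  assume M: "(N = 16 * M \<or> N = 32 * M) \<and> odd M \<and> squarefree M"
  then have "N = 2 ^ 4 * M \<or> N = 2 ^ 5 * M" by auto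
  then obtain e where e: "e = 4 \<or> e = 5" "N = 2 ^ e * M" by blast
  have "is_quotient_of_level (dedekind_eta # map (eta_character 4) [\<psi>]) N f"
  \<comment> \<open>Here u = 4 = 2^2. The value g = 2 may occur besides 1 and 4, which is harmless
    since totient 2 = 1.\<close>
  proof (rule quotient_of_level_prime_power[where r = 2 and d = 2 and e = e and M = M and c = 3 and S = "\<lambda>m. m mod 4 = 1" and k = k])
    show "coprime 3 (4::nat)" by (simp add: coprime_4_iff)
    show "(a * b) mod 4 = 1" if "a mod 4 = 1" "b mod 4 = 1" for a b :: nat
      using mod_mult_eq[of a 4 b] that by simp
    show "chi (n + int 4) = chi n" if "chi \<in> set [\<psi>]" for chi n
      using that assms(6) by (simp add: dirichlet_character_def)
    show "totient (2 ^ k) = 1" if "k < 2" for k :: nat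
      using that by (cases k) auto
  qed (use M e assms(8,9) generator_4 nonunit_4 span_4[OF assms(6,7)] in \<open>auto simp: cong_def\<close>)
  then show "is_quotient_of_level [dedekind_eta, eta_character 4 \<psi>] N f" by simp
next
  fix M :: nat
  assume M: "(N = 25 * M \<or> N = 125 * M) \<and> squarefree M \<and> coprime M 5"
  then have "N = 5 ^ 2 * M \<or> N = 5 ^ 3 * M" by auto
  then obtain e where e: "e = 2 \<or> e = 3" "N = 5 ^ e * M" by blast
  have "is_quotient_of_level (dedekind_eta # map (eta_character 5) [legendre_character 5, chi1, chi2]) N f"
  \<comment> \<open>The units modulo 5 that fail to generate are the squares 1 and 4. They make up
    S, and c = 2 is a nonsquare.\<close>
  proof (rule quotient_of_level_prime_power[where r = 5 and d = 1 and e = e and M = M and c = 2 and S = "\<lambda>m. m mod 5 = 1 \<or> m mod 5 = 4" and k = k])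
    show "coprime 2 (5::nat)" by simp
    show "(a * b) mod 5 = 1 \<or> (a * b) mod 5 = 4" if "a mod 5 = 1 \<or> a mod 5 = 4" "b mod 5 = 1 \<or> b mod 5 = 4" for a b :: nat
      using mod_mult_eq[of a 5 b] that by auto
    show "chi (n + int 5) = chi n" if "chi \<in> set [legendre_character 5, chi1, chi2]" for chi n
      using that legendre_period[of 5] assms(1,2) by (auto simp: primitive_character_def dirichlet_character_def)
  qed (use M e assms(8,9) generator_5 nonunit_prime[of 5] span_5[OF assms(1,3,2,4,5)] in \<open>auto simp: cong_def\<close>)
  then show "is_quotient_of_level
          [dedekind_eta, eta_character 5 (legendre_character 5),
           eta_character 5 chi1, eta_character 5 chi2] N f" by simp
qed

end
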